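(* Let $\mathcal D_n=(G_n,p_n)$, $n\ge 1$, be a sequence of spherical geodesic drawings with $|V(G_n)|=n$ which is uniform on the sphere, and suppose $2|E(G_n)|/n^2=e+o(1)$ as $n\to\infty$ for some $e\in[0,1]$. Let $t\in[0,\pi]$ be determined by $\cos t=1-2e$. Then \[ \operatorname{cr}(\mathcal D_n)\ \ge\ \frac{n^4}{64\pi^2}\bigl(\sin t-t\cos t\bigr)^2-o(n^4). \]
   Context: $\mathbb S^2\subset\mathbb R^3$ is the unit sphere. A drawing of a simple graph $G$ represents vertices by distinct points and edges by simple curves joining their endpoints; it is good if no edge contains a vertex in its relative interior, no two edges are tangent or meet in infinitely many points, and no three edges share an interior point. A crossing is an intersection point of two edges that is not a vertex; $\operatorname{cr}(\mathcal D)$ is the number of crossings of the drawing $\mathcal D$. A spherical geodesic drawing $\mathcal D=(G,p)$ of $G=(V,E)$ is a good drawing given by an injective map $p:V\to\mathbb S^2$ such that no adjacent pair is mapped to antipodal points, each edge $uv$ being drawn as the shorter great-circle arc between $p(u)$ and $p(v)$. The sequence is uniform on the sphere if the empirical measures $\frac1n\sum_{v\in V(G_n)}\delta_{p_n(v)}$ converge weakly to the normalized area measure $\sigma/(4\pi)$ on $\mathbb S^2$ ($\sigma$ = spherical area measure), i.e. $\frac1n\sum_v F(p_n(v))\to\int F\,d\sigma/(4\pi)$ for every continuous $F:\mathbb S^2\to\mathbb R$. *)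

theory Defs
  imports "HOL-Analysis.Analysis" "HOL-Library.Landau_Symbols"
begin

definition simple_graph :: "'v set \<Rightarrow> 'v set set \<Rightarrow> bool" where
  "simple_graph V E \<longleftrightarrow> finite V \<and> (\<forall>e\<in>E. e \<subseteq> V \<and> card e = 2)"

text \<open>The arc is traversed at unit speed from \<open>a\<close> to \<open>b\<close> inside the great circle through
  \<open>a\<close> and \<open>b\<close>; its length is the angle between them. This is the shorter of the two arcs
  joining \<open>a\<close> and \<open>b\<close>, provided that \<open>a\<close> and \<open>b\<close> are distinct unit vectors with \<open>a \<noteq> - b\<close>;
  it is used only in that case.\<close>

definition shorter_arc :: "real^3 \<Rightarrow> real^3 \<Rightarrow> (real^3) set" where
  "shorter_arc a b = (let \<theta> = arccos (a \<bullet> b) in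
     (\<lambda>s. (sin (\<theta> - s) / sin \<theta>) *\<^sub>R a + (sin s / sin \<theta>) *\<^sub>R b) ` {0..\<theta>})"

text \<open>For an edge \<open>e = {u, v}\<close> both terms of the union are the same set, since
  \<open>shorter_arc\<close> is symmetric in its arguments.\<close>

definition edge_arc :: "('v \<Rightarrow> real^3) \<Rightarrow> 'v set \<Rightarrow> (real^3) set" where
  "edge_arc p e = (\<Union>u\<in>e. \<Union>v\<in>e - {u}. shorter_arc (p u) (p v))"

definition edge_interior :: "('v \<Rightarrow> real^3) \<Rightarrow> 'v set \<Rightarrow> (real^3) set" where
  "edge_interior p e = edge_arc p e - p ` e"

text \<open>The tangent line (as a linear subspace) at \<open>x\<close> of the great circle
  \<open>sphere 0 1 \<inter> span (p ` e)\<close> containing the edge.\<close>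

definition edge_tangent_line :: "('v \<Rightarrow> real^3) \<Rightarrow> 'v set \<Rightarrow> real^3 \<Rightarrow> (real^3) set" where
  "edge_tangent_line p e x = {w \<in> span (p ` e). w \<bullet> x = 0}"

text \<open>Tangency concerns common relative interior points only: two edges that share an endpoint
  and leave it in opposite directions along one great circle do not count as tangent.\<close>

definition edges_tangent :: "('v \<Rightarrow> real^3) \<Rightarrow> 'v set \<Rightarrow> 'v set \<Rightarrow> bool" where
  "edges_tangent p e f \<longleftrightarrow>
     (\<exists>x \<in> edge_interior p e \<inter> edge_interior p f.
        edge_tangent_line p e x = edge_tangent_line p f x)"

definition good_drawing :: "'v set \<Rightarrow> 'v set set \<Rightarrow> ('v \<Rightarrow> real^3) \<Rightarrow> bool" where
  "good_drawing V E p \<longleftrightarrow>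
     (\<forall>e\<in>E. edge_interior p e \<inter> p ` V = {}) \<and>
     (\<forall>e\<in>E. \<forall>f\<in>E. e \<noteq> f \<longrightarrow>
        \<not> edges_tangent p e f \<and> finite (edge_arc p e \<inter> edge_arc p f)) \<and>
     (\<forall>e\<in>E. \<forall>f\<in>E. \<forall>g\<in>E. e \<noteq> f \<and> f \<noteq> g \<and> e \<noteq> g \<longrightarrow>
        edge_interior p e \<inter> edge_interior p f \<inter> edge_interior p g = {})"

definition spherical_geodesic_drawing ::
    "'v set \<Rightarrow> 'v set set \<Rightarrow> ('v \<Rightarrow> real^3) \<Rightarrow> bool" where
  "spherical_geodesic_drawing V E p \<longleftrightarrow>
     simple_graph V E \<and> p ` V \<subseteq> sphere 0 1 \<and> inj_on p V \<and>
     (\<forall>u v. {u, v} \<in> E \<longrightarrow> p u \<noteq> - p v) \<and>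
     good_drawing V E p"

definition crossings :: "'v set \<Rightarrow> 'v set set \<Rightarrow> ('v \<Rightarrow> real^3) \<Rightarrow> (real^3) set" where
  "crossings V E p =
     {x. \<exists>e\<in>E. \<exists>f\<in>E. e \<noteq> f \<and> x \<in> edge_arc p e \<inter> edge_arc p f \<and> x \<notin> p ` V}"

definition crossing_count :: "'v set \<Rightarrow> 'v set set \<Rightarrow> ('v \<Rightarrow> real^3) \<Rightarrow> nat" where
  "crossing_count V E p = card (crossings V E p)"

text \<open>Surface measure on the unit sphere in the usual polar-coordinates form: the area of \<open>A\<close>
  is 3 times the volume of the cone \<open>{r x | 0 < r \<le> 1, x \<in> A}\<close>, which is the preimage of
  \<open>A\<close> under \<open>sgn\<close> (that is, \<open>x \<mapsto> x / norm x\<close>) in the punctured unit ball. The measure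
  space is the sphere itself, so functions on it need not be measurable off the sphere.\<close>

definition sphere_area :: "(real^3) measure" where
  "sphere_area = scale_measure 3
     (distr (restrict_space lborel (cball 0 1 - {0})) (restrict_space borel (sphere 0 1)) sgn)"

lemma space_sphere_area: "space sphere_area = sphere 0 1"
  by (simp add: sphere_area_def space_restrict_space space_scale_measure)

lemma sgn_measurable_sphere:
  "sgn \<in> measurable (restrict_space lborel (cball 0 1 - {0})) 
           (restrict_space borel (sphere (0 :: real^3) 1))"
proof -
  have "(\<lambda>x :: real^3. x /\<^sub>R norm x) \<in> borel_measurable borel"
    by measurable
  then have "(sgn :: real^3 \<Rightarrow> _) \<in> measurable (restrict_space lborel (cball 0 1 - {0})) borel"
    by (intro measurable_restrict_space1) (simp add: sgn_div_norm)
  then show ?thesis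
    by (intro measurable_restrict_space2) (auto simp: space_restrict_space norm_sgn)
qed

lemma emeasure_sphere_area:
  assumes "A \<in> sets borel" "A \<subseteq> sphere 0 1"
  shows "emeasure sphere_area A = 3 * emeasure lborel {x \<in> cball 0 1 - {0}. sgn x \<in> A}"
proof -
  have A: "A \<in> sets (restrict_space borel (sphere (0::real^3) 1))"
    using assms by (auto simp: sets_restrict_space)
  have "sgn -` A \<inter> (cball 0 1 - {0}) = {x \<in> cball 0 1 - {0}. sgn x \<in> A}"
    by auto
  moreover have "emeasure (restrict_space lborel (cball 0 1 - {0})) {x \<in> cball 0 1 - {0}. sgn x \<in> A}
      = emeasure lborel {x \<in> cball 0 1 - {0}. sgn x \<in> A}"
    by (intro emeasure_restrict_space) auto
  ultimately show ?thesis
    unfolding sphere_area_def using A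
    by (simp add: emeasure_distr[OF sgn_measurable_sphere] space_restrict_space)
qed

lemma emeasure_sphere_area_total: "emeasure sphere_area (sphere 0 1) = ennreal (4 * pi)"
proof -
  have "{x \<in> cball 0 1 - {0}. sgn x \<in> sphere (0::real^3) 1} = cball 0 1 - {0}"
    by (auto simp: norm_sgn)
  then have "emeasure sphere_area (sphere 0 1) = 3 * emeasure lborel (cball (0::real^3) 1 - {0})"
    by (simp add: emeasure_sphere_area)
  also have "emeasure lborel (cball (0::real^3) 1 - {0}) = emeasure lborel (cball (0::real^3) 1)"
    by (subst emeasure_Diff) auto
  also have "\<dots> = ennreal (4 / 3 * pi)"
    by (subst emeasure_cball) (simp_all add: unit_ball_vol_3)
  also have "3 * \<dots> = ennreal (4 * pi)"
    using ennreal_mult[of 3 "4 / 3 * pi"] by simp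
  finally show ?thesis .
qed

definition uniform_on_sphere :: "(nat \<Rightarrow> 'v set) \<Rightarrow> (nat \<Rightarrow> 'v \<Rightarrow> real^3) \<Rightarrow> bool" where
  "uniform_on_sphere V p \<longleftrightarrow>
     (\<forall>F :: real^3 \<Rightarrow> real. continuous_on (sphere 0 1) F \<longrightarrow>
        (\<lambda>n. 1 / real n * (\<Sum>v\<in>V n. F (p n v)))
          \<longlonglongrightarrow> (LINT x|sphere_area. F x) / (4 * pi))"

end

theory Submission imports Defs "HOL-Probability.Distribution_Functions"
begin

text \<open>Let \<open>W\<close> be a density of edges on pairs of points of the sphere, with values in \<open>[0, 1]\<close>. The
  crossings of \<open>W\<close> with itself are sorted by the crossing point \<open>Q\<close>. The arcs through \<open>Q\<close> lie on the great
  circles through \<open>Q\<close>; if \<open>m\<close> is the slope of such a circle and \<open>g m\<close> the amount of \<open>W\<close> on it, the density of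
  crossings at \<open>Q\<close> is the double integral of \<open>\<bar>m - m'\<bar> * g m * g m'\<close>. Young's inequality, together with the
  fact that a continuous distribution function is uniformly distributed, bounds it from below in terms
  of the integral of \<open>g powr (2/3)\<close>. On one great circle the mass \<open>g m\<close> is smallest, for a given amount of
  edges, if all arcs shorter than some angle \<open>\<tau>\<close> are present and no others (bathtub principle). Then the
  power \<open>2/3\<close> of the mass is a convex function of \<open>1 - cos \<tau>\<close>, that is of the edge density; replacing it by
  its tangent at \<open>\<tau> = t\<close> gives a bound that is linear in \<open>W\<close> and can be integrated over \<open>Q\<close>.

  A drawing is turned into such a density by a smoothing kernel, a partition of unity normalised by
  the areas of its members; uniformity of the drawing keeps the density below \<open>1 + o(1)\<close>.

  Integrals over the sphere are replaced by integrals of functions homogeneous of degree 0 over the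
  unit ball, so that linear substitutions apply.\<close>

subsection \<open>Integration in three-space\<close>

text \<open>The constant is the crossing density of the graph that joins all pairs at angle at most
  t. Such pairs form the fraction (1 - cos t) / 2 = e of all pairs, their arcs have total length
  about n^2 / 4 times \<open>cap_moment t\<close>, and two arcs of lengths a and b in independent
  random position have a b / (2 pi^2) crossings on average. Every inequality is arranged to be sharp
  there: the bathtub bound with threshold t, and Young's inequality because the slope density is
  then a multiple of (1 + m^2)^(-3/2). The obstacle is that only the total amount of edges is known,
  not how it is spread over points and great circles. Hence every nonlinear bound is replaced by a
  tangent at the extremal value before it is averaged, also the one on the line, where the parameter
  \<open>y\<close> does this. Moreover an arc is seen from its points Q in proportion to its length,
  so edges are recovered from the mass at Q through division by the angle; two quantities per great
  circle, the mass and the mass divided by the angle, run through the estimates. Since the integrals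
  take values in \<open>ennreal\<close>, inequalities are rearranged until no term has to be
  subtracted.\<close>

definition triple :: "real^3 \<Rightarrow> real^3 \<Rightarrow> real^3 \<Rightarrow> real" where
  "triple a b c = a \<bullet> cross3 b c"

lemma nn_integral_lborel_scaleR:
  fixes G :: "'a::euclidean_space \<Rightarrow> ennreal"
  assumes [measurable]: "G \<in> borel_measurable borel" and c: "c > 0"
  shows "(\<integral>\<^sup>+x. G x \<partial>lborel) = ennreal (c ^ DIM('a)) * (\<integral>\<^sup>+x. G (c *\<^sub>R x) \<partial>lborel)"
proof -
  have "(\<integral>\<^sup>+x. G x \<partial>lborel) = (\<integral>\<^sup>+x. G x \<partial>density (distr lborel borel (\<lambda>x::'a. 0 + c *\<^sub>R x)) (\<lambda>_. \<bar>c\<bar> ^ DIM('a)))"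
    using lborel_affine[of c "0::'a"] c by simp
  also have "\<dots> = ennreal (c ^ DIM('a)) * (\<integral>\<^sup>+x. G (c *\<^sub>R x) \<partial>lborel)"
    using c by (simp add: nn_integral_density nn_integral_distr nn_integral_cmult)
  finally show ?thesis .
qed

text \<open>\<open>lborel\<close> is determined by its values on boxes, so it suffices to push it
  forward by f, rescale by the determinant and test a box. The preimage of a box is its image under
  the inverse map \<open>g\<close>, to which the volume formula for linear images applies.\<close>

lemma nn_integral_lborel_linear:
  fixes f :: "real^'n::{finite,wellorder} \<Rightarrow> real^'n::_" and G :: "_ \<Rightarrow> ennreal"
  assumes f: "linear f" and det: "det (matrix f) \<noteq> 0" and [measurable]: "G \<in> borel_measurable borel"
  shows "(\<integral>\<^sup>+x. G x \<partial>lborel) = ennreal \<bar>det (matrix f)\<bar> * (\<integral>\<^sup>+x. G (f x) \<partial>lborel)"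
proof -
  obtain B where B: "matrix f ** B = mat 1" "B ** matrix f = mat 1"
    using det invertible_det_nz[of "matrix f"] unfolding invertible_def by blast
  have fm: "matrix f *v x = f x" for x
    using matrix_vector_mul(2)[OF f] by metis
  define g where "g = (\<lambda>x. B *v x)"
  have fg: "f (g x) = x" for x
  proof -
    have "matrix f *v (B *v x) = x" by (simp only: matrix_vector_mul_assoc B matrix_vector_mul_lid)
    then show ?thesis by (simp only: fm g_def)
  qed
  have gf: "g (f x) = x" for x
  proof -
    have "B *v (matrix f *v x) = x" by (simp only: matrix_vector_mul_assoc B matrix_vector_mul_lid)
    then show ?thesis by (simp only: fm g_def)
  qed
  have lg: "linear g" unfolding g_def by (rule matrix_vector_mul_linear)
  have "det (matrix f) * det (matrix g) = 1"
    unfolding g_def matrix_of_matrix_vector_mul det_mul[symmetric] B by (rule det_I)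
  then have dets: "\<bar>det (matrix f)\<bar> * \<bar>det (matrix g)\<bar> = 1"
    by (metis abs_mult abs_one)
  have [measurable]: "f \<in> borel \<rightarrow>\<^sub>M borel"
    by (intro borel_measurable_continuous_onI linear_continuous_on linear_conv_bounded_linear[THEN iffD1] f)
  have "lborel = density (distr lborel borel f) (\<lambda>_. ennreal \<bar>det (matrix f)\<bar>)"
  proof (rule lborel_eqI)
    fix l u :: "real^'n::_" assume lu: "\<And>b. b \<in> Basis \<Longrightarrow> l \<bullet> b \<le> u \<bullet> b"
    have im: "f -` box l u = g ` box l u"
    proof (intro equalityI subsetI)
      fix x assume "x \<in> f -` box l u"
      then show "x \<in> g ` box l u" by (intro image_eqI[of x g "f x"]) (simp_all only: gf vimage_eq)
    next
      fix x assume "x \<in> g ` box l u"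
      then obtain y where "x = g y" "y \<in> box l u" by (rule imageE)
      then show "x \<in> f -` box l u" by (simp only: fg vimage_eq)
    qed
    have box: "box l u \<in> lmeasurable" by simp
    have gbox: "g ` box l u \<in> lmeasurable" "measure lebesgue (g ` box l u) = \<bar>det (matrix g)\<bar> * measure lebesgue (box l u)"
      using measurable_linear_image[OF lg box] measure_linear_image[OF lg box] by auto
    have m: "f -` box l u \<in> sets borel"
      by (rule measurable_sets_borel[of f borel]) simp_all
    have "emeasure lborel (f -` box l u) = emeasure lebesgue (g ` box l u)"
      using m im by simp
    also have "\<dots> = ennreal (\<bar>det (matrix g)\<bar> * measure lebesgue (box l u))"
      using gbox by (simp add: emeasure_eq_measure2)
    finally have e: "emeasure lborel (f -` box l u) = ennreal (\<bar>det (matrix g)\<bar> * measure lborel (box l u))"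
      by simp
    have "emeasure (density (distr lborel borel f) (\<lambda>_. ennreal \<bar>det (matrix f)\<bar>)) (box l u)
       = ennreal \<bar>det (matrix f)\<bar> * emeasure lborel (f -` box l u)"
      by (simp add: emeasure_density nn_integral_cmult_indicator emeasure_distr)
    also have "\<dots> = ennreal (measure lborel (box l u))"
      unfolding e using dets by (simp add: ennreal_mult[symmetric] mult.assoc[symmetric])
    also have "\<dots> = (\<Prod>b\<in>Basis. (u - l) \<bullet> b)"
      using lu by (simp add: measure_lborel_box_eq)
    finally show "emeasure (density (distr lborel borel f) (\<lambda>_. ennreal \<bar>det (matrix f)\<bar>)) (box l u)
       = ennreal (\<Prod>b\<in>Basis. (u - l) \<bullet> b)" .
  qed simp
  then have "(\<integral>\<^sup>+x. G x \<partial>lborel) = (\<integral>\<^sup>+x. G x \<partial>density (distr lborel borel f) (\<lambda>_. ennreal \<bar>det (matrix f)\<bar>))"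
    by simp
  also have "\<dots> = ennreal \<bar>det (matrix f)\<bar> * (\<integral>\<^sup>+x. G (f x) \<partial>lborel)"
    by (simp add: nn_integral_density nn_integral_distr nn_integral_cmult)
  finally show ?thesis .
qed

lemma emeasure_lborel_Times:
  assumes "A \<in> sets borel" "B \<in> sets borel"
  shows "emeasure lborel (A \<times> B) = emeasure lborel A * emeasure lborel B"
  using assms by (simp add: lborel_prod[symmetric] lborel.emeasure_pair_measure_Times)

lemma nn_integral_lborel_Pair:
  assumes "G \<in> borel_measurable borel"
  shows "(\<integral>\<^sup>+p. G p \<partial>lborel) = (\<integral>\<^sup>+x. \<integral>\<^sup>+y. G (x, y) \<partial>lborel \<partial>lborel)"
  using lborel.nn_integral_fst[of G lborel] assms by (simp add: lborel_prod)

lemma lborel_real3: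
  "distr lborel borel (\<lambda>(x, y, z). vector [x, y, z] :: real^3) = lborel"
proof (rule lborel_eqI[symmetric])
  let ?f = "\<lambda>(x, y, z). vector [x, y, z] :: real^3"
  have vec: "vector [x, y, z] = x *\<^sub>R axis 1 1 + y *\<^sub>R axis 2 1 + z *\<^sub>R (axis 3 1 :: real^3)" for x y z :: real
    by (simp add: vec_eq_iff forall_3 axis_def)
  have m:  "?f \<in> borel \<rightarrow>\<^sub>M borel"
    unfolding vec case_prod_beta by (intro borel_measurable_continuous_onI continuous_intros)
  fix l u :: "real^3" assume lu: "\<And>b. b \<in> Basis \<Longrightarrow> l \<bullet> b \<le> u \<bullet> b"
  have le: "l$i \<le> u$i" for i using lu[of "axis i 1"] by (simp add: inner_axis)
  have "?f -` box l u = {l$1<..<u$1} \<times> {l$2<..<u$2} \<times> {l$3<..<u$3}"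
    by (auto simp: mem_box_cart forall_3)
  moreover have "?f -` box l u \<inter> space lborel = ?f -` box l u" by simp
  ultimately have "emeasure (distr lborel borel ?f) (box l u) = emeasure lborel ({l$1<..<u$1} \<times> {l$2<..<u$2} \<times> {l$3<..<u$3})"
    using emeasure_distr[of ?f lborel borel "box l u"] m by simp
  moreover have "emeasure lborel ({l$1<..<u$1} \<times> {l$2<..<u$2} \<times> {l$3<..<u$3}) = ennreal ((u$1 - l$1) * ((u$2 - l$2) * (u$3 - l$3)))"
    using le[of 1] le[of 2] le[of 3] by (simp add: emeasure_lborel_Times borel_Times ennreal_mult)
  moreover have "(\<Prod>b\<in>Basis. (u - l) \<bullet> b) = (u$1 - l$1) * ((u$2 - l$2) * (u$3 - l$3))"
  proof -
    have B: "Basis = range (\<lambda>i. axis i 1 :: real^3)" by (auto simp: Basis_vec_def)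
    have inj: "inj (\<lambda>i. axis i 1 :: real^3)" by (auto simp: inj_on_def axis_eq_axis)
    have "(\<Prod>b\<in>Basis. (u - l) \<bullet> b) = (\<Prod>i\<in>UNIV. (u - l) \<bullet> axis i 1)"
      unfolding B by (subst prod.reindex[OF inj]) (simp add: o_def)
    also have "\<dots> = (\<Prod>i\<in>{1, 2, 3}. (u - l) \<bullet> axis i 1)" by (simp only: UNIV_3)
    also have "\<dots> = (u$1 - l$1) * ((u$2 - l$2) * (u$3 - l$3))" by (simp add: inner_axis)
    finally show ?thesis .
  qed
  ultimately show "emeasure (distr lborel borel ?f) (box l u) = ennreal (\<Prod>b\<in>Basis. (u - l) \<bullet> b)"
    by simp
qed simp

lemma nn_integral_real3:
  fixes G :: "real^3 \<Rightarrow> ennreal"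
  assumes [measurable]: "G \<in> borel_measurable borel"
  shows "(\<integral>\<^sup>+x. G x \<partial>lborel) = (\<integral>\<^sup>+x. \<integral>\<^sup>+y. \<integral>\<^sup>+z. G (vector [x, y, z]) \<partial>lborel \<partial>lborel \<partial>lborel)"
proof -
  have vec: "vector [x, y, z] = x *\<^sub>R axis 1 1 + y *\<^sub>R axis 2 1 + z *\<^sub>R (axis 3 1 :: real^3)" for x y z :: real
    by (simp add: vec_eq_iff forall_3 axis_def)
  have [measurable]: "(\<lambda>(x, y, z). vector [x, y, z] :: real^3) \<in> borel \<rightarrow>\<^sub>M borel"
    unfolding vec case_prod_beta by (intro borel_measurable_continuous_onI continuous_intros)
  have "(\<integral>\<^sup>+x. G x \<partial>lborel) = (\<integral>\<^sup>+p. G (case p of (x, y, z) \<Rightarrow> vector [x, y, z]) \<partial>lborel)"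
    by (subst lborel_real3[symmetric]) (simp add: nn_integral_distr)
  also have "\<dots> = (\<integral>\<^sup>+x. \<integral>\<^sup>+q. G (case q of (y, z) \<Rightarrow> vector [x, y, z]) \<partial>lborel \<partial>lborel)"
    by (subst nn_integral_lborel_Pair) simp_all
  also have "\<dots> = (\<integral>\<^sup>+x. \<integral>\<^sup>+y. \<integral>\<^sup>+z. G (vector [x, y, z]) \<partial>lborel \<partial>lborel \<partial>lborel)"
  proof (intro nn_integral_cong)
    fix x :: real
    have [measurable]: "(\<lambda>(y, z). vector [x, y, z] :: real^3) \<in> borel \<rightarrow>\<^sub>M borel"
      unfolding vec case_prod_beta by (intro borel_measurable_continuous_onI continuous_intros)
    show "(\<integral>\<^sup>+q. G (case q of (y, z) \<Rightarrow> vector [x, y, z]) \<partial>lborel) = (\<integral>\<^sup>+y. \<integral>\<^sup>+z. G (vector [x, y, z]) \<partial>lborel \<partial>lborel)"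
      by (subst nn_integral_lborel_Pair) simp_all
  qed
  finally show ?thesis .
qed

text \<open>The triple product is the determinant of the coordinate map. This is applied to two
  bases: X, Y, -X' for the fourth end of a pair of crossing arcs, and a frame with one axis along
  the crossing point.\<close>

lemma nn_integral_real3_frame:
  fixes G :: "real^3 \<Rightarrow> ennreal"
  assumes [measurable]: "G \<in> borel_measurable borel" and T: "triple a b c \<noteq> 0"
  shows "(\<integral>\<^sup>+x. G x \<partial>lborel) = ennreal \<bar>triple a b c\<bar> *
    (\<integral>\<^sup>+x. \<integral>\<^sup>+y. \<integral>\<^sup>+z. G (x *\<^sub>R a + y *\<^sub>R b + z *\<^sub>R c) \<partial>lborel \<partial>lborel \<partial>lborel)"
proof -
  define f where "f = (\<lambda>v::real^3. v$1 *\<^sub>R a + v$2 *\<^sub>R b + v$3 *\<^sub>R c)"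
  have lin: "linear f" unfolding f_def
    by (intro linearI) (auto simp: algebra_simps)
  have "det (matrix f) = triple a b c"
    unfolding triple_def dot_cross_det det_3 by (simp add: matrix_def f_def axis_def algebra_simps)
  then have d: "det (matrix f) = triple a b c" .
  have [measurable]: "f \<in> borel \<rightarrow>\<^sub>M borel"
    by (intro borel_measurable_continuous_onI linear_continuous_on linear_conv_bounded_linear[THEN iffD1] lin)
  have "(\<integral>\<^sup>+x. G x \<partial>lborel) = ennreal \<bar>triple a b c\<bar> * (\<integral>\<^sup>+x. G (f x) \<partial>lborel)"
    unfolding d[symmetric] by (rule nn_integral_lborel_linear[OF lin _ assms(1)]) (simp only: d T not_False_eq_True)
  also have "(\<integral>\<^sup>+x. G (f x) \<partial>lborel) = (\<integral>\<^sup>+x. \<integral>\<^sup>+y. \<integral>\<^sup>+z. G (f (vector [x, y, z])) \<partial>lborel \<partial>lborel \<partial>lborel)"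
    by (rule nn_integral_real3) measurable
  also have "\<dots> = (\<integral>\<^sup>+x. \<integral>\<^sup>+y. \<integral>\<^sup>+z. G (x *\<^sub>R a + y *\<^sub>R b + z *\<^sub>R c) \<partial>lborel \<partial>lborel \<partial>lborel)"
    by (simp only: f_def vector_3)
  finally show ?thesis .
qed

section \<open>Radial scaling and homogeneous functions\<close>

lemma nn_integral_inverse_pow4:
  assumes "r > 0"
  shows "(\<integral>\<^sup>+s. ennreal (1 / s^4) * indicator {r..} s \<partial>lborel) = ennreal (1 / (3 * r^3))"
proof -
  have "(\<integral>\<^sup>+s. ennreal (1 / s^4) * indicator {r..} s \<partial>lborel) = ennreal (0 - (- 1 / (3 * r^3)))"
  proof (rule nn_integral_FTC_atLeast)
    show "((\<lambda>s. - 1 / (3 * s^3)) has_real_derivative 1 / x^4) (at x)" if "r \<le> x" for x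
      using that assms by (auto intro!: derivative_eq_intros simp: field_simps power_eq_if)
    show "((\<lambda>s. - 1 / (3 * s^3)) \<longlongrightarrow> (0::real)) at_top"
      by (intro tendsto_divide_0[OF tendsto_const] filterlim_at_top_imp_at_infinity
          filterlim_tendsto_pos_mult_at_top[OF tendsto_const] filterlim_pow_at_top filterlim_ident) auto
  qed auto
  then show ?thesis by simp
qed

lemma nn_integral_sq_upto:
  assumes "r > 0"
  shows "(\<integral>\<^sup>+s. ennreal (3 * s^2 * r^3) * indicator {0<..} s * (if s * r \<le> 1 then 1 else 0) \<partial>lborel) = 1"
proof -
  have "(\<integral>\<^sup>+s. ennreal (3 * s^2 * r^3) * indicator {0<..} s * (if s * r \<le> 1 then 1 else 0) \<partial>lborel)
     = (\<integral>\<^sup>+s. ennreal (3 * s^2 * r^3) * indicator {0..1/r} s \<partial>lborel)"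
    using assms by (intro nn_integral_cong) (auto simp: indicator_def field_simps)
  also have "\<dots> = ennreal ((1/r)^3 * r^3 - 0^3 * r^3)"
    using assms by (intro nn_integral_FTC_Icc) (auto intro!: derivative_eq_intros)
  finally show ?thesis using assms by (simp add: power_divide)
qed

text \<open>In terms of y = s x the condition on x reads norm y <= s and the Jacobian is s^(-3), so
  y receives as weight the integral of s^(-4) over s >= norm y. The scale s will serve as a free
  coefficient in linear combinations; the price is the factor 3 and the density norm y ^
  (-3).\<close>

lemma nn_integral_ball_scale:
  fixes G :: "real^3 \<Rightarrow> ennreal"
  assumes [measurable]: "G \<in> borel_measurable borel"
  shows "(\<integral>\<^sup>+s. indicator {0<..} s * (\<integral>\<^sup>+x. indicator (cball 0 1) x * (ennreal (1/s) * G (s *\<^sub>R x)) \<partial>lborel) \<partial>lborel)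
       = (\<integral>\<^sup>+x. ennreal (1 / (3 * norm x ^ 3)) * G x \<partial>lborel)"
proof -
  have "(\<integral>\<^sup>+s. indicator {0<..} s * (\<integral>\<^sup>+x. indicator (cball 0 1) x * (ennreal (1/s) * G (s *\<^sub>R x)) \<partial>lborel) \<partial>lborel)
      = (\<integral>\<^sup>+s. \<integral>\<^sup>+x. ennreal (1/s^4) * indicator {0<..} s * (if norm x \<le> s then 1 else 0) * G x \<partial>lborel \<partial>lborel)"
  proof (intro nn_integral_cong)
    fix s :: real
    show "indicator {0<..} s * (\<integral>\<^sup>+x. indicator (cball 0 1) x * (ennreal (1/s) * G (s *\<^sub>R x)) \<partial>lborel)
      = (\<integral>\<^sup>+x. ennreal (1/s^4) * indicator {0<..} s * (if norm x \<le> s then 1 else 0) * G x \<partial>lborel)"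
    proof (cases "s > 0")
      case True
      have "(\<integral>\<^sup>+x. ennreal (1/s^4) * indicator {0<..} s * (if norm x \<le> s then 1 else 0) * G x \<partial>lborel)
         = ennreal (s^3) * (\<integral>\<^sup>+x. ennreal (1/s^4) * indicator {0<..} s * (if norm (s *\<^sub>R x) \<le> s then 1 else 0) * G (s *\<^sub>R x) \<partial>lborel)"
        using True by (subst nn_integral_lborel_scaleR[where c=s]) auto
      also have "\<dots> = (\<integral>\<^sup>+x. ennreal (s^3) * (ennreal (1/s^4) * indicator {0<..} s * (if norm (s *\<^sub>R x) \<le> s then 1 else 0) * G (s *\<^sub>R x)) \<partial>lborel)"
        by (rule nn_integral_cmult[symmetric]) measurable
      also have "\<dots> = (\<integral>\<^sup>+x. indicator (cball 0 1) x * (ennreal (1/s) * G (s *\<^sub>R x)) \<partial>lborel)"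
      proof (intro nn_integral_cong)
        fix x :: "real^3"
        have "ennreal (s^3) * ennreal (1/s^4) = ennreal (1/s)"
          using True by (simp add: ennreal_mult[symmetric] power_eq_if)
        moreover have "s * norm x \<le> s \<longleftrightarrow> norm x \<le> 1" using True by simp
        ultimately show "ennreal (s^3) * (ennreal (1/s^4) * indicator {0<..} s * (if norm (s *\<^sub>R x) \<le> s then 1 else 0) * G (s *\<^sub>R x))
          = indicator (cball 0 1) x * (ennreal (1/s) * G (s *\<^sub>R x))"
          using True by (simp add: indicator_def mult.assoc[symmetric])
      qed
      finally show ?thesis using True by simp
    qed simp
  qed
  also have "\<dots> = (\<integral>\<^sup>+x. \<integral>\<^sup>+s. ennreal (1/s^4) * indicator {0<..} s * (if norm x \<le> s then 1 else 0) * G x \<partial>lborel \<partial>lborel)"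
    by (rule lborel_pair.Fubini') measurable
  also have "\<dots> = (\<integral>\<^sup>+x. ennreal (1 / (3 * norm x ^ 3)) * G x \<partial>lborel)"
  proof (rule nn_integral_cong_AE)
    have "AE x in lborel. x \<noteq> (0::real^3)" by (rule AE_lborel_singleton)
    then show "AE x in lborel. (\<integral>\<^sup>+s. ennreal (1/s^4) * indicator {0<..} s * (if norm x \<le> s then 1 else 0) * G x \<partial>lborel) = ennreal (1 / (3 * norm x ^ 3)) * G x"
    proof eventually_elim
      case (elim x)
      have "(\<integral>\<^sup>+s. ennreal (1/s^4) * indicator {0<..} s * (if norm x \<le> s then 1 else 0) * G x \<partial>lborel)
         = (\<integral>\<^sup>+s. ennreal (1/s^4) * indicator {norm x..} s \<partial>lborel) * G x"
        using elim by (subst nn_integral_multc[symmetric])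
          (auto intro!: nn_integral_cong simp: indicator_def, smt (verit) norm_le_zero_iff)
      then show ?case using elim by (simp add: nn_integral_inverse_pow4)
    qed
  qed
  finally show ?thesis .
qed

text \<open>Both sides are \<open>1/3\<close> of the integral of \<open>H\<close> over directions: a function homogeneous of degree
  \<open>- DIM('a)\<close> may be integrated against any homogeneous gauge.\<close>

lemma nn_integral_homogeneous_change:
  fixes H :: "'a::euclidean_space \<Rightarrow> ennreal" and N M :: "'a \<Rightarrow> real"
  assumes [measurable]: "H \<in> borel_measurable borel" "N \<in> borel_measurable borel" "M \<in> borel_measurable borel"
    and H: "\<And>c x. c > 0 \<Longrightarrow> H x = ennreal (c ^ DIM('a)) * H (c *\<^sub>R x)"
    and N: "\<And>c x. c > 0 \<Longrightarrow> N (c *\<^sub>R x) = c * N x"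
    and M: "\<And>c x. c > 0 \<Longrightarrow> M (c *\<^sub>R x) = c * M x"
    and pos: "\<And>x. H x \<noteq> 0 \<Longrightarrow> N x > 0 \<and> M x > 0"
  shows "(\<integral>\<^sup>+x. H x * (ennreal (N x ^ 3) * (if N x \<le> 1 then 1 else 0)) \<partial>lborel)
       = (\<integral>\<^sup>+x. H x * (ennreal (M x ^ 3) * (if M x \<le> 1 then 1 else 0)) \<partial>lborel)"
proof -
  \<comment> \<open>The two gauges are tied by a double integral in x and s. The integrand with the
    factor \<open>3 * s^2 * M x^3\<close> and the cutoff s M <= 1 gives back the N side, as this
    factor integrates to 1 over s. For fixed s, replacing x by s x identifies it with the integrand
    with \<open>3 * N x^3 / s^4\<close> and the cutoff N <= s, whose factor again integrates to 1
    and leaves the M side.\<close>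
  have scaled: "(\<integral>\<^sup>+x. H x * (ennreal (M x ^ 3) * (if M x \<le> 1 then 1 else 0)) *
          (ennreal (3 * N x^3) * (ennreal (1/s^4) * indicator {0<..} s * (if N x \<le> s then 1 else 0))) \<partial>lborel) = (\<integral>\<^sup>+x. H x * (ennreal (N x ^ 3) * (if N x \<le> 1 then 1 else 0)) *
          (ennreal (3 * s^2 * M x^3) * indicator {0<..} s * (if s * M x \<le> 1 then 1 else 0)) \<partial>lborel)" if s: "s > 0" for s
  proof -
      have "(\<integral>\<^sup>+x. H x * (ennreal (M x ^ 3) * (if M x \<le> 1 then 1 else 0)) *
          (ennreal (3 * N x^3) * (ennreal (1/s^4) * indicator {0<..} s * (if N x \<le> s then 1 else 0))) \<partial>lborel)
        = (\<integral>\<^sup>+x. ennreal (s^DIM('a)) * (H (s *\<^sub>R x) * (ennreal (M (s *\<^sub>R x) ^ 3) * (if M (s *\<^sub>R x) \<le> 1 then 1 else 0)) *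
          (ennreal (3 * N (s *\<^sub>R x)^3) * (ennreal (1/s^4) * indicator {0<..} s * (if N (s *\<^sub>R x) \<le> s then 1 else 0)))) \<partial>lborel)"
        using s by (subst nn_integral_lborel_scaleR[where c=s]) (simp_all add: nn_integral_cmult)
      also have "\<dots> = (\<integral>\<^sup>+x. H x * (ennreal (N x ^ 3) * (if N x \<le> 1 then 1 else 0)) *
          (ennreal (3 * s^2 * M x^3) * indicator {0<..} s * (if s * M x \<le> 1 then 1 else 0)) \<partial>lborel)"
      proof (intro nn_integral_cong)
        fix x :: 'a
        show "ennreal (s^DIM('a)) * (H (s *\<^sub>R x) * (ennreal (M (s *\<^sub>R x) ^ 3) * (if M (s *\<^sub>R x) \<le> 1 then 1 else 0)) *
          (ennreal (3 * N (s *\<^sub>R x)^3) * (ennreal (1/s^4) * indicator {0<..} s * (if N (s *\<^sub>R x) \<le> s then 1 else 0))))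
          = H x * (ennreal (N x ^ 3) * (if N x \<le> 1 then 1 else 0)) *
          (ennreal (3 * s^2 * M x^3) * indicator {0<..} s * (if s * M x \<le> 1 then 1 else 0))"
        proof (cases "H x = 0")
          case True
          then have "ennreal (s^DIM('a)) * H (s *\<^sub>R x) = 0" using H[OF s, of x] by simp
          with True show ?thesis by (simp add: mult.assoc[symmetric])
        next
          case False
          then have p: "N x > 0" "M x > 0" using pos by auto
          have i: "s * N x \<le> s \<longleftrightarrow> N x \<le> 1" using s by simp
          have e: "ennreal ((s * M x)^3) * (ennreal (3 * (s * N x)^3) * ennreal (1/s^4)) = ennreal (N x ^ 3) * ennreal (3 * s^2 * M x^3)"
            using p s by (simp add: ennreal_mult[symmetric] power_mult_distrib) (simp add: field_simps power_eq_if)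
          have "ennreal (s^DIM('a)) * (H (s *\<^sub>R x) * A * B) = H x * (A * B)" for A B
            unfolding H[OF s, of x] by (simp only: mult_ac)
          note pull = this
          show ?thesis
            unfolding N[OF s] M[OF s] pull using s i e by (simp add: mult_ac)
        qed
      qed
      finally show ?thesis .
  qed
  have "(\<integral>\<^sup>+x. H x * (ennreal (N x ^ 3) * (if N x \<le> 1 then 1 else 0)) \<partial>lborel)
     = (\<integral>\<^sup>+x. \<integral>\<^sup>+s. H x * (ennreal (N x ^ 3) * (if N x \<le> 1 then 1 else 0)) *
          (ennreal (3 * s^2 * M x^3) * indicator {0<..} s * (if s * M x \<le> 1 then 1 else 0)) \<partial>lborel \<partial>lborel)"
  proof (rule nn_integral_cong)
    fix x :: 'a
    show "H x * (ennreal (N x ^ 3) * (if N x \<le> 1 then 1 else 0)) =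
      (\<integral>\<^sup>+s. H x * (ennreal (N x ^ 3) * (if N x \<le> 1 then 1 else 0)) *
          (ennreal (3 * s^2 * M x^3) * indicator {0<..} s * (if s * M x \<le> 1 then 1 else 0)) \<partial>lborel)"
      using pos[of x] by (cases "H x = 0") (simp_all add: nn_integral_cmult nn_integral_sq_upto)
  qed
  also have "\<dots> = (\<integral>\<^sup>+s. \<integral>\<^sup>+x. H x * (ennreal (N x ^ 3) * (if N x \<le> 1 then 1 else 0)) *
          (ennreal (3 * s^2 * M x^3) * indicator {0<..} s * (if s * M x \<le> 1 then 1 else 0)) \<partial>lborel \<partial>lborel)"
    by (rule lborel_pair.Fubini') measurable
  also have "\<dots> = (\<integral>\<^sup>+s. \<integral>\<^sup>+x. H x * (ennreal (M x ^ 3) * (if M x \<le> 1 then 1 else 0)) *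
          (ennreal (3 * N x^3) * (ennreal (1/s^4) * indicator {0<..} s * (if N x \<le> s then 1 else 0))) \<partial>lborel \<partial>lborel)"
  proof (rule nn_integral_cong)
    fix s :: real
    show "(\<integral>\<^sup>+x. H x * (ennreal (N x ^ 3) * (if N x \<le> 1 then 1 else 0)) *
          (ennreal (3 * s^2 * M x^3) * indicator {0<..} s * (if s * M x \<le> 1 then 1 else 0)) \<partial>lborel) = (\<integral>\<^sup>+x. H x * (ennreal (M x ^ 3) * (if M x \<le> 1 then 1 else 0)) *
          (ennreal (3 * N x^3) * (ennreal (1/s^4) * indicator {0<..} s * (if N x \<le> s then 1 else 0))) \<partial>lborel)"
    proof (cases "s > 0")
      case True
      then show ?thesis by (rule scaled[symmetric])
    next
      case False
      then have "indicator {0<..} s = (0::ennreal)" by simp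
      then show ?thesis by (simp only: mult_zero_left mult_zero_right)
    qed
  qed
  also have "\<dots> = (\<integral>\<^sup>+x. \<integral>\<^sup>+s. H x * (ennreal (M x ^ 3) * (if M x \<le> 1 then 1 else 0)) *
          (ennreal (3 * N x^3) * (ennreal (1/s^4) * indicator {0<..} s * (if N x \<le> s then 1 else 0))) \<partial>lborel \<partial>lborel)"
    by (rule lborel_pair.Fubini') measurable
  also have "\<dots> = (\<integral>\<^sup>+x. H x * (ennreal (M x ^ 3) * (if M x \<le> 1 then 1 else 0)) \<partial>lborel)"
  proof (rule nn_integral_cong)
    fix x :: 'a
    show "(\<integral>\<^sup>+s. H x * (ennreal (M x ^ 3) * (if M x \<le> 1 then 1 else 0)) *
          (ennreal (3 * N x^3) * (ennreal (1/s^4) * indicator {0<..} s * (if N x \<le> s then 1 else 0))) \<partial>lborel)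
       = H x * (ennreal (M x ^ 3) * (if M x \<le> 1 then 1 else 0))"
    proof (cases "H x = 0")
      case False
      then have p: "N x > 0" using pos by auto
      have "(\<integral>\<^sup>+s. ennreal (1/s^4) * indicator {0<..} s * (if N x \<le> s then 1 else 0) \<partial>lborel) = (\<integral>\<^sup>+s. ennreal (1/s^4) * indicator {N x..} s \<partial>lborel)"
        using p by (intro nn_integral_cong) (auto simp: indicator_def)
      also have "\<dots> = ennreal (1 / (3 * N x^3))" using p by (rule nn_integral_inverse_pow4)
      finally have "ennreal (3 * N x^3) * (\<integral>\<^sup>+s. ennreal (1/s^4) * indicator {0<..} s * (if N x \<le> s then 1 else 0) \<partial>lborel) = 1"
        using p by (simp add: ennreal_mult[symmetric])
      then show ?thesis by (simp add: nn_integral_cmult)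
    qed simp
  qed
  finally show ?thesis .
qed

subsection \<open>A lower bound for the mean distance on the line\<close>

context finite_borel_measure
begin

text \<open>The sublevel set is a closed half-line, and by continuity the value u is attained
  exactly at its end, so flat pieces of the distribution function do no harm. The strict upper bound
  on u keeps the half-line bounded; it can be empty only for u = 0, as the distribution function
  tends to 0 at minus infinity.\<close>

lemma cdf_level_set:
  assumes atomless: "\<And>x. measure M {x} = 0" and u: "0 \<le> u" "u < measure M (space M)"
  shows "measure M {x. cdf M x \<le> u} = u"
proof -
  define S where "S = {x. cdf M x \<le> u}"
  have cont: "isCont (cdf M) x" for x
    using atomless isCont_cdf by blast
  show ?thesis
  proof (cases "S = {}")
    case True
    have "u = 0"
    proof (rule ccontr)
      assume "u \<noteq> 0"
      then have "u > 0" using u by simp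
      with cdf_lim_at_bot have "\<forall>\<^sub>F x in at_bot. cdf M x < u"
        by (rule order_tendstoD(2))
      then obtain x where "cdf M x < u"
        using eventually_happens by fastforce
      then have "x \<in> S" by (simp add: S_def)
      with True show False by simp
    qed
    with True show ?thesis by (simp add: S_def)
  next
    case False
    have "\<forall>\<^sub>F x in at_top. u < cdf M x"
      using cdf_lim_at_top u(2) by (rule order_tendstoD(1))
    then obtain b where b: "u < cdf M b"
      using eventually_happens by fastforce
    have bdd: "bdd_above S"
    proof
      fix x assume "x \<in> S"
      then show "x \<le> b"
        using b cdf_nondecreasing[of b x] by (cases "x \<le> b") (auto simp: S_def)
    qed
    define z where "z = Sup S"
    have "closed S" unfolding S_def
      by (intro closed_Collect_le continuous_intros continuous_at_imp_continuous_on ballI cont)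
    then have zS: "z \<in> S" unfolding z_def using closed_contains_Sup[OF False bdd] by simp
    have le: "u \<le> cdf M z"
    proof (rule ccontr)
      assume "\<not> u \<le> cdf M z"
      then have "\<forall>\<^sub>F x in at z. cdf M x < u"
        using cont[of z] by (intro order_tendstoD(2)[of _ "cdf M z"]) (auto simp: isCont_def)
      then have "\<forall>\<^sub>F x in at_right z. cdf M x < u"
        by (simp add: eventually_at_split)
      moreover have "\<forall>\<^sub>F x in at_right z. x > z" by (rule eventually_at_right_less)
      ultimately have "\<forall>\<^sub>F x in at_right z. x > z \<and> cdf M x < u" by eventually_elim auto
      then obtain x where "x > z" "cdf M x < u"
        using eventually_happens[of _ "at_right z"] by (auto simp: trivial_limit_at_right_real)
      then have "x \<in> S" by (simp add: S_def)
      then have "x \<le> z" unfolding z_def using bdd by (intro cSup_upper)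
      with \<open>x > z\<close> show False by simp
    qed
    have "S = {..z}"
    proof (intro equalityI subsetI)
      fix x assume "x \<in> S" then show "x \<in> {..z}" unfolding z_def using bdd by (simp add: cSup_upper)
    next
      fix x assume "x \<in> {..z}"
      then show "x \<in> S" using zS cdf_nondecreasing[of x z] by (simp add: S_def)
    qed
    then have "measure M S = cdf M z" by (simp add: cdf_def)
    also have "\<dots> = u" using le zS by (simp add: S_def)
    finally show ?thesis by (simp add: S_def)
  qed
qed

lemma cdf_measurable: "cdf M \<in> borel_measurable borel"
  by (intro borel_measurable_mono monoI cdf_nondecreasing)

text \<open>The probability integral transform. The total mass is left unnormalised and becomes the
  length of the interval.\<close>

lemma distr_cdf_uniform:
  assumes atomless: "\<And>x. measure M {x} = 0"
  shows "distr M borel (cdf M) = density lborel (indicator {0..measure M (space M)})"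
proof (rule measure_eqI_lessThan)
  let ?m = "measure M (space M)"
  have m[measurable]: "cdf M \<in> borel_measurable M"
    using cdf_measurable measurable_cong_sets[OF M_is_borel refl] by blast
  show "emeasure (distr M borel (cdf M)) {x<..} < \<infinity>" for x
    by (subst emeasure_distr) (simp_all add: m less_top[symmetric] emeasure_finite)
  show "emeasure (distr M borel (cdf M)) {x<..} = emeasure (density lborel (indicator {0..?m})) {x<..}" for x
  proof -
    have l: "emeasure (distr M borel (cdf M)) {x<..} = ennreal (measure M {z. x < cdf M z})"
      by (subst emeasure_distr) (simp_all add: m emeasure_eq_measure borel_UNIV vimage_def)
    have r: "emeasure (density lborel (indicator {0..?m})) {x<..} = emeasure lborel ({0..?m} \<inter> {x<..})"
      by (subst emeasure_density) (simp_all add: indicator_inter_arith[symmetric])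
    consider "x < 0" | "0 \<le> x" "x < ?m" | "?m \<le> x" by linarith
    then show ?thesis
    proof cases
      case 1
      have "x < cdf M z" for z using 1 cdf_nonneg[of z] by simp
      then have "{z. x < cdf M z} = space M" by (simp add: borel_UNIV)
      moreover have "{0..?m} \<inter> {x<..} = {0..?m}" using 1 by auto
      ultimately show ?thesis unfolding l r by simp
    next
      case 2
      have "{z. x < cdf M z} = space M - {z. cdf M z \<le> x}" by (auto simp: borel_UNIV)
      moreover have "{z. cdf M z \<le> x} \<in> sets M"
      proof -
        have "{z \<in> space M. cdf M z \<le> x} \<in> sets M" by measurable
        then show ?thesis by (simp add: borel_UNIV)
      qed
      ultimately have "measure M {z. x < cdf M z} = ?m - x"
        using finite_measure_compl[of "{z. cdf M z \<le> x}"] cdf_level_set[OF atomless 2] by simp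
      moreover have "{0..?m} \<inter> {x<..} = {x<..?m}" using 2 by auto
      ultimately show ?thesis unfolding l r using 2 by simp
    next
      case 3
      have "\<not> x < cdf M z" for z using 3 cdf_bounded[of z] by simp
      then have "{z. x < cdf M z} = {}" by simp
      moreover have "{0..?m} \<inter> {x<..} = {}" using 3 by auto
      ultimately show ?thesis unfolding l r by simp
    qed
  qed
qed simp_all

end

text \<open>The arcsine law: after rescaling by m this is Beta(1/2, 1/2). The value does not depend
  on m, so the total mass on the line will not enter the estimate.\<close>

lemma nn_integral_arcsine:
  assumes "m > 0"
  shows "(\<integral>\<^sup>+u. ennreal (1 / sqrt (u * (m - u))) * indicator {0..m} u \<partial>lborel) = ennreal pi"
proof -
  have "((\<lambda>t. t powr (1/2 - 1) * (1 - t) powr (1/2 - 1)) has_integral Beta (1/2) (1/2)) {0..1::real}"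
    by (rule has_integral_Beta_real) auto
  moreover have "Beta (1/2) (1/2) = (pi::real)"
    by (simp add: Beta_def Gamma_one_half_real)
  ultimately have B: "((\<lambda>t. t powr (1/2 - 1) * (1 - t) powr (1/2 - 1)) has_integral pi) {0..1::real}" by simp
  have "(\<integral>\<^sup>+u. ennreal (1 / sqrt (u * (m - u))) * indicator {0..m} u \<partial>lborel)
     = ennreal \<bar>m\<bar> * (\<integral>\<^sup>+v. ennreal (1 / sqrt ((0 + m * v) * (m - (0 + m * v)))) * indicator {0..m} (0 + m * v) \<partial>lborel)"
    using assms by (intro nn_integral_real_affine) auto
  also have "\<dots> = (\<integral>\<^sup>+v. ennreal m * (ennreal (1 / sqrt ((0 + m * v) * (m - (0 + m * v)))) * indicator {0..m} (0 + m * v)) \<partial>lborel)"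
    using assms by (subst nn_integral_cmult) auto
  also have "\<dots> = (\<integral>\<^sup>+v. ennreal (v powr (1/2 - 1) * (1 - v) powr (1/2 - 1)) * indicator {0..1} v \<partial>lborel)"
  proof (rule nn_integral_cong)
    fix v :: real
    have "ennreal m * ennreal (1 / sqrt ((0 + m * v) * (m - (0 + m * v)))) = ennreal (v powr (1/2 - 1) * (1 - v) powr (1/2 - 1))"
      if "0 \<le> v" "v \<le> 1"
    proof -
      have e: "(0 + m * v) * (m - (0 + m * v)) = m^2 * (v * (1 - v))"
        by (simp add: power2_eq_square algebra_simps)
      have "sqrt ((0 + m * v) * (m - (0 + m * v))) = m * (sqrt v * sqrt (1 - v))"
        unfolding e using assms by (simp add: real_sqrt_mult)
      moreover have "x powr (1/2 - 1) = 1 / sqrt x" if "x \<ge> 0" for x :: real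
        using that by (simp add: powr_minus_divide powr_half_sqrt)
      ultimately show ?thesis using that assms by (simp add: ennreal_mult'[symmetric])
    qed
    moreover have "indicator {0..m} (0 + m * v) = (indicator {0..1} v :: ennreal)"
      using assms by (auto simp: indicator_def zero_le_mult_iff)
    ultimately show "ennreal m * (ennreal (1 / sqrt ((0 + m * v) * (m - (0 + m * v)))) * indicator {0..m} (0 + m * v))
      = ennreal (v powr (1/2 - 1) * (1 - v) powr (1/2 - 1)) * indicator {0..1} v"
      by (cases "v \<in> {0..1}") (simp_all add: mult.assoc[symmetric])
  qed
  also have "\<dots> = ennreal pi"
    using B by (rule nn_integral_has_integral_lebesgue'[rotated]) simp
  finally show ?thesis .
qed

text \<open>A distance is the measure of the set of points that separate its ends. Fubini then turns
  the mean distance into an integral over the separating point z of F z (c - F z), with F the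
  distribution function and c the total mass.\<close>

lemma nn_integral_dist_eq:
  fixes m m' :: real
  shows "(\<integral>\<^sup>+z. indicator {m..} z * indicator {..<m'} z + indicator {m'..} z * indicator {..<m} z \<partial>lborel) = ennreal \<bar>m - m'\<bar>"
proof -
  have "(\<integral>\<^sup>+z. indicator {m..} z * indicator {..<m'} z + indicator {m'..} z * indicator {..<m} z \<partial>lborel)
    = (\<integral>\<^sup>+z. indicator {min m m'..<max m m'} z \<partial>lborel)"
    by (intro nn_integral_cong) (auto simp: indicator_def min_def max_def)
  then show ?thesis by (simp add: min_def max_def abs_if)
qed

text \<open>\<open>g powr (2/3)\<close> is the weighted geometric mean, with weights 1/3 and 2/3, of
  \<open>L^2 * P\<close> and \<open>g / (L * sqrt P)\<close>. The scale L does not affect this mean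
  and is free for tuning.\<close>

lemma young_two_thirds:
  fixes g P L :: real
  assumes "g \<ge> 0" "P > 0" "L > 0"
  shows "g powr (2/3) \<le> (L^2/3) * P + (2/(3*L)) * (g / sqrt P)"
proof (cases "g = 0")
  case False
  define b where "b = g / (L * sqrt P)"
  have pos: "g > 0" "L * sqrt P > 0" "b > 0" using assms False by (auto simp: b_def)
  have "(L * sqrt P)^2 = L^2 * P" using assms by (simp add: power_mult_distrib)
  then have e: "L^2 * P = (L * sqrt P) powr 2" using pos by simp
  have "(L^2 * P) powr (1/3) * b powr (2/3) \<le> 1/3 * (L^2 * P) + 2/3 * b"
    by (rule Youngs_inequality_0) (use assms pos in auto)
  moreover have "(L^2 * P) powr (1/3) = (L * sqrt P) powr (2/3)"
    unfolding e by (simp add: powr_powr)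
  moreover have "(L * sqrt P) powr (2/3) * b powr (2/3) = (L * sqrt P * b) powr (2/3)"
    using pos by (simp only: powr_mult less_imp_le)
  moreover have "L * sqrt P * b = g" using assms by (simp add: b_def)
  moreover have "2/3 * b = (2/(3*L)) * (g / sqrt P)" by (simp add: b_def)
  ultimately show ?thesis by simp
qed (use assms in simp)

text \<open>With F the distribution function of g and P = F (c - F), the double integral is twice
  the integral of P, while g / sqrt P integrates to at most pi because F is uniformly distributed
  under g. Young's inequality with L = pi / y joins the two. Optimising over y would give the cubic
  bound 2 A^3 / pi^2, where A is the integral of \<open>g powr (2/3)\<close>; the statement is the
  tangent of this cubic at A = y, which is linear in A and can be averaged.\<close>

lemma one_dim_lower_bound:
  fixes g :: "real \<Rightarrow> real" and y :: real
  assumes [measurable]: "g \<in> borel_measurable borel" and g0: "\<And>m. g m \<ge> 0"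
    and int: "integrable lborel g" and y: "y > 0"
  shows "ennreal (6 * y^2 / pi^2) * (\<integral>\<^sup>+m. ennreal (g m powr (2/3)) \<partial>lborel)
     \<le> (\<integral>\<^sup>+m. \<integral>\<^sup>+m'. ennreal (\<bar>m - m'\<bar> * g m * g m') \<partial>lborel \<partial>lborel) + ennreal (4 * y^3 / pi^2)"
proof -
  define N where "N = density lborel (\<lambda>x. ennreal (g x))"
  define c where "c = (\<integral>x. g x \<partial>lborel)"
  have tot: "(\<integral>\<^sup>+x. ennreal (g x) \<partial>lborel) = ennreal c"
    unfolding c_def using int g0 by (intro nn_integral_eq_integral) auto
  have c0: "c \<ge> 0" unfolding c_def using g0 by (intro integral_nonneg_AE) auto
  have sp: "space N = UNIV" by (simp add: N_def)
  have emN: "emeasure N UNIV = ennreal c"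
    using tot by (simp add: N_def emeasure_density)
  have "finite_measure N" by (rule finite_measureI) (simp add: sp emN)
  moreover have "sets N = sets borel" by (simp add: N_def)
  ultimately interpret N: finite_borel_measure N
    by (intro finite_borel_measure.intro finite_borel_measure_axioms.intro)
  have msN: "measure N (space N) = c" using emN c0 by (simp add: sp measure_def)
  define F where "F = cdf N"
  have Fm[measurable]: "F \<in> borel_measurable borel" unfolding F_def by (rule N.cdf_measurable)
  have F0: "0 \<le> F z" "F z \<le> c" for z
    using N.cdf_nonneg N.cdf_bounded msN by (auto simp: F_def)
  define P where "P z = F z * (c - F z)" for z
  have Pm[measurable]: "P \<in> borel_measurable borel" unfolding P_def by measurable
  have P0: "P z \<ge> 0" for z using F0 by (simp add: P_def)
  have setsN: "A \<in> sets borel \<Longrightarrow> A \<in> sets N" for A by (simp add: N_def)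
  have atomless: "measure N {x} = 0" for x
  proof -
    have "AE y in lborel. ennreal (g y) * indicator {x} y = 0"
      by (rule eventually_mono[OF AE_lborel_singleton[of x]]) simp
    then have "(\<integral>\<^sup>+y. ennreal (g y) * indicator {x} y \<partial>lborel) = 0"
      by (subst nn_integral_0_iff_AE) simp_all
    then have "emeasure N {x} = 0"
      unfolding N_def by (subst emeasure_density) simp_all
    then show ?thesis by (simp add: measure_def)
  qed
  have unif: "distr N borel F = density lborel (indicator {0..c})"
    using N.distr_cdf_uniform[OF atomless] by (simp add: F_def msN)
  have eF: "emeasure N {..z} = ennreal (F z)" for z
    by (simp add: F_def cdf_def N.emeasure_eq_measure)
  have eF': "emeasure N {z<..} = ennreal (c - F z)" for z
  proof -
    have "{z<..} = space N - {..z}" by (auto simp: sp)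
    then have "measure N {z<..} = c - F z"
      using N.finite_measure_compl[of "{..z}"] setsN[of "{..z}"] by (simp add: msN F_def cdf_def)
    then show ?thesis by (simp add: N.emeasure_eq_measure)
  qed
  have I: "(\<integral>\<^sup>+m. \<integral>\<^sup>+m'. ennreal (\<bar>m - m'\<bar> * g m * g m') \<partial>lborel \<partial>lborel) = 2 * (\<integral>\<^sup>+z. ennreal (P z) \<partial>lborel)"
  proof -
    define a where "a z m = (if m \<le> z then ennreal (g m) else 0)" for z m
    define b where "b z m = (if z < m then ennreal (g m) else 0)" for z m
    have [measurable]: "(\<lambda>p. a (fst p) (snd p)) \<in> borel_measurable (borel \<Otimes>\<^sub>M borel)" "(\<lambda>p. b (fst p) (snd p)) \<in> borel_measurable (borel \<Otimes>\<^sub>M borel)"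
      unfolding a_def b_def by measurable
    have am: "(\<lambda>m. a z m) \<in> borel_measurable borel" "(\<lambda>m. b z m) \<in> borel_measurable borel" for z
      unfolding a_def b_def by measurable
    have ai: "(\<integral>\<^sup>+m. a z m \<partial>lborel) = ennreal (F z)" for z
    proof -
      have "(\<integral>\<^sup>+m. a z m \<partial>lborel) = emeasure N {..z}"
        unfolding N_def by (subst emeasure_density) (auto intro!: nn_integral_cong simp: a_def)
      then show ?thesis by (simp only: eF)
    qed
    have bi: "(\<integral>\<^sup>+m. b z m \<partial>lborel) = ennreal (c - F z)" for z
    proof -
      have "(\<integral>\<^sup>+m. b z m \<partial>lborel) = emeasure N {z<..}"
        unfolding N_def by (subst emeasure_density) (auto intro!: nn_integral_cong simp: b_def)
      then show ?thesis by (simp only: eF')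
    qed
    have K: "ennreal (\<bar>m - m'\<bar> * g m * g m') = (\<integral>\<^sup>+z. a z m * b z m' + a z m' * b z m \<partial>lborel)" for m m'
    proof -
      have "(\<integral>\<^sup>+z. a z m * b z m' + a z m' * b z m \<partial>lborel) =
        (\<integral>\<^sup>+z. (ennreal (g m) * ennreal (g m')) * (indicator {m..} z * indicator {..<m'} z + indicator {m'..} z * indicator {..<m} z) \<partial>lborel)"
        by (intro nn_integral_cong) (auto simp: a_def b_def indicator_def mult.commute)
      also have "\<dots> = (ennreal (g m) * ennreal (g m')) * ennreal \<bar>m - m'\<bar>"
        by (subst nn_integral_cmult) (simp_all only: nn_integral_dist_eq, measurable)
      also have "\<dots> = ennreal (\<bar>m - m'\<bar> * g m * g m')"
        using g0 by (simp add: ennreal_mult[symmetric] mult_ac)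
      finally show ?thesis by (rule sym)
    qed
    have "(\<integral>\<^sup>+m. \<integral>\<^sup>+m'. ennreal (\<bar>m - m'\<bar> * g m * g m') \<partial>lborel \<partial>lborel)
      = (\<integral>\<^sup>+m. \<integral>\<^sup>+m'. \<integral>\<^sup>+z. a z m * b z m' + a z m' * b z m \<partial>lborel \<partial>lborel \<partial>lborel)"
      by (simp only: K)
    also have "\<dots> = (\<integral>\<^sup>+m. \<integral>\<^sup>+z. \<integral>\<^sup>+m'. a z m * b z m' + a z m' * b z m \<partial>lborel \<partial>lborel \<partial>lborel)"
      by (rule nn_integral_cong, rule lborel_pair.Fubini') (unfold a_def b_def, measurable)
    also have "\<dots> = (\<integral>\<^sup>+m. \<integral>\<^sup>+z. a z m * ennreal (c - F z) + ennreal (F z) * b z m \<partial>lborel \<partial>lborel)"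
      using am by (simp add: nn_integral_add nn_integral_cmult nn_integral_multc ai bi)
    also have "\<dots> = (\<integral>\<^sup>+z. \<integral>\<^sup>+m. a z m * ennreal (c - F z) + ennreal (F z) * b z m \<partial>lborel \<partial>lborel)"
      by (rule lborel_pair.Fubini') (unfold a_def b_def, measurable)
    also have "\<dots> = (\<integral>\<^sup>+z. ennreal (F z) * ennreal (c - F z) + ennreal (F z) * ennreal (c - F z) \<partial>lborel)"
      using am by (simp add: nn_integral_add nn_integral_cmult nn_integral_multc ai bi)
    also have "\<dots> = (\<integral>\<^sup>+z. 2 * ennreal (P z) \<partial>lborel)"
      using F0 by (intro nn_integral_cong) (simp add: P_def ennreal_mult[symmetric] mult_2)
    also have "\<dots> = 2 * (\<integral>\<^sup>+z. ennreal (P z) \<partial>lborel)"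
      by (rule nn_integral_cmult) measurable
    finally show ?thesis .
  qed
  \<comment> \<open>Only an inequality: for c = 0 the integrand vanishes, because division by 0
    gives 0.\<close>
  have A: "(\<integral>\<^sup>+z. ennreal (g z / sqrt (P z)) \<partial>lborel) \<le> ennreal pi"
  proof (cases "c = 0")
    case True
    then have "P z = 0" for z using F0[of z] by (simp add: P_def)
    then show ?thesis by simp
  next
    case False
    have "(\<integral>\<^sup>+z. ennreal (g z / sqrt (P z)) \<partial>lborel) = (\<integral>\<^sup>+z. ennreal (1 / sqrt (F z * (c - F z))) \<partial>N)"
      unfolding N_def using P0 g0
      by (subst nn_integral_density) (auto intro!: nn_integral_cong simp: P_def ennreal_mult[symmetric])
    also have "\<dots> = (\<integral>\<^sup>+u. ennreal (1 / sqrt (u * (c - u))) \<partial>distr N borel F)"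
      by (subst nn_integral_distr) (auto simp: measurable_cong_sets[OF N.M_is_borel refl])
    also have "\<dots> = (\<integral>\<^sup>+u. ennreal (1 / sqrt (u * (c - u))) * indicator {0..c} u \<partial>lborel)"
      unfolding unif by (subst nn_integral_density) (auto intro!: nn_integral_cong simp: mult.commute)
    also have "\<dots> = ennreal pi"
      using False c0 by (intro nn_integral_arcsine) simp
    finally show ?thesis by simp
  qed
  \<comment> \<open>Young's inequality needs P > 0. The values 0 and c are null for the uniform law,
    so F avoids them almost everywhere with respect to g; where g vanishes the claim is
    trivial.\<close>
  have Y: "AE z in lborel. g z powr (2/3) \<le> ((pi/y)^2/3) * P z + (2/(3*(pi/y))) * (g z / sqrt (P z))"
  proof -
    have "AE u in density lborel (indicator {0..c}). u \<noteq> 0 \<and> u \<noteq> c"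
      by (subst AE_density) (use AE_lborel_singleton[of 0] AE_lborel_singleton[of c] in \<open>auto elim!: eventually_elim2\<close>)
    then have "AE z in N. F z \<noteq> 0 \<and> F z \<noteq> c"
      unfolding unif[symmetric] by (subst (asm) AE_distr_iff) (auto simp: measurable_cong_sets[OF N.M_is_borel refl])
    then have "AE z in lborel. g z > 0 \<longrightarrow> F z \<noteq> 0 \<and> F z \<noteq> c"
      unfolding N_def by (subst (asm) AE_density) (auto elim!: eventually_mono)
    then show ?thesis
    proof eventually_elim
      case (elim z)
      show ?case
      proof (cases "g z > 0")
        case True
        with elim have "P z > 0" using F0[of z] by (simp add: P_def order.not_eq_order_implies_strict)
        then show ?thesis using young_two_thirds[OF g0, of "P z" "pi/y" z] y by simp
      next
        case False
        then have "g z = 0" using g0[of z] by simp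
        then show ?thesis using P0[of z] by simp
      qed
    qed
  qed
  have "(\<integral>\<^sup>+m. ennreal (g m powr (2/3)) \<partial>lborel) \<le>
     (\<integral>\<^sup>+z. ennreal ((pi/y)^2/3) * ennreal (P z) + ennreal (2/(3*(pi/y))) * ennreal (g z / sqrt (P z)) \<partial>lborel)"
    using Y by (intro nn_integral_mono_AE, eventually_elim)
      (use P0 g0 y in \<open>simp add: ennreal_mult[symmetric] ennreal_plus[symmetric] del: ennreal_plus\<close>)
  also have "\<dots> = ennreal ((pi/y)^2/3) * (\<integral>\<^sup>+z. ennreal (P z) \<partial>lborel) + ennreal (2/(3*(pi/y))) * (\<integral>\<^sup>+z. ennreal (g z / sqrt (P z)) \<partial>lborel)"
    by (subst nn_integral_add) (auto simp: nn_integral_cmult)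
  also have "\<dots> \<le> ennreal ((pi/y)^2/3) * (\<integral>\<^sup>+z. ennreal (P z) \<partial>lborel) + ennreal (2/(3*(pi/y))) * ennreal pi"
    by (intro add_mono mult_left_mono A) auto
  finally have "ennreal (6 * y^2 / pi^2) * (\<integral>\<^sup>+m. ennreal (g m powr (2/3)) \<partial>lborel) \<le>
    ennreal (6 * y^2 / pi^2) * (ennreal ((pi/y)^2/3) * (\<integral>\<^sup>+z. ennreal (P z) \<partial>lborel) + ennreal (2/(3*(pi/y))) * ennreal pi)"
    by (rule mult_left_mono) simp
  also have "\<dots> = ennreal (6 * y^2 / pi^2) * ennreal ((pi/y)^2/3) * (\<integral>\<^sup>+z. ennreal (P z) \<partial>lborel) + ennreal (6 * y^2 / pi^2) * (ennreal (2/(3*(pi/y))) * ennreal pi)"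
    by (simp add: distrib_left mult.assoc)
  also have "ennreal (6 * y^2 / pi^2) * ennreal ((pi/y)^2/3) = ennreal 2"
    using y by (subst ennreal_mult[symmetric]) (auto simp: field_simps power2_eq_square)
  also have "ennreal (6 * y^2 / pi^2) * (ennreal (2/(3*(pi/y))) * ennreal pi) = ennreal (4 * y^3 / pi^2)"
    using y by (simp add: ennreal_mult[symmetric] field_simps power2_eq_square power3_eq_cube)
  finally show ?thesis unfolding I by simp
qed

subsection \<open>Arcs on one great circle\<close>

text \<open>The substitution rule for closed intervals does not reach maps such as - cot, which are
  unbounded at the ends. The open interval is exhausted by the intervals {p n..q n}, their images
  exhaust T by the intermediate value theorem, and both integrals pass to the limit by monotone
  convergence.\<close>

lemma nn_integral_substitution_open:
  fixes f :: "real \<Rightarrow> ennreal" and g g' :: "real \<Rightarrow> real"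
  assumes f: "f \<in> borel_measurable borel" and ab: "a < b"
    and der: "\<And>x. x \<in> {a<..<b} \<Longrightarrow> (g has_real_derivative g' x) (at x)"
    and cont: "continuous_on {a<..<b} g'" and nonneg: "\<And>x. x \<in> {a<..<b} \<Longrightarrow> g' x \<ge> 0"
    and T: "g ` {a<..<b} = T"
  shows "(\<integral>\<^sup>+x. f x * indicator T x \<partial>lborel) = (\<integral>\<^sup>+x. f (g x) * g' x * indicator {a<..<b} x \<partial>lborel)"
proof -
  \<comment> \<open>The offset 3 keeps each margin below half of the interval, so that p n < q n
    already for n = 0.\<close>
  define p where "p n = a + (b - a) / real (n + 3)" for n
  define q where "q n = b - (b - a) / real (n + 3)" for n
  have small: "0 < (b - a) / real (n + 3)" "(b - a) / real (n + 3) < (b - a) / 2" for n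
  proof -
    show "0 < (b - a) / real (n + 3)" using ab by simp
    show "(b - a) / real (n + 3) < (b - a) / 2"
      by (rule divide_strict_left_mono) (use ab in auto)
  qed
  have pq: "a < p n" "p n < q n" "q n < b" for n
  proof -
    define r where "r = (b - a) / real (n + 3)"
    have r: "0 < r" "r < (b - a) / 2" using small[of n] by (simp_all only: r_def)
    have "a < a + r" using r by simp
    moreover have "a + r < b - r" using r(2) by (simp add: field_simps)
    moreover have "b - r < b" using r by simp
    ultimately show "a < p n" "p n < q n" "q n < b" by (simp_all only: p_def q_def r_def)
  qed
  have dec: "(b - a) / real (n + 3) \<le> (b - a) / real (m + 3)" if "m \<le> n" for m n
    using ab that by (intro divide_left_mono) auto
  have pqm: "p n \<le> p m" "q m \<le> q n" if "m \<le> n" for m n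
    using dec[OF that] by (simp_all add: p_def q_def)
  have ex: "\<exists>n. x \<in> {p n..q n}" if x: "a < x" "x < b" for x
  proof -
    define d where "d = min (x - a) (b - x)"
    have d: "d > 0" using x by (simp add: d_def)
    obtain n where "real n > (b - a) / d" using reals_Archimedean2 by blast
    then have "(b - a) < d * real n" using d by (simp add: field_simps)
    also have "\<dots> \<le> d * real (n + 3)" using d by (intro mult_left_mono) auto
    finally have "(b - a) / real (n + 3) < d" by (simp add: field_simps)
    then have "x \<in> {p n..q n}" by (simp add: p_def q_def d_def)
    then show ?thesis ..
  qed
  have mono: "g x \<le> g y" if "a < x" "x \<le> y" "y < b" for x y
    using that by (intro DERIV_nonneg_imp_nondecreasing[of x y g]) (auto intro!: exI der nonneg)
  have gcont: "continuous_on {a<..<b} g"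
    by (intro continuous_at_imp_continuous_on ballI DERIV_isCont[OF der])
  have S: "(\<Union>n. {p n..q n}) = {a<..<b}"
  proof (intro equalityI subsetI)
    fix x assume "x \<in> (\<Union>n. {p n..q n})"
    then obtain n where "p n \<le> x" "x \<le> q n" by auto
    then show "x \<in> {a<..<b}" using pq[of n] by auto
  next
    fix x assume "x \<in> {a<..<b}" then show "x \<in> (\<Union>n. {p n..q n})" using ex by auto
  qed
  have TT: "(\<Union>n. {g (p n)..g (q n)}) = T"
  proof (intro equalityI subsetI)
    fix y assume "y \<in> (\<Union>n. {g (p n)..g (q n)})"
    then obtain n where n: "g (p n) \<le> y" "y \<le> g (q n)" by auto
    have "{p n..q n} \<subseteq> {a<..<b}" using pq[of n] by auto
    then have "continuous_on {p n..q n} g" by (rule continuous_on_subset[OF gcont])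
    then obtain x where "p n \<le> x" "x \<le> q n" "g x = y"
      using IVT'[of g "p n" y "q n"] n pq[of n] by auto
    then show "y \<in> T" unfolding T[symmetric] using pq[of n] by (intro image_eqI[of _ _ x]) auto
  next
    fix y assume "y \<in> T"
    then obtain x where x: "a < x" "x < b" "y = g x" unfolding T[symmetric] by auto
    obtain n where n: "p n \<le> x" "x \<le> q n" using ex[OF x(1,2)] by auto
    have "g (p n) \<le> y" "y \<le> g (q n)" using x n pq[of n] by (auto intro!: mono)
    then show "y \<in> (\<Union>n. {g (p n)..g (q n)})" by auto
  qed
  have g'm: "(\<lambda>x. g' x * indicator {a<..<b} x) \<in> borel_measurable borel"
    using borel_measurable_continuous_on_indicator[OF _ cont] by (simp add: mult.commute)
  have gm: "(\<lambda>x. g x * indicator {a<..<b} x) \<in> borel_measurable borel"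
    using borel_measurable_continuous_on_indicator[OF _ gcont] by (simp add: mult.commute)
  have hm: "(\<lambda>x. f (g x) * g' x * indicator {p n..q n} x) \<in> borel_measurable borel" for n
  proof -
    have "(\<lambda>x. f (g x * indicator {a<..<b} x) * ennreal (g' x * indicator {a<..<b} x) * indicator {p n..q n} x) \<in> borel_measurable borel"
      using f g'm gm by measurable
    also have "(\<lambda>x. f (g x * indicator {a<..<b} x) * ennreal (g' x * indicator {a<..<b} x) * indicator {p n..q n} x)
      = (\<lambda>x. f (g x) * g' x * indicator {p n..q n} x)"
      using pq[of n] by (auto simp: fun_eq_iff indicator_def)
    finally show ?thesis .
  qed
  have step: "(\<integral>\<^sup>+x. f x * indicator {g (p n)..g (q n)} x \<partial>lborel) = (\<integral>\<^sup>+x. f (g x) * g' x * indicator {p n..q n} x \<partial>lborel)" for n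
  proof (rule nn_integral_substitution_aux[OF f])
    show "continuous_on {p n..q n} g'"
      using pq[of n] by (intro continuous_on_subset[OF cont]) auto
  qed (use pq[of n] der nonneg in auto)
  have inc1: "incseq (\<lambda>n x. f x * indicator {g (p n)..g (q n)} x)"
  proof (intro incseq_SucI le_funI mult_left_mono)
    fix n x
    have "{g (p n)..g (q n)} \<subseteq> {g (p (Suc n))..g (q (Suc n))}"
      using pq[of n] pq[of "Suc n"] pqm[of n "Suc n"] mono[of "p (Suc n)" "p n"] mono[of "q n" "q (Suc n)"] by auto
    then show "indicator {g (p n)..g (q n)} x \<le> (indicator {g (p (Suc n))..g (q (Suc n))} x :: ennreal)"
      by (auto simp: indicator_def)
  qed simp
  have inc2: "incseq (\<lambda>n x. f (g x) * g' x * indicator {p n..q n} x)"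
  proof (intro incseq_SucI le_funI mult_left_mono)
    fix n x
    have "{p n..q n} \<subseteq> {p (Suc n)..q (Suc n)}"
      using pqm[of n "Suc n"] by auto
    then show "indicator {p n..q n} x \<le> (indicator {p (Suc n)..q (Suc n)} x :: ennreal)"
      by (auto simp: indicator_def)
  qed simp
  have sup: "(SUP n. c * indicator (A n) x) = c * indicator (\<Union>n. A n) x" for c :: ennreal and A :: "nat \<Rightarrow> real set" and x
  proof (cases "\<exists>n. x \<in> A n")
    case True
    then obtain n where n: "x \<in> A n" ..
    have "(SUP n. c * indicator (A n) x) = c"
    proof (rule antisym)
      show "(SUP n. c * indicator (A n) x) \<le> c" by (rule SUP_least) (simp add: indicator_def)
      show "c \<le> (SUP n. c * indicator (A n) x)" by (rule SUP_upper2[of n]) (use n in auto)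
    qed
    with True show ?thesis by simp
  qed simp
  have "(\<integral>\<^sup>+x. f x * indicator T x \<partial>lborel) = (\<integral>\<^sup>+x. (SUP n. f x * indicator {g (p n)..g (q n)} x) \<partial>lborel)"
    by (simp only: sup TT)
  also have "\<dots> = (SUP n. \<integral>\<^sup>+x. f x * indicator {g (p n)..g (q n)} x \<partial>lborel)"
    by (intro nn_integral_monotone_convergence_SUP inc1 borel_measurable_times_ennreal borel_measurable_indicator)
      (simp_all add: f)
  also have "\<dots> = (SUP n. \<integral>\<^sup>+x. f (g x) * g' x * indicator {p n..q n} x \<partial>lborel)"
    by (simp only: step)
  also have "\<dots> = (\<integral>\<^sup>+x. (SUP n. f (g x) * g' x * indicator {p n..q n} x) \<partial>lborel)"
    using hm by (intro nn_integral_monotone_convergence_SUP[symmetric] inc2) simp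
  also have "\<dots> = (\<integral>\<^sup>+x. f (g x) * g' x * indicator {a<..<b} x \<partial>lborel)"
    by (simp only: sup S)
  finally show ?thesis .
qed

section \<open>Cotangent coordinates for the arcs through a point\<close>

lemma DERIV_uminus_cot:
  fixes s :: real
  assumes "s \<in> {0<..<pi}"
  shows "((\<lambda>s. - cot s) has_real_derivative 1 / (sin s)\<^sup>2) (at s)"
proof -
  have "sin s > 0" using assms sin_gt_zero by auto
  then have "((\<lambda>s. - cot s) has_real_derivative - (- inverse ((sin s)\<^sup>2))) (at s)"
    by (intro DERIV_minus DERIV_cot) simp
  then show ?thesis by (simp add: inverse_eq_divide)
qed

lemma cot_strict_antimono:
  fixes x y :: real
  assumes "0 < x" "x < y" "y < pi"
  shows "cot y < cot x"
proof -
  have "- cot x < - cot y"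
  proof (rule DERIV_pos_imp_increasing[OF assms(2)])
    fix z assume "x \<le> z" "z \<le> y"
    then have "z \<in> {0<..<pi}" using assms by auto
    moreover from this have "sin z > 0" using sin_gt_zero by auto
    ultimately show "\<exists>d. ((\<lambda>s. - cot s) has_real_derivative d) (at z) \<and> 0 < d"
      using DERIV_uminus_cot by (intro exI[of _ "1 / (sin z)\<^sup>2"]) auto
  qed
  then show ?thesis by simp
qed

lemma uminus_cot_surj:
  obtains s where "s \<in> {0<..<pi}" "- cot s = (y::real)"
proof
  show "pi / 2 + arctan y \<in> {0<..<pi}"
    using arctan_lbound[of y] arctan_ubound[of y] by auto
  have "- cot (pi / 2 + arctan y) = tan (arctan y)"
    by (simp add: cot_def tan_def sin_add cos_add)
  then show "- cot (pi / 2 + arctan y) = y" by (simp add: tan_arctan)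
qed

lemma image_uminus_cot:
  assumes "l > 0"
  shows "(\<lambda>s. l * (- cot s)) ` {0<..<pi} = (UNIV :: real set)"
proof (intro equalityI subsetI)
  fix y :: real
  obtain s where "s \<in> {0<..<pi}" "- cot s = y / l" by (rule uminus_cot_surj)
  then show "y \<in> (\<lambda>s. l * (- cot s)) ` {0<..<pi}" using assms by (intro image_eqI[of _ _ s]) auto
qed simp

lemma image_uminus_cot':
  assumes a: "a \<in> {0<..<pi}" and "c > 0"
  shows "(\<lambda>s. c * (cot a - cot s)) ` {a<..<pi} = {0<..}"
proof (intro equalityI subsetI)
  fix y assume "y \<in> (\<lambda>s. c * (cot a - cot s)) ` {a<..<pi}"
  then obtain s where "a < s" "s < pi" "y = c * (cot a - cot s)" by auto
  then show "y \<in> {0<..}" using cot_strict_antimono[of a s] assms by simp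
next
  fix y :: real assume y: "y \<in> {0<..}"
  obtain s where s: "s \<in> {0<..<pi}" "- cot s = y / c - cot a" by (rule uminus_cot_surj)
  have "cot s < cot a" using s y assms by (smt (verit) divide_pos_pos greaterThan_iff)
  then have "a < s" using cot_strict_antimono[of s a] s a by (cases a s rule: linorder_cases) auto
  then show "y \<in> (\<lambda>s. c * (cot a - cot s)) ` {a<..<pi}"
    using s assms by (intro image_eqI[of _ _ s]) (auto simp: field_simps)
qed

lemma borel_measurable_arccos[measurable]: "arccos \<in> borel_measurable borel"
proof -
  \<comment> \<open>Outside {-1..1} \<open>arccos\<close> has an unspecified value, but the same one
    for all arguments, since the defining predicate is identically false there.\<close>
  have out: "arccos y = (THE x. False)" if "\<not> (-1 \<le> y \<and> y \<le> 1)" for y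
  proof -
    have "\<not> (0 \<le> x \<and> x \<le> pi \<and> cos x = y)" for x
      using that cos_ge_minus_one[of x] cos_le_one[of x] by auto
    then have "(\<lambda>x. 0 \<le> x \<and> x \<le> pi \<and> cos x = y) = (\<lambda>x. False)" by auto
    then show ?thesis by (simp only: arccos_def)
  qed
  have "(\<lambda>y. indicator {-1..1} y *\<^sub>R arccos y) \<in> borel_measurable borel"
    by (intro borel_measurable_continuous_on_indicator continuous_on_arccos') auto
  then have "(\<lambda>y. indicator {-1..1} y *\<^sub>R arccos y + (THE x. False) * indicator (- {-1..1}) y) \<in> borel_measurable borel"
    by measurable
  also have "(\<lambda>y. indicator {-1..1} y *\<^sub>R arccos y + (THE x. False) * indicator (- {-1..1}) y) = arccos"
  proof
    fix y :: real
    show "indicator {-1..1} y *\<^sub>R arccos y + (THE x. False) * indicator (- {-1..1}) y = arccos y"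
      by (cases "-1 \<le> y \<and> y \<le> 1") (simp_all add: out)
  qed
  finally show ?thesis .
qed

text \<open>The two ends of an arc through \<open>Q\<close> are written as \<open>X\<close> and \<open>Q - X\<close>, where \<open>X\<close> has the coordinates
  \<open>(l, k)\<close> with respect to a normal vector and \<open>Q\<close> itself, so that \<open>Q - X\<close> has the coordinates
  \<open>(- l, 1 - k)\<close>.\<close>

definition arc_density :: "real \<Rightarrow> real \<Rightarrow> real" where
  "arc_density l k = l\<^sup>2 / (sqrt (k\<^sup>2 + l\<^sup>2) ^ 3 * sqrt ((1 - k)\<^sup>2 + l\<^sup>2) ^ 3)"

definition arc_angle :: "real \<Rightarrow> real \<Rightarrow> real" where
  "arc_angle l k = arccos ((k * (1 - k) - l\<^sup>2) / (sqrt (k\<^sup>2 + l\<^sup>2) * sqrt ((1 - k)\<^sup>2 + l\<^sup>2)))"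

text \<open>Here \<open>a\<close> and \<open>s - a\<close> are the angles from \<open>Q\<close> to the ends of the arc.\<close>

lemma arc_polar:
  fixes a s :: real
  assumes a: "0 < a" "a < s" "s < pi"
  defines "l \<equiv> (sin a)\<^sup>2 * (cot a - cot s)"
  shows "arc_density l (l * cot a) * (l / (sin a)\<^sup>2) * ((sin a)\<^sup>2 / (sin s)\<^sup>2) = sin s"
    and "arc_angle l (l * cot a) = s"
proof -
  define A B S where "A = sin a" and "B = sin (s - a)" and "S = sin s"
  have pos: "A > 0" "B > 0" "S > 0" using a by (auto simp: A_def B_def S_def intro!: sin_gt_zero)
  have "cot a - cot s = B / (A * S)"
    using pos by (simp add: cot_def A_def B_def S_def sin_diff field_simps)
  then have l: "l = A * B / S" using pos by (simp add: l_def A_def[symmetric] power2_eq_square)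
  have k: "l * cot a = cos a * B / S" using pos by (simp add: l cot_def A_def)
  have "S = A * cos (s - a) + cos a * B"
    using sin_add[of a "s - a"] by (simp add: S_def A_def B_def)
  then have k1: "1 - l * cot a = A * cos (s - a) / S" using pos by (simp add: k field_simps)
  have sq: "(x * z / y)\<^sup>2 + (w * z / y)\<^sup>2 = (z / y)\<^sup>2 * (x\<^sup>2 + w\<^sup>2)" for x y z w :: real
    by (simp add: power_divide power_mult_distrib add_divide_distrib distrib_left mult.commute)
  have "(l * cot a)\<^sup>2 + l\<^sup>2 = (B / S)\<^sup>2 * ((cos a)\<^sup>2 + (sin a)\<^sup>2)"
    unfolding k unfolding l A_def by (rule sq)
  then have r1: "sqrt ((l * cot a)\<^sup>2 + l\<^sup>2) = B / S" using pos by simp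
  have "(1 - l * cot a)\<^sup>2 + l\<^sup>2 = (A / S)\<^sup>2 * ((cos (s - a))\<^sup>2 + (sin (s - a))\<^sup>2)"
    unfolding k1 unfolding l B_def using sq[of "cos (s - a)" A S "sin (s - a)"] by (simp only: mult.commute)
  then have r2: "sqrt ((1 - l * cot a)\<^sup>2 + l\<^sup>2) = A / S" using pos by simp
  show "arc_density l (l * cot a) * (l / (sin a)\<^sup>2) * ((sin a)\<^sup>2 / (sin s)\<^sup>2) = sin s"
    unfolding arc_density_def r1 r2 A_def[symmetric] S_def[symmetric] unfolding l
    using pos by (simp add: field_simps power2_eq_square power3_eq_cube)
  have "cos s = cos a * cos (s - a) - A * B"
    using cos_add[of a "s - a"] by (simp add: A_def B_def)
  moreover have "(l * cot a) * (1 - l * cot a) - l\<^sup>2 = (A * B / S\<^sup>2) * (cos a * cos (s - a) - A * B)"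
    unfolding k1 unfolding k unfolding l
    by (simp add: power2_eq_square right_diff_distrib diff_divide_distrib mult_ac)
  ultimately have "((l * cot a) * (1 - l * cot a) - l\<^sup>2) / (B / S * (A / S)) = cos s"
    using pos by (simp add: power2_eq_square)
  then show "arc_angle l (l * cot a) = s"
    unfolding arc_angle_def r1 r2 using a by (simp add: arccos_cos)
qed

lemma nn_integral_cot_substitution:
  fixes G :: "real \<Rightarrow> ennreal"
  assumes G[measurable]: "G \<in> borel_measurable borel" and l: "l > 0"
  shows "(\<integral>\<^sup>+k. G k \<partial>lborel) = (\<integral>\<^sup>+a. G (l * cot a) * ennreal (l / (sin a)\<^sup>2) * indicator {0<..<pi} a \<partial>lborel)"
proof -
  have "(\<integral>\<^sup>+k. G k \<partial>lborel) = (\<integral>\<^sup>+k. G (- k) * indicator UNIV k \<partial>lborel)"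
    using nn_integral_real_affine[OF G, of "-1" 0] by simp
  also have "\<dots> = (\<integral>\<^sup>+a. G (- (l * (- cot a))) * ennreal (l / (sin a)\<^sup>2) * indicator {0<..<pi} a \<partial>lborel)"
  proof (rule nn_integral_substitution_open)
    show "((\<lambda>s. l * (- cot s)) has_real_derivative l / (sin s)\<^sup>2) (at s)" if "s \<in> {0<..<pi}" for s
      using DERIV_cmult[OF DERIV_uminus_cot[OF that], of l] by simp
    show "continuous_on {0<..<pi} (\<lambda>s. l / (sin s)\<^sup>2)"
    proof (intro continuous_intros ballI)
      fix x :: real assume "x \<in> {0<..<pi}"
      then have "sin x > 0" by (intro sin_gt_zero) auto
      then show "(sin x)\<^sup>2 \<noteq> 0" by simp
    qed
    show "(\<lambda>s. l * - cot s) ` {0<..<pi} = UNIV" using l by (rule image_uminus_cot)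
  qed (use l in auto)
  finally show ?thesis by simp
qed

lemma arc_measurable[measurable (raw)]:
  assumes [measurable]: "f \<in> borel_measurable M" "g \<in> borel_measurable M"
  shows "(\<lambda>x. arc_density (f x) (g x)) \<in> borel_measurable M"
    and "(\<lambda>x. arc_angle (f x) (g x)) \<in> borel_measurable M"
    and "(\<lambda>x. cot (f x)) \<in> borel_measurable M"
  unfolding arc_density_def arc_angle_def cot_def by measurable

text \<open>Substituting k = l cot a and then l = (sin a)^2 (cot a - cot s) passes to the angle a
  between Q and one end and to the length s of the arc; by \<open>arc_polar\<close> the density
  becomes sin s. Nothing depends on a in (0, s) any more, whence the factor s: an arc of length s
  can slide through Q in a family of positions of size s.\<close>

lemma nn_integral_arc_half:
  fixes H :: "real \<Rightarrow> ennreal"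
  assumes H[measurable]: "H \<in> borel_measurable borel"
  shows "(\<integral>\<^sup>+l. \<integral>\<^sup>+k. indicator {0<..} l * (ennreal (arc_density l k) * H (arc_angle l k)) \<partial>lborel \<partial>lborel)
    = (\<integral>\<^sup>+s. ennreal (s * sin s) * H s * indicator {0<..<pi} s \<partial>lborel)"
proof -
  define G where "G l k = ennreal (arc_density l k) * H (arc_angle l k)" for l k
  have Gl: "G l \<in> borel_measurable borel" for l
    unfolding G_def by measurable
  have "(\<integral>\<^sup>+l. \<integral>\<^sup>+k. indicator {0<..} l * G l k \<partial>lborel \<partial>lborel)
    = (\<integral>\<^sup>+l. \<integral>\<^sup>+a. indicator {0<..} l * (G l (l * cot a) * ennreal (l / (sin a)\<^sup>2) * indicator {0<..<pi} a) \<partial>lborel \<partial>lborel)"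
  proof (rule nn_integral_cong)
    fix l :: real
    show "(\<integral>\<^sup>+k. indicator {0<..} l * G l k \<partial>lborel) = (\<integral>\<^sup>+a. indicator {0<..} l * (G l (l * cot a) * ennreal (l / (sin a)\<^sup>2) * indicator {0<..<pi} a) \<partial>lborel)"
      by (cases "l > 0") (simp_all add: nn_integral_cot_substitution[OF Gl, of l l])
  qed
  also have "\<dots> = (\<integral>\<^sup>+a. \<integral>\<^sup>+l. indicator {0<..} l * (G l (l * cot a) * ennreal (l / (sin a)\<^sup>2) * indicator {0<..<pi} a) \<partial>lborel \<partial>lborel)"
    unfolding G_def by (rule lborel_pair.Fubini') measurable
  also have "\<dots> = (\<integral>\<^sup>+a. \<integral>\<^sup>+s. ennreal (sin s) * H s * (if 0 < a \<and> a < s \<and> s < pi then 1 else 0) \<partial>lborel \<partial>lborel)"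
  proof (rule nn_integral_cong)
    fix a :: real
    show "(\<integral>\<^sup>+l. indicator {0<..} l * (G l (l * cot a) * ennreal (l / (sin a)\<^sup>2) * indicator {0<..<pi} a) \<partial>lborel)
      = (\<integral>\<^sup>+s. ennreal (sin s) * H s * (if 0 < a \<and> a < s \<and> s < pi then 1 else 0) \<partial>lborel)"
    proof (cases "a \<in> {0<..<pi}")
      case True
      define c where "c = (sin a)\<^sup>2"
      have c: "c > 0" using True sin_gt_zero[of a] by (auto simp: c_def)
      have m: "(\<lambda>l. G l (l * cot a) * ennreal (l / (sin a)\<^sup>2)) \<in> borel_measurable borel"
        unfolding G_def by measurable
      have "(\<integral>\<^sup>+l. indicator {0<..} l * (G l (l * cot a) * ennreal (l / (sin a)\<^sup>2) * indicator {0<..<pi} a) \<partial>lborel)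
        = (\<integral>\<^sup>+l. (G l (l * cot a) * ennreal (l / (sin a)\<^sup>2)) * indicator {0<..} l \<partial>lborel)"
        using True by (simp add: mult_ac)
      also have "\<dots> = (\<integral>\<^sup>+s. (G (c * (cot a - cot s)) (c * (cot a - cot s) * cot a) * ennreal (c * (cot a - cot s) / (sin a)\<^sup>2))
           * ennreal (c / (sin s)\<^sup>2) * indicator {a<..<pi} s \<partial>lborel)"
      proof (rule nn_integral_substitution_open[OF m])
        show "a < pi" using True by simp
        show "((\<lambda>s. c * (cot a - cot s)) has_real_derivative c / (sin s)\<^sup>2) (at s)" if "s \<in> {a<..<pi}" for s
        proof -
          have "s \<in> {0<..<pi}" using that True by auto
          from DERIV_cmult[OF DERIV_add[OF DERIV_const DERIV_uminus_cot[OF this]], of c "cot a"] show ?thesis by simp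
        qed
        show "continuous_on {a<..<pi} (\<lambda>s. c / (sin s)\<^sup>2)"
        proof (intro continuous_intros ballI)
          fix x assume "x \<in> {a<..<pi}"
          then have "sin x > 0" using True by (intro sin_gt_zero) auto
          then show "(sin x)\<^sup>2 \<noteq> 0" by simp
        qed
        show "(\<lambda>s. c * (cot a - cot s)) ` {a<..<pi} = {0<..}" using True c by (rule image_uminus_cot')
      qed (use c in auto)
      also have "\<dots> = (\<integral>\<^sup>+s. ennreal (sin s) * H s * (if 0 < a \<and> a < s \<and> s < pi then 1 else 0) \<partial>lborel)"
      proof (rule nn_integral_cong)
        fix s :: real
        show "(G (c * (cot a - cot s)) (c * (cot a - cot s) * cot a) * ennreal (c * (cot a - cot s) / (sin a)\<^sup>2))
           * ennreal (c / (sin s)\<^sup>2) * indicator {a<..<pi} s = ennreal (sin s) * H s * (if 0 < a \<and> a < s \<and> s < pi then 1 else 0)"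
        proof (cases "a < s \<and> s < pi")
          case s: True
          define l where "l = c * (cot a - cot s)"
          have a: "0 < a" using True by simp
          have P: "arc_density l (l * cot a) * (l / (sin a)\<^sup>2) * (c / (sin s)\<^sup>2) = sin s" "arc_angle l (l * cot a) = s"
            unfolding l_def c_def using arc_polar[of a s] a s by auto
          have l0: "l > 0" unfolding l_def using cot_strict_antimono[of a s] a s c by simp
          have "ennreal (arc_density l (l * cot a)) * ennreal (l / (sin a)\<^sup>2) * ennreal (c / (sin s)\<^sup>2) = ennreal (sin s)"
          proof -
            have "ennreal (arc_density l (l * cot a)) * ennreal (l / (sin a)\<^sup>2) * ennreal (c / (sin s)\<^sup>2)
              = ennreal (arc_density l (l * cot a) * (l / (sin a)\<^sup>2) * (c / (sin s)\<^sup>2))"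
            proof -
              have "ennreal x * ennreal y * ennreal z = ennreal (x * y * z)" if "0 \<le> x" "0 \<le> y" "0 \<le> z" for x y z
                using that by (simp add: ennreal_mult)
              moreover have "0 \<le> arc_density l (l * cot a)" by (simp add: arc_density_def)
              ultimately show ?thesis using l0 c by simp
            qed
            then show ?thesis by (simp only: P(1))
          qed
          then show ?thesis unfolding l_def[symmetric] G_def P(2) using a s by (simp add: mult_ac)
        next
          case False
          then have "indicator {a<..<pi} s = (0::ennreal)" by auto
          then show ?thesis using False by auto
        qed
      qed
      finally show ?thesis .
    next
      case False
      have n: "(if 0 < a \<and> a < s \<and> s < pi then 1 else 0) = (0::ennreal)" for s using False by auto
      have i: "indicator {0<..<pi} a = (0::ennreal)" using False by (rule indicator_simps(2))
      show ?thesis by (simp only: i n mult_zero_right)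
    qed
  qed
  also have "\<dots> = (\<integral>\<^sup>+s. \<integral>\<^sup>+a. ennreal (sin s) * H s * (if 0 < a \<and> a < s \<and> s < pi then 1 else 0) \<partial>lborel \<partial>lborel)"
    by (rule lborel_pair.Fubini') measurable
  also have "\<dots> = (\<integral>\<^sup>+s. ennreal (s * sin s) * H s * indicator {0<..<pi} s \<partial>lborel)"
  proof (rule nn_integral_cong)
    fix s :: real
    have "(\<integral>\<^sup>+a. ennreal (sin s) * H s * (if 0 < a \<and> a < s \<and> s < pi then 1 else 0) \<partial>lborel) =
      (\<integral>\<^sup>+a. (ennreal (sin s) * H s * indicator {0<..<pi} s) * indicator {0<..<s} a \<partial>lborel)"
      by (intro nn_integral_cong) (auto simp: indicator_def)
    also have "\<dots> = ennreal (sin s) * H s * indicator {0<..<pi} s * emeasure lborel {0<..<s}"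
      by (rule nn_integral_cmult_indicator) simp
    also have "\<dots> = ennreal (s * sin s) * H s * indicator {0<..<pi} s"
      using sin_gt_zero[of s] by (cases "s \<in> {0<..<pi}") (auto simp: ennreal_mult mult_ac)
    finally show "(\<integral>\<^sup>+a. ennreal (sin s) * H s * (if 0 < a \<and> a < s \<and> s < pi then 1 else 0) \<partial>lborel) = ennreal (s * sin s) * H s * indicator {0<..<pi} s" .
  qed
  finally show ?thesis unfolding G_def .
qed

lemma nn_integral_arc:
  fixes H :: "real \<Rightarrow> ennreal"
  assumes H[measurable]: "H \<in> borel_measurable borel"
  shows "(\<integral>\<^sup>+l. \<integral>\<^sup>+k. ennreal (arc_density l k) * H (arc_angle l k) \<partial>lborel \<partial>lborel)
    = 2 * (\<integral>\<^sup>+s. ennreal (s * sin s) * H s * indicator {0<..<pi} s \<partial>lborel)"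
proof -
  define G where "G l = (\<integral>\<^sup>+k. ennreal (arc_density l k) * H (arc_angle l k) \<partial>lborel)" for l
  have mk: "(\<lambda>k. ennreal (arc_density l k) * H (arc_angle l k)) \<in> borel_measurable lborel" for l
    by measurable
  have Gm[measurable]: "G \<in> borel_measurable borel"
    unfolding G_def by measurable
  have ev: "G (- l) = G l" for l by (simp add: G_def arc_density_def arc_angle_def)
  have half: "(\<integral>\<^sup>+l. indicator {0<..} l * G l \<partial>lborel) = (\<integral>\<^sup>+s. ennreal (s * sin s) * H s * indicator {0<..<pi} s \<partial>lborel)"
    unfolding nn_integral_arc_half[OF H, symmetric] G_def using mk by (simp add: nn_integral_cmult)
  have "(\<integral>\<^sup>+l. indicator {..<0} l * G l \<partial>lborel) = (\<integral>\<^sup>+l. indicator {..<0} (- l) * G (- l) \<partial>lborel)"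
    using nn_integral_real_affine[of "\<lambda>l. indicator {..<0} l * G l" "-1" 0] by simp
  also have "\<dots> = (\<integral>\<^sup>+l. indicator {0<..} l * G l \<partial>lborel)"
    by (simp add: ev indicator_def)
  finally have other: "(\<integral>\<^sup>+l. indicator {..<0} l * G l \<partial>lborel) = (\<integral>\<^sup>+l. indicator {0<..} l * G l \<partial>lborel)" .
  have "(\<integral>\<^sup>+l. G l \<partial>lborel) = (\<integral>\<^sup>+l. indicator {..<0} l * G l + indicator {0<..} l * G l \<partial>lborel)"
    by (rule nn_integral_cong_AE, rule eventually_mono[OF AE_lborel_singleton[of 0]]) (auto simp: indicator_def)
  also have "\<dots> = 2 * (\<integral>\<^sup>+l. indicator {0<..} l * G l \<partial>lborel)"
    by (simp add: nn_integral_add other mult_2)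
  finally show ?thesis unfolding half unfolding G_def .
qed

text \<open>The integral of x sin x from 0 to t: up to a constant, the total length of the arcs from
  a fixed point to all points at angle at most t. Its square is the main factor of the final
  bound.\<close>

definition cap_moment :: "real \<Rightarrow> real" where
  "cap_moment t = sin t - t * cos t"

lemma DERIV_cap_moment: "(cap_moment has_real_derivative t * sin t) (at t)"
  unfolding cap_moment_def[abs_def] by (auto intro!: derivative_eq_intros)

lemma cap_moment_pos:
  assumes "0 < t" "t \<le> pi"
  shows "0 < cap_moment t"
proof -
  have "cap_moment 0 < cap_moment t"
  proof (rule DERIV_pos_imp_increasing_open[OF assms(1)])
    fix x assume "0 < x" "x < t"
    then show "\<exists>y. (cap_moment has_real_derivative y) (at x) \<and> 0 < y"
      using assms by (intro exI[of _ "x * sin x"] conjI DERIV_cap_moment mult_pos_pos sin_gt_zero) auto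
  next
    show "continuous_on {0..t} cap_moment"
      by (intro continuous_at_imp_continuous_on ballI DERIV_isCont[OF DERIV_cap_moment])
  qed
  then show ?thesis by (simp add: cap_moment_def)
qed

lemma cap_moment_nonneg: "0 \<le> t \<Longrightarrow> t \<le> pi \<Longrightarrow> 0 \<le> cap_moment t"
  using cap_moment_pos[of t] by (cases "t = 0") (auto simp: cap_moment_def)

text \<open>Writing D for the cap moment, the numerator of the derivative is x^2 (3 D - x^2 sin x),
  and the bracket has the derivative x D >= 0. The quotient is the cube of x D^(-1/3), which up to
  the factor 2/3 is the derivative of D^(2/3) with respect to 1 - cos x; so this monotonicity is a
  convexity statement.\<close>

lemma cube_over_cap_moment_mono:
  assumes "0 < a" "a \<le> b" "b \<le> pi"
  shows "a ^ 3 / cap_moment a \<le> b ^ 3 / cap_moment b"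
proof -
  have q: "0 \<le> 3 * cap_moment x - x\<^sup>2 * sin x" if "0 \<le> x" "x \<le> pi" for x
  proof -
    have "3 * cap_moment 0 - 0\<^sup>2 * sin 0 \<le> 3 * cap_moment x - x\<^sup>2 * sin x"
    proof (rule DERIV_nonneg_imp_nondecreasing[OF that(1)])
      fix y assume y: "0 \<le> y" "y \<le> x"
      have "((\<lambda>x. 3 * cap_moment x - x\<^sup>2 * sin x) has_real_derivative 3 * (y * sin y) - (2 * y * sin y + y\<^sup>2 * cos y)) (at y)"
        by (auto intro!: derivative_eq_intros DERIV_cap_moment)
      moreover have "3 * (y * sin y) - (2 * y * sin y + y\<^sup>2 * cos y) = y * cap_moment y"
        by (simp add: cap_moment_def power2_eq_square algebra_simps)
      ultimately show "\<exists>z. ((\<lambda>x. 3 * cap_moment x - x\<^sup>2 * sin x) has_real_derivative z) (at y) \<and> 0 \<le> z"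
        using y that cap_moment_nonneg[of y] by auto
    qed
    then show ?thesis by (simp add: cap_moment_def)
  qed
  show ?thesis
  proof (rule DERIV_nonneg_imp_nondecreasing[OF assms(2)])
    fix x assume x: "a \<le> x" "x \<le> b"
    then have x0: "0 < x" "x \<le> pi" using assms by auto
    note D = cap_moment_pos[OF x0]
    have "((\<lambda>x. x ^ 3 / cap_moment x) has_real_derivative (3 * x\<^sup>2 * cap_moment x - x ^ 3 * (x * sin x)) / (cap_moment x)\<^sup>2) (at x)"
      using D by (auto intro!: derivative_eq_intros DERIV_cap_moment simp: power2_eq_square)
    moreover have "3 * x\<^sup>2 * cap_moment x - x ^ 3 * (x * sin x) = x\<^sup>2 * (3 * cap_moment x - x\<^sup>2 * sin x)"
      by (simp add: power2_eq_square power3_eq_cube algebra_simps)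
    ultimately show "\<exists>y. ((\<lambda>x. x ^ 3 / cap_moment x) has_real_derivative y) (at x) \<and> 0 \<le> y"
      using q[of x] x0 by auto
  qed
qed

lemma cap_moment_ratio_mono:
  assumes "0 < a" "a \<le> b" "b \<le> pi"
  shows "a * cap_moment a powr (-1/3) \<le> b * cap_moment b powr (-1/3)"
proof -
  have e: "x * cap_moment x powr (-1/3) = (x ^ 3 / cap_moment x) powr (1/3)" if "0 < x" "x \<le> pi" for x
  proof -
    have "(x ^ 3 / cap_moment x) powr (1/3) = (x ^ 3) powr (1/3) / cap_moment x powr (1/3)"
      by (rule powr_divide)
    moreover have "(x ^ 3) powr (1/3) = x"
      using that by (simp add: powr_powr flip: powr_numeral)
    moreover have "cap_moment x powr (-1/3) = 1 / cap_moment x powr (1/3)"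
      using powr_minus_divide[of "cap_moment x" "1/3"] by simp
    ultimately show ?thesis by simp
  qed
  have "0 < a ^ 3 / cap_moment a" using assms cap_moment_pos[of a] by simp
  then have "(a ^ 3 / cap_moment a) powr (1/3) \<le> (b ^ 3 / cap_moment b) powr (1/3)"
    using cube_over_cap_moment_mono[OF assms] by (intro powr_mono2) auto
  moreover have "a * cap_moment a powr (-1/3) = (a ^ 3 / cap_moment a) powr (1/3)"
    by (rule e) (use assms in auto)
  moreover have "b * cap_moment b powr (-1/3) = (b ^ 3 / cap_moment b) powr (1/3)"
    by (rule e) (use assms in auto)
  ultimately show ?thesis by (simp only:)
qed

text \<open>The tangent at t of the (2/3)-power of the cap moment, as a convex function of 1 - cos
  s. The derivative of \<phi> is a nonnegative multiple of an increasing function that vanishes at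
  t, so \<phi> is minimal at t.\<close>

lemma cap_moment_tangent:
  assumes t: "0 < t" "t \<le> pi" and s: "0 \<le> s" "s \<le> pi"
  shows "cap_moment s powr (2/3) \<ge> cap_moment t powr (2/3) + 2/3 * cap_moment t powr (-1/3) * t * (cos t - cos s)"
proof -
  define c where "c = cap_moment t powr (-1/3) * t"
  define \<phi> where "\<phi> s = cap_moment s powr (2/3) + 2/3 * c * cos s" for s
  have der: "(\<phi> has_real_derivative 2/3 * sin x * (x * cap_moment x powr (-1/3) - c)) (at x)" if "0 < x" "x \<le> pi" for x
  proof -
    have "((\<lambda>s. cap_moment s powr (2/3)) has_real_derivative 2/3 * cap_moment x powr (2/3 - 1) * (x * sin x)) (at x)"
      using DERIV_fun_powr[OF DERIV_cap_moment cap_moment_pos[OF that], of "2/3"] by simp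
    then have "(\<phi> has_real_derivative 2/3 * cap_moment x powr (2/3 - 1) * (x * sin x) + 2/3 * c * (- sin x)) (at x)"
      unfolding \<phi>_def[abs_def] by (intro DERIV_add DERIV_cmult DERIV_cos)
    then show ?thesis by (simp add: algebra_simps)
  qed
  have cont: "continuous_on A \<phi>" if "A \<subseteq> {0..pi}" for A
    unfolding \<phi>_def[abs_def] using that cap_moment_nonneg
    by (intro continuous_intros continuous_on_powr' continuous_at_imp_continuous_on[of _ cap_moment] ballI DERIV_isCont[OF DERIV_cap_moment]) auto
  have "\<phi> t \<le> \<phi> s"
  proof (cases "s < t")
    case True
    then show ?thesis
    \<comment> \<open>The open variant admits s = 0, where the cap moment vanishes and the chain
      rule for its power does not apply; continuity is enough there.\<close>
    proof (intro DERIV_nonpos_imp_decreasing_open[of s t \<phi>])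
      fix x assume x: "s < x" "x < t"
      then have "x * cap_moment x powr (-1/3) \<le> c"
        using cap_moment_ratio_mono[of x t] s t by (simp add: c_def mult.commute)
      moreover have "0 \<le> sin x" using x s t by (intro sin_ge_zero) auto
      ultimately have "2/3 * sin x * (x * cap_moment x powr (-1/3) - c) \<le> 0"
        by (intro mult_nonneg_nonpos) auto
      then show "\<exists>y. (\<phi> has_real_derivative y) (at x) \<and> y \<le> 0"
        using der[of x] x s t by auto
    qed (use s t in \<open>auto intro!: cont\<close>)
  next
    case False
    then show ?thesis
    proof (intro DERIV_nonneg_imp_nondecreasing[of t s \<phi>])
      fix x assume x: "t \<le> x" "x \<le> s"
      then have "c \<le> x * cap_moment x powr (-1/3)"
        using cap_moment_ratio_mono[of t x] s t by (simp add: c_def mult.commute)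
      moreover have "0 \<le> sin x" using x s t by (intro sin_ge_zero) auto
      ultimately have "0 \<le> 2/3 * sin x * (x * cap_moment x powr (-1/3) - c)"
        by (intro mult_nonneg_nonneg) auto
      then show "\<exists>y. (\<phi> has_real_derivative y) (at x) \<and> 0 \<le> y"
        using der[of x] x s t by auto
    qed auto
  qed
  then show ?thesis by (simp add: \<phi>_def c_def algebra_simps diff_divide_distrib)
qed

lemma nn_integral_sin_upto:
  assumes "0 \<le> \<tau>" "\<tau> \<le> pi"
  shows "(\<integral>\<^sup>+s. ennreal (sin s) * indicator {0..\<tau>} s \<partial>lborel) = ennreal (1 - cos \<tau>)"
proof -
  have "(\<integral>\<^sup>+s. ennreal (sin s) * indicator {0..\<tau>} s \<partial>lborel) = ennreal (- cos \<tau> - (- cos 0))"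
    using assms by (intro nn_integral_FTC_Icc) (auto intro!: derivative_eq_intros sin_ge_zero)
  then show ?thesis by simp
qed

lemma nn_integral_moment_upto:
  assumes "0 \<le> \<tau>" "\<tau> \<le> pi"
  shows "(\<integral>\<^sup>+s. ennreal (s * sin s) * indicator {0..\<tau>} s \<partial>lborel) = ennreal (cap_moment \<tau>)"
proof -
  have "(\<integral>\<^sup>+s. ennreal (s * sin s) * indicator {0..\<tau>} s \<partial>lborel) = ennreal (cap_moment \<tau> - cap_moment 0)"
    using assms by (intro nn_integral_FTC_Icc) (auto intro!: DERIV_cap_moment mult_nonneg_nonneg sin_ge_zero)
  then show ?thesis by (simp add: cap_moment_def)
qed

text \<open>The factor s in \<open>nn_integral_arc\<close> counts an arc in proportion to its
  length. Division by the angle cancels it and leaves the area element sin s, so that the second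
  integral measures edges.\<close>

lemma nn_integral_arc_moments:
  assumes "0 \<le> \<tau>" "\<tau> \<le> pi"
  shows "(\<integral>\<^sup>+l. \<integral>\<^sup>+k. ennreal (arc_density l k) * indicator {0<..\<tau>} (arc_angle l k) \<partial>lborel \<partial>lborel) = ennreal (2 * cap_moment \<tau>)"
    and "(\<integral>\<^sup>+l. \<integral>\<^sup>+k. ennreal (arc_density l k) * (ennreal (1 / arc_angle l k) * indicator {0<..\<tau>} (arc_angle l k)) \<partial>lborel \<partial>lborel)
       = ennreal (2 * (1 - cos \<tau>))"
proof -
  have AE0: "AE s in lborel. s \<noteq> 0 \<and> s \<noteq> pi"
    using AE_lborel_singleton[of 0] AE_lborel_singleton[of pi] by (rule AE_conjI)
  have "(\<integral>\<^sup>+s. ennreal (s * sin s) * indicator {0<..\<tau>} s * indicator {0<..<pi} s \<partial>lborel)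
    = (\<integral>\<^sup>+s. ennreal (s * sin s) * indicator {0..\<tau>} s \<partial>lborel)"
    by (rule nn_integral_cong_AE, rule eventually_mono[OF AE0]) (use assms in \<open>auto simp: indicator_def\<close>)
  then show "(\<integral>\<^sup>+l. \<integral>\<^sup>+k. ennreal (arc_density l k) * indicator {0<..\<tau>} (arc_angle l k) \<partial>lborel \<partial>lborel) = ennreal (2 * cap_moment \<tau>)"
    using nn_integral_arc[of "indicator {0<..\<tau>}"] nn_integral_moment_upto[OF assms] cap_moment_nonneg[OF assms]
    by (simp add: ennreal_mult)
  have "(\<integral>\<^sup>+s. ennreal (s * sin s) * (ennreal (1 / s) * indicator {0<..\<tau>} s) * indicator {0<..<pi} s \<partial>lborel)
    = (\<integral>\<^sup>+s. ennreal (sin s) * indicator {0..\<tau>} s \<partial>lborel)"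
  proof (rule nn_integral_cong_AE, rule eventually_mono[OF AE0])
    fix s assume s: "s \<noteq> 0 \<and> s \<noteq> pi"
    show "ennreal (s * sin s) * (ennreal (1 / s) * indicator {0<..\<tau>} s) * indicator {0<..<pi} s = ennreal (sin s) * indicator {0..\<tau>} s"
    proof (cases "0 < s \<and> s \<le> \<tau>")
      case True
      then have "ennreal (s * sin s) * ennreal (1 / s) = ennreal (sin s)"
        using assms sin_ge_zero[of s] by (simp add: ennreal_mult[symmetric])
      then show ?thesis using True s assms by (simp add: indicator_def)
    next
      case False
      then show ?thesis using s by (auto simp: indicator_def)
    qed
  qed
  then show "(\<integral>\<^sup>+l. \<integral>\<^sup>+k. ennreal (arc_density l k) * (ennreal (1 / arc_angle l k) * indicator {0<..\<tau>} (arc_angle l k)) \<partial>lborel \<partial>lborel)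
       = ennreal (2 * (1 - cos \<tau>))"
    using nn_integral_arc[of "\<lambda>s. ennreal (1 / s) * indicator {0<..\<tau>} s"] nn_integral_sin_upto[OF assms]
    by (simp add: ennreal_mult del: right_diff_distrib_numeral)
qed

lemma nn_integral_arc_density: "(\<integral>\<^sup>+l. \<integral>\<^sup>+k. ennreal (arc_density l k) \<partial>lborel \<partial>lborel) = ennreal (2 * pi)"
proof -
  have "(\<integral>\<^sup>+s. ennreal (s * sin s) * indicator {0<..<pi} s \<partial>lborel) = (\<integral>\<^sup>+s. ennreal (s * sin s) * indicator {0..pi} s \<partial>lborel)"
    by (intro nn_integral_cong) (auto simp: indicator_def)
  also have "\<dots> = ennreal pi" using nn_integral_moment_upto[of pi] by (simp add: cap_moment_def)
  finally show ?thesis using nn_integral_arc[of "\<lambda>_. 1"] by (simp add: ennreal_mult)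
qed

text \<open>The angle \<tau> acts as a Lagrange multiplier for the amount of edges: 1 - \<tau> / s
  has the sign of s - \<tau>, so (1 - \<tau> / s) times the difference of v and the indicator of s
  <= \<tau> is nonnegative pointwise. The terms are distributed over the two sides so that each of
  them is nonnegative.\<close>

lemma arc_bathtub:
  fixes v :: "real \<Rightarrow> real \<Rightarrow> real" and \<tau> :: real
  assumes [measurable]: "(\<lambda>p. v (fst p) (snd p)) \<in> borel_measurable (borel \<Otimes>\<^sub>M borel)"
    and v: "\<And>l k. 0 \<le> v l k" "\<And>l k. v l k \<le> 1" and t: "0 \<le> \<tau>" "\<tau> \<le> pi"
  shows "ennreal (2 * cap_moment \<tau>) + ennreal \<tau> * (\<integral>\<^sup>+l. \<integral>\<^sup>+k. ennreal (arc_density l k * (v l k / arc_angle l k)) \<partial>lborel \<partial>lborel)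
    \<le> (\<integral>\<^sup>+l. \<integral>\<^sup>+k. ennreal (arc_density l k * v l k) \<partial>lborel \<partial>lborel) + ennreal \<tau> * ennreal (2 * (1 - cos \<tau>))"
proof -
  have d0: "0 \<le> arc_density l k" for l k by (simp add: arc_density_def)
  have vm[measurable]: "(\<lambda>k. v l k) \<in> borel_measurable borel" for l
    using measurable_compose[of "\<lambda>k. (l, k)" borel "borel \<Otimes>\<^sub>M borel" "\<lambda>p. v (fst p) (snd p)" borel] by simp
  have pw: "indicator {0<..\<tau>} s + ennreal \<tau> * ennreal (x / s) \<le> ennreal x + ennreal \<tau> * (ennreal (1 / s) * indicator {0<..\<tau>} s)"
    if x: "0 \<le> x" "x \<le> 1" for x s :: real
  proof (cases "0 < s \<and> s \<le> \<tau>")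
    case True
    have "0 \<le> (1 - x) * (\<tau> / s - 1)" using True x by (intro mult_nonneg_nonneg) auto
    then have "1 + \<tau> * (x / s) \<le> x + \<tau> * (1 / s)" by (simp add: algebra_simps diff_divide_distrib)
    then have "ennreal (1 + \<tau> * (x / s)) \<le> ennreal (x + \<tau> * (1 / s))" by (rule ennreal_leI)
    moreover have "ennreal (1 + \<tau> * (x / s)) = 1 + ennreal \<tau> * ennreal (x / s)"
      using True x t by (simp add: ennreal_mult[symmetric])
    moreover have "ennreal (x + \<tau> * (1 / s)) = ennreal x + ennreal \<tau> * ennreal (1 / s)"
      using True x t by (simp add: ennreal_mult[symmetric] ennreal_plus[symmetric] del: ennreal_plus)
    ultimately show ?thesis using True by simp
  next
    case False
    have "ennreal \<tau> * ennreal (x / s) \<le> ennreal x"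
    proof (cases "s > 0")
      case True
      then have "\<tau> * x \<le> s * x" using False x by (intro mult_right_mono) auto
      then have "\<tau> * (x / s) \<le> x" using True by (simp add: field_simps)
      then have "ennreal (\<tau> * (x / s)) \<le> ennreal x" by (rule ennreal_leI)
      then show ?thesis using x t True by (simp add: ennreal_mult[symmetric])
    next
      case False
      then have "x / s \<le> 0" using x by (simp add: divide_nonneg_nonpos)
      then show ?thesis by (simp add: ennreal_neg)
    qed
    moreover have "indicator {0<..\<tau>} s = (0::ennreal)" using False by auto
    ultimately show ?thesis by simp
  qed
  have "ennreal (2 * cap_moment \<tau>) + ennreal \<tau> * (\<integral>\<^sup>+l. \<integral>\<^sup>+k. ennreal (arc_density l k * (v l k / arc_angle l k)) \<partial>lborel \<partial>lborel)
    = (\<integral>\<^sup>+l. \<integral>\<^sup>+k. ennreal (arc_density l k) * (indicator {0<..\<tau>} (arc_angle l k) + ennreal \<tau> * ennreal (v l k / arc_angle l k)) \<partial>lborel \<partial>lborel)"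
  proof -
    have "ennreal (arc_density l k) * (indicator {0<..\<tau>} (arc_angle l k) + ennreal \<tau> * ennreal (v l k / arc_angle l k))
      = ennreal (arc_density l k) * indicator {0<..\<tau>} (arc_angle l k) + ennreal \<tau> * ennreal (arc_density l k * (v l k / arc_angle l k))" for l k
      by (simp only: distrib_left ennreal_mult'[OF d0] mult_ac)
    then show ?thesis
      by (simp add: nn_integral_add nn_integral_cmult nn_integral_arc_moments(1)[OF t])
  qed
  also have "\<dots> \<le> (\<integral>\<^sup>+l. \<integral>\<^sup>+k. ennreal (arc_density l k) * (ennreal (v l k) + ennreal \<tau> * (ennreal (1 / arc_angle l k) * indicator {0<..\<tau>} (arc_angle l k))) \<partial>lborel \<partial>lborel)"
    by (intro nn_integral_mono mult_left_mono pw v) simp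
  also have "\<dots> = (\<integral>\<^sup>+l. \<integral>\<^sup>+k. ennreal (arc_density l k * v l k) \<partial>lborel \<partial>lborel) + ennreal \<tau> * ennreal (2 * (1 - cos \<tau>))"
  proof -
    have "ennreal (arc_density l k) * (ennreal (v l k) + ennreal \<tau> * (ennreal (1 / arc_angle l k) * indicator {0<..\<tau>} (arc_angle l k)))
      = ennreal (arc_density l k * v l k) + ennreal \<tau> * (ennreal (arc_density l k) * (ennreal (1 / arc_angle l k) * indicator {0<..\<tau>} (arc_angle l k)))" for l k
      by (simp only: distrib_left ennreal_mult'[OF d0] mult_ac)
    then show ?thesis
      by (simp add: nn_integral_add nn_integral_cmult nn_integral_arc_moments(2)[OF t])
  qed
  finally show ?thesis .
qed

text \<open>On one great circle through Q, h is the mass of arcs and e the amount of edges. For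
  \<tau> with 2 (1 - cos \<tau>) = e the two correction terms of \<open>arc_bathtub\<close> agree,
  which leaves h >= 2 * \<open>cap_moment \<tau>\<close>, and the tangent at t makes the bound
  linear in e. Everything is scaled by 6 (2 D)^(4/3), the coefficient that
  \<open>one_dim_lower_bound\<close> attaches to the (2/3)-power for the y chosen afterwards.
  Equality holds for h = 2 D and e = 2 (1 - cos t).\<close>

lemma arc_slice_bound:
  fixes v :: "real \<Rightarrow> real \<Rightarrow> real" and t :: real
  assumes vm[measurable]: "(\<lambda>p. v (fst p) (snd p)) \<in> borel_measurable (borel \<Otimes>\<^sub>M borel)"
    and v: "\<And>l k. 0 \<le> v l k" "\<And>l k. v l k \<le> 1" and t: "0 < t" "t \<le> pi"
  defines "h \<equiv> \<integral>\<^sup>+l. \<integral>\<^sup>+k. ennreal (arc_density l k * v l k) \<partial>lborel \<partial>lborel"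
    and "e \<equiv> \<integral>\<^sup>+l. \<integral>\<^sup>+k. ennreal (arc_density l k * (v l k / arc_angle l k)) \<partial>lborel \<partial>lborel"
    and "D \<equiv> cap_moment t"
  shows "h \<le> ennreal (2 * pi)"
    and "ennreal (24 * D\<^sup>2) + ennreal (8 * D * t) * e
      \<le> ennreal (6 * (2 powr (2/3) * D powr (2/3))\<^sup>2) * ennreal (enn2real h powr (2/3)) + ennreal (16 * D * t * (1 - cos t))"
proof -
  have d0: "0 \<le> arc_density l k" for l k by (simp add: arc_density_def)
  have "h \<le> (\<integral>\<^sup>+l. \<integral>\<^sup>+k. ennreal (arc_density l k) \<partial>lborel \<partial>lborel)"
    unfolding h_def using v d0 by (intro nn_integral_mono ennreal_leI mult_left_le) auto
  then show hb: "h \<le> ennreal (2 * pi)" by (simp only: nn_integral_arc_density)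
  define h' where "h' = enn2real h"
  have h': "h = ennreal h'" "0 \<le> h'"
  proof -
    have "h < top" using hb by (rule le_less_trans) simp
    then show "h = ennreal h'" by (simp add: h'_def)
  qed (simp add: h'_def)
  \<comment> \<open>Cauchy-Schwarz for the vectors (k, l) and (1 - k, - l), with defect exactly l^2.
    It keeps the argument of \<open>arccos\<close> in {-1..1}, where its value is specified.\<close>
  have ang: "arc_angle l k \<le> pi \<and> 0 \<le> arc_angle l k" for l k
  proof -
    have "\<bar>(k * (1 - k) + l * (- l)) / (sqrt (k\<^sup>2 + l\<^sup>2) * sqrt ((1 - k)\<^sup>2 + l\<^sup>2))\<bar> \<le> 1"
    proof -
      have "(k * (1 - k) + l * (- l))\<^sup>2 \<le> (k\<^sup>2 + l\<^sup>2) * ((1 - k)\<^sup>2 + l\<^sup>2)"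
      proof -
        have "(k\<^sup>2 + l\<^sup>2) * ((1 - k)\<^sup>2 + l\<^sup>2) - (k * (1 - k) + l * (- l))\<^sup>2 = l\<^sup>2"
          by (simp add: power2_eq_square algebra_simps)
        then show ?thesis by (smt (verit) zero_le_power2)
      qed
      then have "\<bar>k * (1 - k) + l * (- l)\<bar> \<le> sqrt ((k\<^sup>2 + l\<^sup>2) * ((1 - k)\<^sup>2 + l\<^sup>2))"
        by (intro real_le_rsqrt) simp
      then have "\<bar>k * (1 - k) + l * (- l)\<bar> \<le> sqrt (k\<^sup>2 + l\<^sup>2) * sqrt ((1 - k)\<^sup>2 + l\<^sup>2)"
        by (simp only: real_sqrt_mult)
      moreover have "x / y \<le> 1" if "x \<le> y" "0 \<le> y" for x y :: real
        using that by (cases "y = 0") auto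
      moreover have "0 \<le> sqrt (k\<^sup>2 + l\<^sup>2) * sqrt ((1 - k)\<^sup>2 + l\<^sup>2)" by simp
      ultimately show ?thesis by (simp only: abs_divide abs_of_nonneg)
    qed
    then have "- 1 \<le> (k * (1 - k) + l * (- l)) / (sqrt (k\<^sup>2 + l\<^sup>2) * sqrt ((1 - k)\<^sup>2 + l\<^sup>2))"
      "(k * (1 - k) + l * (- l)) / (sqrt (k\<^sup>2 + l\<^sup>2) * sqrt ((1 - k)\<^sup>2 + l\<^sup>2)) \<le> 1"
      unfolding abs_le_iff by (simp_all only: minus_le_iff)
    then have "arccos ((k * (1 - k) + l * (- l)) / (sqrt (k\<^sup>2 + l\<^sup>2) * sqrt ((1 - k)\<^sup>2 + l\<^sup>2))) \<in> {0..pi}"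
      unfolding atLeastAtMost_iff by (intro conjI arccos_lbound arccos_ubound)
    then show ?thesis by (simp add: arc_angle_def power2_eq_square)
  qed
  have "e \<le> (\<integral>\<^sup>+l. \<integral>\<^sup>+k. ennreal (arc_density l k) * (ennreal (1 / arc_angle l k) * indicator {0<..pi} (arc_angle l k)) \<partial>lborel \<partial>lborel)"
    unfolding e_def
  proof (intro nn_integral_mono)
    fix l k
    show "ennreal (arc_density l k * (v l k / arc_angle l k)) \<le> ennreal (arc_density l k) * (ennreal (1 / arc_angle l k) * indicator {0<..pi} (arc_angle l k))"
    proof (cases "arc_angle l k = 0")
      case False
      then have a: "arc_angle l k \<in> {0<..pi}" using ang[of l k] by auto
      have "v l k / arc_angle l k \<le> 1 / arc_angle l k" using a v by (intro divide_right_mono) auto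
      then have "ennreal (arc_density l k * (v l k / arc_angle l k)) \<le> ennreal (arc_density l k * (1 / arc_angle l k))"
        using d0 by (intro ennreal_leI mult_left_mono)
      then show ?thesis using a by (simp add: ennreal_mult'[OF d0, symmetric])
    qed simp
  qed
  also have "\<dots> = ennreal 4" by (subst nn_integral_arc_moments(2)) simp_all
  finally have eb: "e \<le> ennreal 4" .
  define e' where "e' = enn2real e"
  have e': "e = ennreal e'" "0 \<le> e'"
  proof -
    have "e < top" using eb by (rule le_less_trans) simp
    then show "e = ennreal e'" by (simp add: e'_def)
  qed (simp add: e'_def)
  \<comment> \<open>The value 4 belongs to all arcs being present. The bound keeps 1 - e' / 2 above
    -1, so that a threshold \<tau> exists.\<close>
  have e4: "e' \<le> 4" using eb unfolding e'(1) by (subst (asm) ennreal_le_iff) simp_all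
  define \<tau> where "\<tau> = arccos (1 - e' / 2)"
  have \<tau>: "0 \<le> \<tau>" "\<tau> \<le> pi" "cos \<tau> = 1 - e' / 2"
    using e' e4 by (auto simp: \<tau>_def arccos_lbound arccos_ubound)
  have "ennreal (2 * cap_moment \<tau>) + ennreal \<tau> * e \<le> h + ennreal \<tau> * ennreal (2 * (1 - cos \<tau>))"
    unfolding h_def e_def by (rule arc_bathtub) (use vm v \<tau> in auto)
  then have "ennreal (2 * cap_moment \<tau> + \<tau> * e') \<le> ennreal (h' + \<tau> * e')"
    using \<tau> e' h' cap_moment_nonneg[of \<tau>] by (simp add: ennreal_mult)
  then have "2 * cap_moment \<tau> \<le> h'"
    using \<tau> e' h' by (subst (asm) ennreal_le_iff) auto
  then have "(2 * cap_moment \<tau>) powr (2/3) \<le> h' powr (2/3)"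
    using cap_moment_nonneg[of \<tau>] \<tau> by (intro powr_mono2) auto
  then have hp: "2 powr (2/3) * cap_moment \<tau> powr (2/3) \<le> h' powr (2/3)"
    using cap_moment_nonneg[of \<tau>] \<tau> by (simp add: powr_mult)
  have D: "D > 0" unfolding D_def using t by (rule cap_moment_pos)
  \<comment> \<open>Cube roots of D and of 2 replace the fractional powers, so that the remaining
    computation is polynomial.\<close>
  define d where "d = D powr (1/3)"
  have dp: "d > 0" using D by (simp add: d_def)
  have d3: "D = d ^ 3" using D by (simp add: d_def powr_powr flip: powr_numeral)
  have d2: "D powr (2/3) = d ^ 2" using D by (simp add: d_def powr_powr flip: powr_numeral)
  have d1: "D powr (-1/3) = 1 / d" using D powr_minus_divide[of D "1/3"] by (simp add: d_def)
  define c where "c = (2::real) powr (1/3)"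
  have cp: "c > 0" by (simp add: c_def)
  have c3: "c ^ 3 = 2" by (simp add: c_def powr_powr flip: powr_numeral)
  have c2: "2 powr (2/3) = c ^ 2" by (simp add: c_def powr_powr flip: powr_numeral)
  have "D powr (2/3) + 2/3 * D powr (-1/3) * t * (cos t - cos \<tau>) \<le> cap_moment \<tau> powr (2/3)"
    unfolding D_def using cap_moment_tangent[OF t \<tau>(1,2)] .
  then have "d\<^sup>2 + 2/3 * (1 / d) * t * (e' / 2 - (1 - cos t)) \<le> cap_moment \<tau> powr (2/3)"
    unfolding d1 d2 \<tau>(3) by (simp add: algebra_simps)
  then have "c\<^sup>2 * (d\<^sup>2 + 2/3 * (1 / d) * t * (e' / 2 - (1 - cos t))) \<le> h' powr (2/3)"
    using hp cp unfolding c2 by (smt (verit) mult_left_mono zero_le_power2)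
  then have "6 * (c\<^sup>2 * d\<^sup>2)\<^sup>2 * (c\<^sup>2 * (d\<^sup>2 + 2/3 * (1 / d) * t * (e' / 2 - (1 - cos t)))) \<le> 6 * (c\<^sup>2 * d\<^sup>2)\<^sup>2 * h' powr (2/3)"
    by (intro mult_left_mono) auto
  moreover have "6 * (c\<^sup>2 * d\<^sup>2)\<^sup>2 * (c\<^sup>2 * (d\<^sup>2 + 2/3 * (1 / d) * t * (e' / 2 - (1 - cos t)))) = 24 * D\<^sup>2 + 8 * D * t * e' - 16 * D * t * (1 - cos t)"
  proof -
    have "6 * (c\<^sup>2 * d\<^sup>2)\<^sup>2 * (c\<^sup>2 * (d\<^sup>2 + 2/3 * (1 / d) * t * (e' / 2 - (1 - cos t))))
      = 6 * (c ^ 3)\<^sup>2 * (d ^ 6 + 2/3 * d ^ 3 * t * (e' / 2 - (1 - cos t)))"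
      using dp by (simp add: field_simps power_eq_if)
    also have "\<dots> = 24 * D\<^sup>2 + 8 * D * t * e' - 16 * D * t * (1 - cos t)"
      unfolding c3 d3 by (simp add: algebra_simps power_mult[symmetric] add_divide_distrib diff_divide_distrib)
    finally show ?thesis .
  qed
  ultimately have r: "24 * D\<^sup>2 + 8 * D * t * e' \<le> 6 * (c\<^sup>2 * d\<^sup>2)\<^sup>2 * h' powr (2/3) + 16 * D * t * (1 - cos t)"
    by linarith
  have nn: "0 \<le> 16 * D * t * (1 - cos t)" "0 \<le> 8 * D * t" using D t by (auto intro!: mult_nonneg_nonneg)
  show "ennreal (24 * D\<^sup>2) + ennreal (8 * D * t) * e
      \<le> ennreal (6 * (2 powr (2/3) * D powr (2/3))\<^sup>2) * ennreal (enn2real h powr (2/3)) + ennreal (16 * D * t * (1 - cos t))"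
    unfolding c2 d2 h'_def[symmetric] e'(1) using ennreal_leI[OF r] nn e'(2)
    by (simp only: ennreal_mult[symmetric] ennreal_plus[symmetric] zero_le_power2 mult_nonneg_nonneg powr_ge_zero zero_le_numeral)
qed

subsection \<open>Crossings at a given point\<close>

text \<open>Polar coordinates with the slope m in place of the angle. The second coordinate l is the
  signed distance from the origin, so that the arc density on each line is the same function of l;
  the Jacobian is |l| / (1 + m^2).\<close>

lemma nn_integral_slopes:
  fixes Z :: "real \<times> real \<Rightarrow> ennreal"
  assumes [measurable]: "Z \<in> borel_measurable (borel \<Otimes>\<^sub>M borel)"
  shows "(\<integral>\<^sup>+x. \<integral>\<^sup>+y. Z (x, y) \<partial>lborel \<partial>lborel)
    = (\<integral>\<^sup>+m. \<integral>\<^sup>+l. ennreal (\<bar>l\<bar> / (1 + m\<^sup>2)) * Z (l / sqrt (1 + m\<^sup>2), m * l / sqrt (1 + m\<^sup>2)) \<partial>lborel \<partial>lborel)"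
proof -
  have "(\<integral>\<^sup>+x. \<integral>\<^sup>+y. Z (x, y) \<partial>lborel \<partial>lborel) = (\<integral>\<^sup>+x. \<integral>\<^sup>+m. ennreal \<bar>x\<bar> * Z (x, m * x) \<partial>lborel \<partial>lborel)"
  proof (rule nn_integral_cong_AE, rule eventually_mono[OF AE_lborel_singleton[of 0]])
    fix x :: real assume x: "x \<noteq> 0"
    have "(\<integral>\<^sup>+y. Z (x, y) \<partial>lborel) = ennreal \<bar>x\<bar> * (\<integral>\<^sup>+m. Z (x, 0 + x * m) \<partial>lborel)"
      using x by (intro nn_integral_real_affine) simp_all
    also have "\<dots> = (\<integral>\<^sup>+m. ennreal \<bar>x\<bar> * Z (x, m * x) \<partial>lborel)"
      by (simp add: nn_integral_cmult mult.commute)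
    finally show "(\<integral>\<^sup>+y. Z (x, y) \<partial>lborel) = (\<integral>\<^sup>+m. ennreal \<bar>x\<bar> * Z (x, m * x) \<partial>lborel)" .
  qed
  also have "\<dots> = (\<integral>\<^sup>+m. \<integral>\<^sup>+x. ennreal \<bar>x\<bar> * Z (x, m * x) \<partial>lborel \<partial>lborel)"
    by (rule lborel_pair.Fubini') measurable
  also have "\<dots> = (\<integral>\<^sup>+m. \<integral>\<^sup>+l. ennreal (\<bar>l\<bar> / (1 + m\<^sup>2)) * Z (l / sqrt (1 + m\<^sup>2), m * l / sqrt (1 + m\<^sup>2)) \<partial>lborel \<partial>lborel)"
  proof (rule nn_integral_cong)
    fix m :: real
    define r where "r = sqrt (1 + m\<^sup>2)"
    have r: "r > 0" "r * r = 1 + m\<^sup>2" by (auto simp: r_def add_pos_nonneg)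
    have "(\<integral>\<^sup>+x. ennreal \<bar>x\<bar> * Z (x, m * x) \<partial>lborel) = ennreal \<bar>1 / r\<bar> * (\<integral>\<^sup>+l. ennreal \<bar>0 + 1 / r * l\<bar> * Z (0 + 1 / r * l, m * (0 + 1 / r * l)) \<partial>lborel)"
      using r by (intro nn_integral_real_affine) simp_all
    also have "\<dots> = (\<integral>\<^sup>+l. ennreal \<bar>1 / r\<bar> * (ennreal \<bar>0 + 1 / r * l\<bar> * Z (0 + 1 / r * l, m * (0 + 1 / r * l))) \<partial>lborel)"
      by (rule nn_integral_cmult[symmetric]) measurable
    also have "\<dots> = (\<integral>\<^sup>+l. ennreal (\<bar>l\<bar> / (1 + m\<^sup>2)) * Z (l / r, m * l / r) \<partial>lborel)"
    proof (rule nn_integral_cong)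
      fix l :: real
      have "ennreal \<bar>1 / r\<bar> * ennreal \<bar>0 + 1 / r * l\<bar> = ennreal (\<bar>l\<bar> / (1 + m\<^sup>2))"
        using r by (simp add: ennreal_mult[symmetric] abs_mult r(2)[symmetric])
      then show "ennreal \<bar>1 / r\<bar> * (ennreal \<bar>0 + 1 / r * l\<bar> * Z (0 + 1 / r * l, m * (0 + 1 / r * l))) = ennreal (\<bar>l\<bar> / (1 + m\<^sup>2)) * Z (l / r, m * l / r)"
        by (simp add: mult.assoc[symmetric])
    qed
    finally show "(\<integral>\<^sup>+x. ennreal \<bar>x\<bar> * Z (x, m * x) \<partial>lborel) = (\<integral>\<^sup>+l. ennreal (\<bar>l\<bar> / (1 + m\<^sup>2)) * Z (l / sqrt (1 + m\<^sup>2), m * l / sqrt (1 + m\<^sup>2)) \<partial>lborel)"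
      by (simp only: r_def)
  qed
  finally show ?thesis .
qed

lemma nn_integral_cauchy_density: "(\<integral>\<^sup>+m. ennreal (1 / (1 + m\<^sup>2)) \<partial>lborel) = ennreal pi"
proof -
  have "(\<integral>\<^sup>+m. ennreal (1 / (1 + m\<^sup>2)) \<partial>lborel) = (\<integral>\<^sup>+a. ennreal (1 / (1 + (1 * cot a)\<^sup>2)) * ennreal (1 / (sin a)\<^sup>2) * indicator {0<..<pi} a \<partial>lborel)"
    by (rule nn_integral_cot_substitution) simp_all
  also have "\<dots> = (\<integral>\<^sup>+a. indicator {0<..<pi} a \<partial>lborel)"
  proof (rule nn_integral_cong)
    fix a :: real
    show "ennreal (1 / (1 + (1 * cot a)\<^sup>2)) * ennreal (1 / (sin a)\<^sup>2) * indicator {0<..<pi} a = indicator {0<..<pi} a"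
    proof (cases "a \<in> {0<..<pi}")
      case True
      then have s: "sin a > 0" by (intro sin_gt_zero) auto
      have "(1 + (1 * cot a)\<^sup>2) * (sin a)\<^sup>2 = (sin a)\<^sup>2 + (cos a)\<^sup>2"
        using s by (simp add: cot_def distrib_right power_divide)
      then have "(1 + (1 * cot a)\<^sup>2) * (sin a)\<^sup>2 = 1" by simp
      then have "1 / (1 + (1 * cot a)\<^sup>2) * (1 / (sin a)\<^sup>2) = 1" by simp
      then have "ennreal (1 / (1 + (1 * cot a)\<^sup>2)) * ennreal (1 / (sin a)\<^sup>2) = 1"
        by (subst ennreal_mult[symmetric]) simp_all
      then show ?thesis by simp
    qed simp
  qed
  also have "\<dots> = ennreal pi" by simp
  finally show ?thesis .
qed

text \<open>Coordinates adapted to a crossing point Q = (0, 0, 1): one end is (x, y, k), the other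
  (- x, - y, 1 - k), and the denominator is the product of the cubes of their norms.\<close>

definition arc_weight :: "(real \<times> real \<times> real \<Rightarrow> real) \<Rightarrow> real \<Rightarrow> real \<Rightarrow> real \<Rightarrow> real" where
  "arc_weight w x y k = w (x, y, k) / (sqrt (x\<^sup>2 + y\<^sup>2 + k\<^sup>2) ^ 3 * sqrt (x\<^sup>2 + y\<^sup>2 + (1 - k)\<^sup>2) ^ 3)"

text \<open>The square of l in \<open>arc_density\<close> has two sources: one factor |l| is the
  Jacobian of \<open>nn_integral_slopes\<close>, the other comes from the crossing factor |x y' - y
  x'| or, for the edge term, from sqrt (x^2 + y^2).\<close>

lemma arc_weight_slope:
  fixes w m l k
  defines "r \<equiv> sqrt (1 + m\<^sup>2)"
  shows "l\<^sup>2 * arc_weight w (l / r) (m * l / r) k = arc_density l k * w (l / r, m * l / r, k)"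
    and "(l / r)\<^sup>2 + (m * l / r)\<^sup>2 = l\<^sup>2"
proof -
  have r: "r\<^sup>2 = 1 + m\<^sup>2" "r > 0" by (auto simp: r_def add_pos_nonneg)
  have "(l / r)\<^sup>2 + (m * l / r)\<^sup>2 = l\<^sup>2 * (1 + m\<^sup>2) / r\<^sup>2"
    by (simp add: power_divide power_mult_distrib add_divide_distrib[symmetric] algebra_simps)
  then show e: "(l / r)\<^sup>2 + (m * l / r)\<^sup>2 = l\<^sup>2" unfolding r(1)[symmetric] using r(2) by simp
  show "l\<^sup>2 * arc_weight w (l / r) (m * l / r) k = arc_density l k * w (l / r, m * l / r, k)"
    unfolding arc_weight_def arc_density_def e by (simp add: add.commute)
qed

lemma arc_angle_abs: "arc_angle \<bar>l\<bar> k = arc_angle l k"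
  by (simp add: arc_angle_def)

lemma arc_weight_measurable[measurable (raw)]:
  assumes [measurable]: "w \<in> borel_measurable (borel \<Otimes>\<^sub>M (borel \<Otimes>\<^sub>M borel))"
    "f \<in> borel_measurable M" "g \<in> borel_measurable M" "h \<in> borel_measurable M"
  shows "(\<lambda>x. arc_weight w (f x) (g x) (h x)) \<in> borel_measurable M"
  unfolding arc_weight_def by measurable

text \<open>Each slope m gives a great circle through Q with the problem treated in
  \<open>arc_slice_bound\<close>. The crossing factor splits into |m - m'| and a factor for each
  slice, so the sixfold integral is the double integral of \<open>one_dim_lower_bound\<close> for g
  m = h m / (1 + m^2)^(3/2). The power 2/3 turns the denominator into the Cauchy weight 1 / (1 +
  m^2) of total mass pi, against which the slice bound is integrated.\<close>

lemma local_crossing_bound: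
  fixes w :: "real \<times> real \<times> real \<Rightarrow> real" and t :: real
  assumes wm[measurable]: "w \<in> borel_measurable (borel \<Otimes>\<^sub>M (borel \<Otimes>\<^sub>M borel))"
    and w: "\<And>p. 0 \<le> w p" "\<And>p. w p \<le> 1" and t: "0 < t" "t \<le> pi"
  defines "D \<equiv> cap_moment t"
  shows "ennreal (8 * pi * D\<^sup>2) + ennreal (8 * D * t) *
      (\<integral>\<^sup>+x. \<integral>\<^sup>+y. \<integral>\<^sup>+k. ennreal (arc_weight w x y k * (sqrt (x\<^sup>2 + y\<^sup>2) / arc_angle (sqrt (x\<^sup>2 + y\<^sup>2)) k)) \<partial>lborel \<partial>lborel \<partial>lborel)
    \<le> (\<integral>\<^sup>+x. \<integral>\<^sup>+y. \<integral>\<^sup>+k. \<integral>\<^sup>+x'. \<integral>\<^sup>+y'. \<integral>\<^sup>+k'. ennreal (\<bar>x * y' - y * x'\<bar> * arc_weight w x y k * arc_weight w x' y' k')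
          \<partial>lborel \<partial>lborel \<partial>lborel \<partial>lborel \<partial>lborel \<partial>lborel)
      + ennreal (16 * pi * D * t * (1 - cos t))"
proof -
  define r where "r m = sqrt (1 + m\<^sup>2)" for m :: real
  have [measurable]: "r \<in> borel_measurable borel" unfolding r_def by measurable
  have r: "r m > 0" "r m * r m = 1 + m\<^sup>2" for m by (auto simp: r_def add_pos_nonneg)
  define F where "F = arc_weight w"
  have F0: "0 \<le> F x y k" for x y k unfolding F_def arc_weight_def using w by simp
  have Fm[measurable (raw)]: "(\<lambda>x. F (f x) (g x) (h x)) \<in> borel_measurable M"
    if "f \<in> borel_measurable M" "g \<in> borel_measurable M" "h \<in> borel_measurable M" for f g h and M :: "'z measure"
    unfolding F_def using that by measurable
  define v where "v m l k = w (l / r m, m * l / r m, k)" for m l k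
  have v: "0 \<le> v m l k" "v m l k \<le> 1" for m l k using w by (auto simp: v_def)
  have vm[measurable (raw)]: "(\<lambda>x. v (f x) (g x) (h x)) \<in> borel_measurable M"
    if [measurable]: "f \<in> borel_measurable M" "g \<in> borel_measurable M" "h \<in> borel_measurable M" for f g h and M :: "'y measure"
    unfolding v_def by measurable
  have Fv: "l\<^sup>2 * F (l / r m) (m * l / r m) k = arc_density l k * v m l k" for m l k
    unfolding F_def r_def v_def by (rule arc_weight_slope)
  have rr: "(l / r m)\<^sup>2 + (m * l / r m)\<^sup>2 = l\<^sup>2" for m l
    unfolding r_def by (rule arc_weight_slope)
  define h where "h m = (\<integral>\<^sup>+l. \<integral>\<^sup>+k. ennreal (arc_density l k * v m l k) \<partial>lborel \<partial>lborel)" for m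
  define e where "e m = (\<integral>\<^sup>+l. \<integral>\<^sup>+k. ennreal (arc_density l k * (v m l k / arc_angle l k)) \<partial>lborel \<partial>lborel)" for m
  have [measurable]: "h \<in> borel_measurable borel" "e \<in> borel_measurable borel"
    unfolding h_def e_def by measurable
  define gg where "gg m = ennreal (1 / r m ^ 3) * h m" for m
  have [measurable]: "gg \<in> borel_measurable borel" unfolding gg_def by measurable
  have slice: "h m \<le> ennreal (2 * pi)"
    "ennreal (24 * D\<^sup>2) + ennreal (8 * D * t) * e m
      \<le> ennreal (6 * (2 powr (2/3) * D powr (2/3))\<^sup>2) * ennreal (enn2real (h m) powr (2/3)) + ennreal (16 * D * t * (1 - cos t))" for m
    unfolding h_def e_def D_def by (rule arc_slice_bound; use v t in \<open>simp; measurable?\<close>)+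
  have D: "D > 0" unfolding D_def using t by (rule cap_moment_pos)
  define E where "E = (\<integral>\<^sup>+x. \<integral>\<^sup>+y. \<integral>\<^sup>+k. ennreal (F x y k * (sqrt (x\<^sup>2 + y\<^sup>2) / arc_angle (sqrt (x\<^sup>2 + y\<^sup>2)) k)) \<partial>lborel \<partial>lborel \<partial>lborel)"
  define I where "I = (\<integral>\<^sup>+x. \<integral>\<^sup>+y. \<integral>\<^sup>+k. \<integral>\<^sup>+x'. \<integral>\<^sup>+y'. \<integral>\<^sup>+k'. ennreal (\<bar>x * y' - y * x'\<bar> * F x y k * F x' y' k')
          \<partial>lborel \<partial>lborel \<partial>lborel \<partial>lborel \<partial>lborel \<partial>lborel)"
  have E: "E = (\<integral>\<^sup>+m. ennreal (1 / (1 + m\<^sup>2)) * e m \<partial>lborel)"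
  proof -
    have "E = (\<integral>\<^sup>+m. \<integral>\<^sup>+l. ennreal (\<bar>l\<bar> / (1 + m\<^sup>2)) *
        (\<integral>\<^sup>+k. ennreal (F (l / r m) (m * l / r m) k * (sqrt ((l / r m)\<^sup>2 + (m * l / r m)\<^sup>2) / arc_angle (sqrt ((l / r m)\<^sup>2 + (m * l / r m)\<^sup>2)) k)) \<partial>lborel) \<partial>lborel \<partial>lborel)"
      unfolding E_def r_def
      using nn_integral_slopes[of "\<lambda>p. \<integral>\<^sup>+k. ennreal (F (fst p) (snd p) k * (sqrt ((fst p)\<^sup>2 + (snd p)\<^sup>2) / arc_angle (sqrt ((fst p)\<^sup>2 + (snd p)\<^sup>2)) k)) \<partial>lborel"]
      by simp
    also have "\<dots> = (\<integral>\<^sup>+m. \<integral>\<^sup>+l. \<integral>\<^sup>+k. ennreal (1 / (1 + m\<^sup>2)) * ennreal (arc_density l k * (v m l k / arc_angle l k)) \<partial>lborel \<partial>lborel \<partial>lborel)"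
    proof (intro nn_integral_cong)
      fix m l :: real
      have "ennreal (\<bar>l\<bar> / (1 + m\<^sup>2)) * (\<integral>\<^sup>+k. ennreal (F (l / r m) (m * l / r m) k * (sqrt ((l / r m)\<^sup>2 + (m * l / r m)\<^sup>2) / arc_angle (sqrt ((l / r m)\<^sup>2 + (m * l / r m)\<^sup>2)) k)) \<partial>lborel)
        = (\<integral>\<^sup>+k. ennreal (\<bar>l\<bar> / (1 + m\<^sup>2)) * ennreal (F (l / r m) (m * l / r m) k * (sqrt ((l / r m)\<^sup>2 + (m * l / r m)\<^sup>2) / arc_angle (sqrt ((l / r m)\<^sup>2 + (m * l / r m)\<^sup>2)) k)) \<partial>lborel)"
        by (rule nn_integral_cmult[symmetric]) measurable
      also have "\<dots> = (\<integral>\<^sup>+k. ennreal (1 / (1 + m\<^sup>2)) * ennreal (arc_density l k * (v m l k / arc_angle l k)) \<partial>lborel)"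
      proof (rule nn_integral_cong)
        fix k :: real
        have n: "0 \<le> \<bar>l\<bar> / (1 + m\<^sup>2)" "0 \<le> 1 / (1 + m\<^sup>2)" by auto
        have ll: "\<bar>l\<bar> * \<bar>l\<bar> = l\<^sup>2" by (simp add: power2_eq_square)
        have "\<bar>l\<bar> / (1 + m\<^sup>2) * (F (l / r m) (m * l / r m) k * (\<bar>l\<bar> / arc_angle l k)) = 1 / (1 + m\<^sup>2) * (\<bar>l\<bar> * \<bar>l\<bar> * F (l / r m) (m * l / r m) k / arc_angle l k)"
          by simp
        also have "\<dots> = 1 / (1 + m\<^sup>2) * (arc_density l k * (v m l k / arc_angle l k))"
          unfolding ll Fv by simp
        finally show "ennreal (\<bar>l\<bar> / (1 + m\<^sup>2)) * ennreal (F (l / r m) (m * l / r m) k * (sqrt ((l / r m)\<^sup>2 + (m * l / r m)\<^sup>2) / arc_angle (sqrt ((l / r m)\<^sup>2 + (m * l / r m)\<^sup>2)) k))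
          = ennreal (1 / (1 + m\<^sup>2)) * ennreal (arc_density l k * (v m l k / arc_angle l k))"
          unfolding rr real_sqrt_abs arc_angle_abs ennreal_mult'[OF n(1), symmetric] ennreal_mult'[OF n(2), symmetric] by (rule arg_cong)
      qed
      finally show "ennreal (\<bar>l\<bar> / (1 + m\<^sup>2)) * (\<integral>\<^sup>+k. ennreal (F (l / r m) (m * l / r m) k * (sqrt ((l / r m)\<^sup>2 + (m * l / r m)\<^sup>2) / arc_angle (sqrt ((l / r m)\<^sup>2 + (m * l / r m)\<^sup>2)) k)) \<partial>lborel)
        = (\<integral>\<^sup>+k. ennreal (1 / (1 + m\<^sup>2)) * ennreal (arc_density l k * (v m l k / arc_angle l k)) \<partial>lborel)" .
    qed
    also have "\<dots> = (\<integral>\<^sup>+m. ennreal (1 / (1 + m\<^sup>2)) * e m \<partial>lborel)"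
      unfolding e_def by (simp add: nn_integral_cmult)
    finally show ?thesis .
  qed
  define c where "c m l k = \<bar>l\<bar> / (1 + m\<^sup>2) * (\<bar>l\<bar> / r m * F (l / r m) (m * l / r m) k)" for m l k
  have [measurable (raw)]: "(\<lambda>x. c (f x) (g x) (h x)) \<in> borel_measurable M"
    if [measurable]: "f \<in> borel_measurable M" "g \<in> borel_measurable M" "h \<in> borel_measurable M" for f g h and M :: "'x measure"
    unfolding c_def by measurable
  have cgg: "(\<integral>\<^sup>+l. \<integral>\<^sup>+k. ennreal (c m l k) \<partial>lborel \<partial>lborel) = gg m" for m
  proof -
    have "c m l k = 1 / r m ^ 3 * (arc_density l k * v m l k)" for l k
      unfolding Fv[symmetric] c_def using r(2)[of m] r(1)[of m]
      by (simp add: power2_eq_square power3_eq_cube r(2)[symmetric])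
    moreover have "0 \<le> 1 / r m ^ 3" using r(1)[of m] by simp
    ultimately have "ennreal (c m l k) = ennreal (1 / r m ^ 3) * ennreal (arc_density l k * v m l k)" for l k
      by (simp only: ennreal_mult')
    then show ?thesis unfolding gg_def h_def
      by (simp add: nn_integral_cmult)
  qed
  define K where "K m = (\<integral>\<^sup>+m'. ennreal \<bar>m - m'\<bar> * gg m' \<partial>lborel)" for m
  have [measurable]: "K \<in> borel_measurable borel" unfolding K_def by measurable
  have inner: "ennreal (\<bar>l\<bar> / (1 + m\<^sup>2)) * (\<integral>\<^sup>+x'. \<integral>\<^sup>+y'. \<integral>\<^sup>+k'. ennreal (\<bar>l / r m * y' - m * l / r m * x'\<bar> * F (l / r m) (m * l / r m) k * F x' y' k') \<partial>lborel \<partial>lborel \<partial>lborel)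
      = ennreal (c m l k) * K m" for m l k
  proof -
    define A where "A = F (l / r m) (m * l / r m) k"
    have A0: "0 \<le> A" unfolding A_def by (rule F0)
    have "(\<integral>\<^sup>+x'. \<integral>\<^sup>+y'. \<integral>\<^sup>+k'. ennreal (\<bar>l / r m * y' - m * l / r m * x'\<bar> * A * F x' y' k') \<partial>lborel \<partial>lborel \<partial>lborel)
      = (\<integral>\<^sup>+m'. \<integral>\<^sup>+l'. ennreal (\<bar>l'\<bar> / (1 + m'\<^sup>2)) *
          (\<integral>\<^sup>+k'. ennreal (\<bar>l / r m * (m' * l' / r m') - m * l / r m * (l' / r m')\<bar> * A * F (l' / r m') (m' * l' / r m') k') \<partial>lborel) \<partial>lborel \<partial>lborel)"
      unfolding r_def
      using nn_integral_slopes[of "\<lambda>p. \<integral>\<^sup>+k'. ennreal (\<bar>l / r m * snd p - m * l / r m * fst p\<bar> * A * F (fst p) (snd p) k') \<partial>lborel"]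
      by (simp add: r_def)
    also have "\<dots> = (\<integral>\<^sup>+m'. \<integral>\<^sup>+l'. \<integral>\<^sup>+k'. ennreal (\<bar>l\<bar> / r m * A) * (ennreal \<bar>m - m'\<bar> * ennreal (c m' l' k')) \<partial>lborel \<partial>lborel \<partial>lborel)"
    proof (intro nn_integral_cong)
      fix m' l' :: real
      have "ennreal (\<bar>l'\<bar> / (1 + m'\<^sup>2)) * (\<integral>\<^sup>+k'. ennreal (\<bar>l / r m * (m' * l' / r m') - m * l / r m * (l' / r m')\<bar> * A * F (l' / r m') (m' * l' / r m') k') \<partial>lborel)
        = (\<integral>\<^sup>+k'. ennreal (\<bar>l'\<bar> / (1 + m'\<^sup>2)) * ennreal (\<bar>l / r m * (m' * l' / r m') - m * l / r m * (l' / r m')\<bar> * A * F (l' / r m') (m' * l' / r m') k') \<partial>lborel)"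
        by (rule nn_integral_cmult[symmetric]) measurable
      also have "\<dots> = (\<integral>\<^sup>+k'. ennreal (\<bar>l\<bar> / r m * A) * (ennreal \<bar>m - m'\<bar> * ennreal (c m' l' k')) \<partial>lborel)"
      proof (rule nn_integral_cong)
        fix k' :: real
        have "l / r m * (m' * l' / r m') - m * l / r m * (l' / r m') = (l / r m) * (l' / r m') * (m' - m)"
          by (simp add: algebra_simps diff_divide_distrib)
        then have "\<bar>l / r m * (m' * l' / r m') - m * l / r m * (l' / r m')\<bar> = (\<bar>l\<bar> / r m) * (\<bar>l'\<bar> / r m') * \<bar>m - m'\<bar>"
          using r(1)[of m] r(1)[of m'] by (simp add: abs_mult abs_minus_commute)
        then have "\<bar>l'\<bar> / (1 + m'\<^sup>2) * (\<bar>l / r m * (m' * l' / r m') - m * l / r m * (l' / r m')\<bar> * A * F (l' / r m') (m' * l' / r m') k')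
          = \<bar>l\<bar> / r m * A * (\<bar>m - m'\<bar> * c m' l' k')"
          by (simp add: c_def mult_ac)
        moreover have "0 \<le> \<bar>l'\<bar> / (1 + m'\<^sup>2)" "0 \<le> \<bar>l\<bar> / r m * A" using A0 r(1)[of m] by auto
        ultimately show "ennreal (\<bar>l'\<bar> / (1 + m'\<^sup>2)) * ennreal (\<bar>l / r m * (m' * l' / r m') - m * l / r m * (l' / r m')\<bar> * A * F (l' / r m') (m' * l' / r m') k')
          = ennreal (\<bar>l\<bar> / r m * A) * (ennreal \<bar>m - m'\<bar> * ennreal (c m' l' k'))"
          by (simp only: ennreal_mult'[symmetric] abs_ge_zero)
      qed
      finally show "ennreal (\<bar>l'\<bar> / (1 + m'\<^sup>2)) * (\<integral>\<^sup>+k'. ennreal (\<bar>l / r m * (m' * l' / r m') - m * l / r m * (l' / r m')\<bar> * A * F (l' / r m') (m' * l' / r m') k') \<partial>lborel)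
        = (\<integral>\<^sup>+k'. ennreal (\<bar>l\<bar> / r m * A) * (ennreal \<bar>m - m'\<bar> * ennreal (c m' l' k')) \<partial>lborel)" .
    qed
    also have "\<dots> = ennreal (\<bar>l\<bar> / r m * A) * K m"
      unfolding K_def by (simp add: nn_integral_cmult cgg)
    finally have "ennreal (\<bar>l\<bar> / (1 + m\<^sup>2)) * (\<integral>\<^sup>+x'. \<integral>\<^sup>+y'. \<integral>\<^sup>+k'. ennreal (\<bar>l / r m * y' - m * l / r m * x'\<bar> * A * F x' y' k') \<partial>lborel \<partial>lborel \<partial>lborel)
      = ennreal (\<bar>l\<bar> / (1 + m\<^sup>2)) * (ennreal (\<bar>l\<bar> / r m * A) * K m)" by simp
    also have "\<dots> = ennreal (c m l k) * K m"
    proof -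
      have "0 \<le> \<bar>l\<bar> / (1 + m\<^sup>2)" by simp
      from ennreal_mult'[OF this] show ?thesis unfolding c_def A_def[symmetric] by (simp only: mult.assoc)
    qed
    finally show ?thesis unfolding A_def .
  qed
  have I: "I = (\<integral>\<^sup>+m. \<integral>\<^sup>+m'. gg m * (ennreal \<bar>m - m'\<bar> * gg m') \<partial>lborel \<partial>lborel)"
  proof -
    have "I = (\<integral>\<^sup>+m. \<integral>\<^sup>+l. ennreal (\<bar>l\<bar> / (1 + m\<^sup>2)) *
       (\<integral>\<^sup>+k. \<integral>\<^sup>+x'. \<integral>\<^sup>+y'. \<integral>\<^sup>+k'. ennreal (\<bar>l / r m * y' - m * l / r m * x'\<bar> * F (l / r m) (m * l / r m) k * F x' y' k') \<partial>lborel \<partial>lborel \<partial>lborel \<partial>lborel) \<partial>lborel \<partial>lborel)"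
      unfolding I_def r_def
      using nn_integral_slopes[of "\<lambda>p. \<integral>\<^sup>+k. \<integral>\<^sup>+x'. \<integral>\<^sup>+y'. \<integral>\<^sup>+k'. ennreal (\<bar>fst p * y' - snd p * x'\<bar> * F (fst p) (snd p) k * F x' y' k') \<partial>lborel \<partial>lborel \<partial>lborel \<partial>lborel"]
      by simp
    also have "\<dots> = (\<integral>\<^sup>+m. \<integral>\<^sup>+l. \<integral>\<^sup>+k. ennreal (\<bar>l\<bar> / (1 + m\<^sup>2)) *
       (\<integral>\<^sup>+x'. \<integral>\<^sup>+y'. \<integral>\<^sup>+k'. ennreal (\<bar>l / r m * y' - m * l / r m * x'\<bar> * F (l / r m) (m * l / r m) k * F x' y' k') \<partial>lborel \<partial>lborel \<partial>lborel) \<partial>lborel \<partial>lborel \<partial>lborel)"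
      by (subst nn_integral_cmult) simp_all
    also have "\<dots> = (\<integral>\<^sup>+m. \<integral>\<^sup>+l. \<integral>\<^sup>+k. ennreal (c m l k) * K m \<partial>lborel \<partial>lborel \<partial>lborel)"
      by (simp only: inner)
    also have "\<dots> = (\<integral>\<^sup>+m. gg m * K m \<partial>lborel)"
      by (simp add: nn_integral_multc cgg)
    also have "\<dots> = (\<integral>\<^sup>+m. \<integral>\<^sup>+m'. gg m * (ennreal \<bar>m - m'\<bar> * gg m') \<partial>lborel \<partial>lborel)"
      unfolding K_def by (simp add: nn_integral_cmult)
    finally show ?thesis .
  qed
  \<comment> \<open>The cube of r collects 1 / (1 + m^2) from the Jacobian and 1 / r from the
    crossing factor.\<close>
  define g where "g m = 1 / r m ^ 3 * enn2real (h m)" for m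
  have [measurable]: "g \<in> borel_measurable borel" unfolding g_def by measurable
  have hfin: "h m = ennreal (enn2real (h m))" for m
  proof -
    have "h m < top" using slice(1)[of m] by (rule le_less_trans) simp
    then show ?thesis by simp
  qed
  have g0: "0 \<le> g m" for m using r(1)[of m] by (simp add: g_def)
  have gg: "gg m = ennreal (g m)" for m
  proof -
    have "0 \<le> 1 / r m ^ 3" using r(1)[of m] by simp
    from ennreal_mult'[OF this] show ?thesis unfolding gg_def g_def by (simp only: hfin[symmetric])
  qed
  have gb: "g m \<le> 2 * pi * (1 / (1 + m\<^sup>2))" for m
  proof -
    have "enn2real (h m) \<le> 2 * pi"
      using slice(1)[of m] hfin[of m] by (metis enn2real_leI pi_ge_zero mult_nonneg_nonneg zero_le_numeral)
    moreover have "1 / r m ^ 3 \<le> 1 / (1 + m\<^sup>2)"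
    proof -
      have "1 \<le> r m" by (simp add: r_def)
      then have "r m * r m * 1 \<le> r m * r m * r m" using r(1)[of m] by (intro mult_left_mono) auto
      moreover have "0 < 1 + m\<^sup>2" by (simp add: add_pos_nonneg)
      ultimately show ?thesis using r[of m] by (intro divide_left_mono mult_pos_pos) (auto simp: power3_eq_cube)
    qed
    ultimately have "1 / r m ^ 3 * enn2real (h m) \<le> 1 / (1 + m\<^sup>2) * (2 * pi)"
      using r(1)[of m] by (intro mult_mono) auto
    then show ?thesis by (simp add: g_def mult.commute)
  qed
  have gint: "integrable lborel g"
  proof (rule integrableI_bounded)
    have "(\<integral>\<^sup>+m. ennreal (norm (g m)) \<partial>lborel) \<le> (\<integral>\<^sup>+m. ennreal (2 * pi) * ennreal (1 / (1 + m\<^sup>2)) \<partial>lborel)"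
      using g0 gb by (intro nn_integral_mono) (simp add: ennreal_mult[symmetric])
    also have "\<dots> = ennreal (2 * pi) * ennreal pi"
      by (subst nn_integral_cmult) (simp_all only: nn_integral_cauchy_density, measurable)
    also have "\<dots> < \<infinity>" by (simp add: ennreal_mult_less_top)
    finally show "(\<integral>\<^sup>+m. ennreal (norm (g m)) \<partial>lborel) < \<infinity>" .
  qed measurable
  \<comment> \<open>The integral of the (2/3)-power of g in the extremal case, where every slice has
    the mass 2 D; there the tangent of the one-dimensional bound touches.\<close>
  define y where "y = pi * (2 powr (2/3) * D powr (2/3))"
  have y: "y > 0" using D by (simp add: y_def)
  have y2: "6 * y\<^sup>2 / pi\<^sup>2 = 6 * (2 powr (2/3) * D powr (2/3))\<^sup>2"
    by (simp add: y_def power_mult_distrib)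
  have y3: "4 * y ^ 3 / pi\<^sup>2 = 16 * pi * D\<^sup>2"
  proof -
    have cube: "(x powr (2/3)) ^ 3 = x\<^sup>2" if "x > 0" for x :: real
    proof -
      have "(x powr (2/3)) ^ 3 = (x powr (2/3)) powr 3" by (subst powr_numeral) (use that in auto)
      also have "\<dots> = x\<^sup>2" using that by (simp add: powr_powr)
      finally show ?thesis .
    qed
    have "((2::real) powr (2/3)) ^ 3 = 4" by (subst cube) simp_all
    moreover have "(D powr (2/3)) ^ 3 = D\<^sup>2" using D by (rule cube)
    moreover have "4 * y ^ 3 / pi\<^sup>2 = 4 * (pi ^ 3 * ((2 powr (2/3)) ^ 3 * (D powr (2/3)) ^ 3)) / pi\<^sup>2"
      by (simp only: y_def power_mult_distrib)
    ultimately have "4 * y ^ 3 / pi\<^sup>2 = 4 * (pi ^ 3 * (4 * D\<^sup>2)) / pi\<^sup>2" by (simp only:)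
    then show ?thesis by (simp add: power3_eq_cube power2_eq_square)
  qed
  have one: "ennreal (6 * y\<^sup>2 / pi\<^sup>2) * (\<integral>\<^sup>+m. ennreal (g m powr (2/3)) \<partial>lborel) \<le> I + ennreal (16 * pi * D\<^sup>2)"
  proof -
    have "I = (\<integral>\<^sup>+m. \<integral>\<^sup>+m'. ennreal (\<bar>m - m'\<bar> * g m * g m') \<partial>lborel \<partial>lborel)"
      unfolding I gg using g0 by (simp add: ennreal_mult[symmetric] mult_ac)
    then show ?thesis using one_dim_lower_bound[OF _ g0 gint y] unfolding y3 by simp
  qed
  have gp: "g m powr (2/3) = 1 / (1 + m\<^sup>2) * enn2real (h m) powr (2/3)" for m
  proof -
    have "(1 / r m ^ 3) powr (2/3) = 1 / (1 + m\<^sup>2)"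
    proof -
      have "(r m ^ 3) powr (2/3) = r m powr 2" using r(1)[of m] by (simp add: powr_powr flip: powr_numeral)
      also have "\<dots> = 1 + m\<^sup>2" using r[of m] by (simp add: power2_eq_square)
      finally show ?thesis by (simp add: powr_divide)
    qed
    then show ?thesis unfolding g_def by (simp only: powr_mult)
  qed
  define C where "C = 16 * D * t * (1 - cos t)"
  have C0: "0 \<le> C" using D t by (simp add: C_def)
  have "ennreal (24 * pi * D\<^sup>2) + ennreal (8 * D * t) * E
    = (\<integral>\<^sup>+m. ennreal (1 / (1 + m\<^sup>2)) * (ennreal (24 * D\<^sup>2) + ennreal (8 * D * t) * e m) \<partial>lborel)"
  proof -
    have "(\<integral>\<^sup>+m. ennreal (1 / (1 + m\<^sup>2)) * (ennreal (24 * D\<^sup>2) + ennreal (8 * D * t) * e m) \<partial>lborel)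
      = (\<integral>\<^sup>+m. ennreal (24 * D\<^sup>2) * ennreal (1 / (1 + m\<^sup>2)) + ennreal (8 * D * t) * (ennreal (1 / (1 + m\<^sup>2)) * e m) \<partial>lborel)"
      by (intro nn_integral_cong) (simp only: distrib_left mult_ac)
    also have "\<dots> = ennreal (24 * D\<^sup>2) * (\<integral>\<^sup>+m. ennreal (1 / (1 + m\<^sup>2)) \<partial>lborel) + ennreal (8 * D * t) * (\<integral>\<^sup>+m. ennreal (1 / (1 + m\<^sup>2)) * e m \<partial>lborel)"
      by (subst nn_integral_add) (simp_all add: nn_integral_cmult)
    also have "\<dots> = ennreal (24 * D\<^sup>2) * ennreal pi + ennreal (8 * D * t) * E"
      by (simp only: nn_integral_cauchy_density E)
    also have "ennreal (24 * D\<^sup>2) * ennreal pi = ennreal (24 * pi * D\<^sup>2)"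
      by (simp add: ennreal_mult[symmetric] mult_ac)
    finally show ?thesis by (rule sym)
  qed
  also have "\<dots> \<le> (\<integral>\<^sup>+m. ennreal (1 / (1 + m\<^sup>2)) * (ennreal (6 * y\<^sup>2 / pi\<^sup>2) * ennreal (enn2real (h m) powr (2/3)) + ennreal C) \<partial>lborel)"
    unfolding y2 C_def by (intro nn_integral_mono mult_left_mono slice(2)) simp
  also have "\<dots> = (\<integral>\<^sup>+m. ennreal (6 * y\<^sup>2 / pi\<^sup>2) * ennreal (g m powr (2/3)) + ennreal C * ennreal (1 / (1 + m\<^sup>2)) \<partial>lborel)"
  proof (rule nn_integral_cong)
    fix m :: real
    have "ennreal (g m powr (2/3)) = ennreal (1 / (1 + m\<^sup>2)) * ennreal (enn2real (h m) powr (2/3))"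
      unfolding gp by (rule ennreal_mult) auto
    then show "ennreal (1 / (1 + m\<^sup>2)) * (ennreal (6 * y\<^sup>2 / pi\<^sup>2) * ennreal (enn2real (h m) powr (2/3)) + ennreal C)
      = ennreal (6 * y\<^sup>2 / pi\<^sup>2) * ennreal (g m powr (2/3)) + ennreal C * ennreal (1 / (1 + m\<^sup>2))"
      by (simp only: distrib_left mult_ac)
  qed
  also have "\<dots> = ennreal (6 * y\<^sup>2 / pi\<^sup>2) * (\<integral>\<^sup>+m. ennreal (g m powr (2/3)) \<partial>lborel) + ennreal C * (\<integral>\<^sup>+m. ennreal (1 / (1 + m\<^sup>2)) \<partial>lborel)"
    by (subst nn_integral_add) (simp_all add: nn_integral_cmult)
  also have "\<dots> \<le> I + ennreal (16 * pi * D\<^sup>2) + ennreal C * ennreal pi"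
    unfolding nn_integral_cauchy_density by (rule add_right_mono[OF one])
  also have "ennreal C * ennreal pi = ennreal (16 * pi * D * t * (1 - cos t))"
    using C0 by (simp add: ennreal_mult'[symmetric] C_def mult_ac)
  finally have fin: "ennreal (24 * pi * D\<^sup>2) + ennreal (8 * D * t) * E \<le> I + ennreal (16 * pi * D\<^sup>2) + ennreal (16 * pi * D * t * (1 - cos t))" .
  \<comment> \<open>The error term of the one-dimensional bound is two thirds of 24 pi D^2; it is
    finite and can be cancelled, and one third of the main term survives.\<close>
  have "ennreal (24 * pi * D\<^sup>2) = ennreal (16 * pi * D\<^sup>2) + ennreal (8 * pi * D\<^sup>2)"
    by (simp add: ennreal_plus[symmetric] del: ennreal_plus)
  with fin have "ennreal (16 * pi * D\<^sup>2) + (ennreal (8 * pi * D\<^sup>2) + ennreal (8 * D * t) * E) \<le> ennreal (16 * pi * D\<^sup>2) + (I + ennreal (16 * pi * D * t * (1 - cos t)))"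
    by (simp only: add_ac)
  then have "ennreal (8 * pi * D\<^sup>2) + ennreal (8 * D * t) * E \<le> I + ennreal (16 * pi * D * t * (1 - cos t))"
    by (subst (asm) ennreal_add_left_cancel_le) simp
  then show ?thesis unfolding E_def I_def F_def .
qed

section \<open>Triple products and crossing quadruples\<close>

lemma triple_eq: "triple a b c = a$1 * (b$2 * c$3 - b$3 * c$2) + a$2 * (b$3 * c$1 - b$1 * c$3) + a$3 * (b$1 * c$2 - b$2 * c$1)"
  by (simp add: triple_def cross3_def inner_vec_def sum_3)

lemma triple_lincomb:
  "triple Y X' (a *\<^sub>R X + b *\<^sub>R Y - c *\<^sub>R X') = a * triple X Y X'"
  "triple X X' (a *\<^sub>R X + b *\<^sub>R Y - c *\<^sub>R X') = - (b * triple X Y X')"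
  "triple X Y (a *\<^sub>R X + b *\<^sub>R Y - c *\<^sub>R X') = - (c * triple X Y X')"
  by (simp_all add: triple_eq algebra_simps)

lemma triple_scaleR: "triple (a *\<^sub>R X) (b *\<^sub>R Y) (c *\<^sub>R Z) = a * b * c * triple X Y Z"
  by (simp add: triple_eq algebra_simps)

lemma triple_uminus: "triple X Y (- Z) = - triple X Y Z"
  by (simp add: triple_eq algebra_simps)

lemma triple_cyclic: "triple X Y Z = triple Y Z X"
  by (simp add: triple_eq algebra_simps)

lemma triple_diff: "triple X (Q - X) Z = triple X Q Z"
  by (simp add: triple_eq algebra_simps)

lemma vec_nth_measurable[measurable (raw)]:
  fixes f :: "'b \<Rightarrow> real^3"
  assumes "f \<in> borel_measurable M"
  shows "(\<lambda>x. f x $ i) \<in> borel_measurable M"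
proof -
  have "(\<lambda>v::real^3. v $ i) \<in> borel_measurable borel"
    by (intro borel_measurable_continuous_onI continuous_intros)
  from measurable_compose[OF assms this] show ?thesis .
qed

lemma triple_measurable[measurable (raw)]:
  assumes [measurable]: "f \<in> borel_measurable M" "g \<in> borel_measurable M" "h \<in> borel_measurable M"
  shows "(\<lambda>x. triple (f x) (g x) (h x)) \<in> borel_measurable M"
  unfolding triple_eq by measurable

lemma cross3_norm_measurable[measurable (raw)]:
  assumes [measurable]: "f \<in> borel_measurable M" "g \<in> borel_measurable M"
  shows "(\<lambda>x. norm (cross3 (f x) (g x))) \<in> borel_measurable M"
proof -
  have "norm (cross3 X Y) = sqrt ((norm X * norm Y)\<^sup>2 - (X \<bullet> Y)\<^sup>2)" for X Y
    by (simp add: norm_cross_dot[symmetric])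
  then show ?thesis by simp
qed

text \<open>The four conditions say that \<open>X\<close>, \<open>Y\<close>, \<open>X'\<close>, \<open>Y'\<close> satisfy a linear relation
  \<open>a X + b Y = c X' + d Y'\<close> with positive coefficients, which are given by Cramer's rule: the arcs from
  \<open>X\<close> to \<open>Y\<close> and from \<open>X'\<close> to \<open>Y'\<close> meet in an interior point of both.\<close>

definition crosses :: "real^3 \<Rightarrow> real^3 \<Rightarrow> real^3 \<Rightarrow> real^3 \<Rightarrow> bool" where
  "crosses X Y X' Y' \<longleftrightarrow>
     (triple Y X' Y' > 0 \<and> triple X X' Y' < 0 \<and> triple X Y Y' < 0 \<and> triple X Y X' > 0) \<or>
     (triple Y X' Y' < 0 \<and> triple X X' Y' > 0 \<and> triple X Y Y' > 0 \<and> triple X Y X' < 0)"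

lemma crosses_measurable[measurable (raw)]:
  assumes [measurable]: "f \<in> borel_measurable M" "g \<in> borel_measurable M" "h \<in> borel_measurable M" "k \<in> borel_measurable M"
  shows "Measurable.pred M (\<lambda>x. crosses (f x) (g x) (h x) (k x))"
  unfolding crosses_def by measurable

lemma crosses_lincomb:
  assumes "0 < a" "0 < b" "0 < c" "triple X Y X' \<noteq> 0"
  shows "crosses X Y X' (a *\<^sub>R X + b *\<^sub>R Y - c *\<^sub>R X')"
  using assms unfolding crosses_def triple_lincomb
  by (cases "triple X Y X' > 0") (auto simp: zero_less_mult_iff mult_less_0_iff)

text \<open>With the coefficient of Y' scaled to 1, the relation of a crossing reads Y' = a X + b Y
  - c X' with positive a, b, c. So Y' runs over a cone in which a, b, c are linear coordinates, and
  the triple product is the Jacobian. Only the inclusion of this cone in the set of crossings is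
  needed for a lower bound.\<close>

lemma nn_integral_crosses_ge:
  fixes G :: "real^3 \<Rightarrow> ennreal"
  assumes [measurable]: "G \<in> borel_measurable borel"
  shows "ennreal \<bar>triple X Y X'\<bar> * (\<integral>\<^sup>+a. \<integral>\<^sup>+b. \<integral>\<^sup>+c. (if 0 < a \<and> 0 < b \<and> 0 < c then G (a *\<^sub>R X + b *\<^sub>R Y - c *\<^sub>R X') else 0) \<partial>lborel \<partial>lborel \<partial>lborel)
    \<le> (\<integral>\<^sup>+Y'. (if crosses X Y X' Y' then G Y' else 0) \<partial>lborel)"
proof (cases "triple X Y X' = 0")
  case False
  have "(\<integral>\<^sup>+Y'. (if crosses X Y X' Y' then G Y' else 0) \<partial>lborel) = ennreal \<bar>triple X Y (- X')\<bar> *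
    (\<integral>\<^sup>+a. \<integral>\<^sup>+b. \<integral>\<^sup>+c. (if crosses X Y X' (a *\<^sub>R X + b *\<^sub>R Y + c *\<^sub>R (- X')) then G (a *\<^sub>R X + b *\<^sub>R Y + c *\<^sub>R (- X')) else 0) \<partial>lborel \<partial>lborel \<partial>lborel)"
    using False by (intro nn_integral_real3_frame) (simp_all add: triple_uminus)
  also have "\<dots> \<ge> ennreal \<bar>triple X Y X'\<bar> * (\<integral>\<^sup>+a. \<integral>\<^sup>+b. \<integral>\<^sup>+c. (if 0 < a \<and> 0 < b \<and> 0 < c then G (a *\<^sub>R X + b *\<^sub>R Y - c *\<^sub>R X') else 0) \<partial>lborel \<partial>lborel \<partial>lborel)"
    unfolding triple_uminus abs_minus_cancel
    by (intro mult_left_mono nn_integral_mono) (use crosses_lincomb False in auto)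
  finally show ?thesis .
qed simp

lemma nn_integral_ball_scale':
  fixes G :: "real^3 \<Rightarrow> ennreal"
  assumes [measurable]: "G \<in> borel_measurable borel"
  shows "(\<integral>\<^sup>+x. \<integral>\<^sup>+s. indicator (cball 0 1) x * ((if 0 < s then ennreal (1/s) else 0) * G (s *\<^sub>R x)) \<partial>lborel \<partial>lborel)
       = (\<integral>\<^sup>+x. ennreal (1 / (3 * norm x ^ 3)) * G x \<partial>lborel)"
proof -
  have [measurable]: "Measurable.pred borel (\<lambda>x::real^3. x \<in> cball 0 1)" by simp
  have "(\<integral>\<^sup>+x. \<integral>\<^sup>+s. indicator (cball 0 1) x * ((if 0 < s then ennreal (1/s) else 0) * G (s *\<^sub>R x)) \<partial>lborel \<partial>lborel)
    = (\<integral>\<^sup>+s. \<integral>\<^sup>+x. indicator (cball 0 1) x * ((if 0 < s then ennreal (1/s) else 0) * G (s *\<^sub>R x)) \<partial>lborel \<partial>lborel)"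
    by (rule lborel_pair.Fubini') measurable
  also have "\<dots> = (\<integral>\<^sup>+s. indicator {0<..} s * (\<integral>\<^sup>+x. indicator (cball 0 1) x * (ennreal (1/s) * G (s *\<^sub>R x)) \<partial>lborel) \<partial>lborel)"
    by (intro nn_integral_cong) (auto simp: indicator_def)
  also have "\<dots> = (\<integral>\<^sup>+x. ennreal (1 / (3 * norm x ^ 3)) * G x \<partial>lborel)"
    by (rule nn_integral_ball_scale) measurable
  finally show ?thesis .
qed

text \<open>Three nested uses of \<open>nn_integral_ball_scale'\<close>, with all scale integrals
  moved inside, where they can be read as the coefficients a, b, c of
  \<open>nn_integral_crosses_ge\<close>.\<close>

lemma nn_integral_ball_scale3:
  fixes \<Phi> :: "real^3 \<Rightarrow> real^3 \<Rightarrow> real^3 \<Rightarrow> ennreal"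
  assumes \<Phi>[measurable]: "(\<lambda>p. \<Phi> (fst p) (fst (snd p)) (snd (snd p))) \<in> borel_measurable (borel \<Otimes>\<^sub>M (borel \<Otimes>\<^sub>M borel))"
  shows "(\<integral>\<^sup>+X. \<integral>\<^sup>+Y. \<integral>\<^sup>+Z. \<integral>\<^sup>+a. \<integral>\<^sup>+b. \<integral>\<^sup>+c. indicator (cball 0 1) X * (indicator (cball 0 1) Y * (indicator (cball 0 1) Z *
      ((if 0 < a then ennreal (1/a) else 0) * ((if 0 < b then ennreal (1/b) else 0) * ((if 0 < c then ennreal (1/c) else 0) * \<Phi> (a *\<^sub>R X) (b *\<^sub>R Y) (c *\<^sub>R Z))))))
        \<partial>lborel \<partial>lborel \<partial>lborel \<partial>lborel \<partial>lborel \<partial>lborel)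
    = (\<integral>\<^sup>+X. \<integral>\<^sup>+Y. \<integral>\<^sup>+Z. ennreal (1 / (3 * norm X ^ 3)) * (ennreal (1 / (3 * norm Y ^ 3)) * (ennreal (1 / (3 * norm Z ^ 3)) * \<Phi> X Y Z)) \<partial>lborel \<partial>lborel \<partial>lborel)"
proof -
  have Pm[measurable (raw)]: "(\<lambda>x. \<Phi> (f x) (g x) (h x)) \<in> borel_measurable M"
    if [measurable]: "f \<in> borel_measurable M" "g \<in> borel_measurable M" "h \<in> borel_measurable M" for f g h and M :: "'z measure"
    using measurable_compose[of "\<lambda>x. (f x, g x, h x)" M _ _ borel, OF _ \<Phi>] by simp
  define B :: "real^3 \<Rightarrow> ennreal" where "B = indicator (cball 0 1)"
  define i where "i a = (if 0 < a then ennreal (1/a) else 0)" for a :: real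
  have [measurable]: "B \<in> borel_measurable borel"
    unfolding B_def by (intro borel_measurable_indicator) simp
  have [measurable]: "i \<in> borel_measurable borel"
    unfolding i_def by measurable
  define n where "n X = ennreal (1 / (3 * norm X ^ 3))" for X :: "real^3"
  have [measurable]: "n \<in> borel_measurable borel" unfolding n_def by measurable
  have sc: "(\<integral>\<^sup>+x. \<integral>\<^sup>+s. B x * (i s * G (s *\<^sub>R x)) \<partial>lborel \<partial>lborel) = (\<integral>\<^sup>+x. n x * G x \<partial>lborel)"
    if "G \<in> borel_measurable borel" for G
    using nn_integral_ball_scale'[OF that] unfolding B_def i_def n_def .
  define J where "J X Y = (\<integral>\<^sup>+Z. n Z * \<Phi> X Y Z \<partial>lborel)" for X Y
  have [measurable (raw)]: "(\<lambda>x. J (f x) (g x)) \<in> borel_measurable M"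
    if [measurable]: "f \<in> borel_measurable M" "g \<in> borel_measurable M" for f g and M :: "'y measure"
    unfolding J_def by measurable
  have J: "(\<integral>\<^sup>+Z. \<integral>\<^sup>+c. B Z * (i c * \<Phi> X Y (c *\<^sub>R Z)) \<partial>lborel \<partial>lborel) = J X Y" for X Y
    unfolding J_def by (rule sc) measurable
  define L where "L X = (\<integral>\<^sup>+Y. n Y * J X Y \<partial>lborel)" for X
  have [measurable]: "L \<in> borel_measurable borel"
    unfolding L_def by measurable
  have L: "(\<integral>\<^sup>+Y. \<integral>\<^sup>+b. B Y * (i b * J X (b *\<^sub>R Y)) \<partial>lborel \<partial>lborel) = L X" for X
    unfolding L_def by (rule sc) measurable
  have inner: "(\<integral>\<^sup>+Z. \<integral>\<^sup>+a. \<integral>\<^sup>+b. \<integral>\<^sup>+c. B X * (B Y * (B Z * (i a * (i b * (i c * \<Phi> (a *\<^sub>R X) (b *\<^sub>R Y) (c *\<^sub>R Z)))))) \<partial>lborel \<partial>lborel \<partial>lborel \<partial>lborel)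
     = (\<integral>\<^sup>+a. \<integral>\<^sup>+b. B X * (B Y * (i a * (i b * J (a *\<^sub>R X) (b *\<^sub>R Y)))) \<partial>lborel \<partial>lborel)" for X Y
  proof -
    have "(\<integral>\<^sup>+Z. \<integral>\<^sup>+a. \<integral>\<^sup>+b. \<integral>\<^sup>+c. B X * (B Y * (B Z * (i a * (i b * (i c * \<Phi> (a *\<^sub>R X) (b *\<^sub>R Y) (c *\<^sub>R Z)))))) \<partial>lborel \<partial>lborel \<partial>lborel \<partial>lborel)
      = (\<integral>\<^sup>+a. \<integral>\<^sup>+Z. \<integral>\<^sup>+b. \<integral>\<^sup>+c. B X * (B Y * (B Z * (i a * (i b * (i c * \<Phi> (a *\<^sub>R X) (b *\<^sub>R Y) (c *\<^sub>R Z)))))) \<partial>lborel \<partial>lborel \<partial>lborel \<partial>lborel)"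
      by (rule lborel_pair.Fubini') measurable
    also have "\<dots> = (\<integral>\<^sup>+a. \<integral>\<^sup>+b. \<integral>\<^sup>+Z. \<integral>\<^sup>+c. B X * (B Y * (B Z * (i a * (i b * (i c * \<Phi> (a *\<^sub>R X) (b *\<^sub>R Y) (c *\<^sub>R Z)))))) \<partial>lborel \<partial>lborel \<partial>lborel \<partial>lborel)"
      by (rule nn_integral_cong, rule lborel_pair.Fubini') measurable
    also have "\<dots> = (\<integral>\<^sup>+a. \<integral>\<^sup>+b. \<integral>\<^sup>+Z. \<integral>\<^sup>+c. (B X * (B Y * (i a * i b))) * (B Z * (i c * \<Phi> (a *\<^sub>R X) (b *\<^sub>R Y) (c *\<^sub>R Z))) \<partial>lborel \<partial>lborel \<partial>lborel \<partial>lborel)"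
      by (simp only: mult_ac)
    also have "\<dots> = (\<integral>\<^sup>+a. \<integral>\<^sup>+b. (B X * (B Y * (i a * i b))) * (\<integral>\<^sup>+Z. \<integral>\<^sup>+c. B Z * (i c * \<Phi> (a *\<^sub>R X) (b *\<^sub>R Y) (c *\<^sub>R Z)) \<partial>lborel \<partial>lborel) \<partial>lborel \<partial>lborel)"
      by (simp add: nn_integral_cmult)
    finally show ?thesis by (simp only: J mult.assoc)
  qed
  have inner2: "(\<integral>\<^sup>+Y. \<integral>\<^sup>+a. \<integral>\<^sup>+b. B X * (B Y * (i a * (i b * J (a *\<^sub>R X) (b *\<^sub>R Y)))) \<partial>lborel \<partial>lborel \<partial>lborel)
     = (\<integral>\<^sup>+a. B X * (i a * L (a *\<^sub>R X)) \<partial>lborel)" for X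
  proof -
    have "(\<integral>\<^sup>+Y. \<integral>\<^sup>+a. \<integral>\<^sup>+b. B X * (B Y * (i a * (i b * J (a *\<^sub>R X) (b *\<^sub>R Y)))) \<partial>lborel \<partial>lborel \<partial>lborel)
      = (\<integral>\<^sup>+a. \<integral>\<^sup>+Y. \<integral>\<^sup>+b. B X * (B Y * (i a * (i b * J (a *\<^sub>R X) (b *\<^sub>R Y)))) \<partial>lborel \<partial>lborel \<partial>lborel)"
      by (rule lborel_pair.Fubini') measurable
    also have "\<dots> = (\<integral>\<^sup>+a. \<integral>\<^sup>+Y. \<integral>\<^sup>+b. (B X * i a) * (B Y * (i b * J (a *\<^sub>R X) (b *\<^sub>R Y))) \<partial>lborel \<partial>lborel \<partial>lborel)"
      by (simp only: mult_ac)
    also have "\<dots> = (\<integral>\<^sup>+a. (B X * i a) * (\<integral>\<^sup>+Y. \<integral>\<^sup>+b. B Y * (i b * J (a *\<^sub>R X) (b *\<^sub>R Y)) \<partial>lborel \<partial>lborel) \<partial>lborel)"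
      by (simp add: nn_integral_cmult)
    finally show ?thesis by (simp only: L mult.assoc)
  qed
  have "(\<integral>\<^sup>+X. \<integral>\<^sup>+Y. \<integral>\<^sup>+Z. \<integral>\<^sup>+a. \<integral>\<^sup>+b. \<integral>\<^sup>+c. B X * (B Y * (B Z * (i a * (i b * (i c * \<Phi> (a *\<^sub>R X) (b *\<^sub>R Y) (c *\<^sub>R Z)))))) \<partial>lborel \<partial>lborel \<partial>lborel \<partial>lborel \<partial>lborel \<partial>lborel)
    = (\<integral>\<^sup>+X. \<integral>\<^sup>+a. B X * (i a * L (a *\<^sub>R X)) \<partial>lborel \<partial>lborel)"
    by (simp only: inner inner2)
  also have "\<dots> = (\<integral>\<^sup>+X. n X * L X \<partial>lborel)"
    by (rule sc) measurable
  also have "\<dots> = (\<integral>\<^sup>+X. \<integral>\<^sup>+Y. \<integral>\<^sup>+Z. n X * (n Y * (n Z * \<Phi> X Y Z)) \<partial>lborel \<partial>lborel \<partial>lborel)"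
    unfolding L_def J_def by (simp add: nn_integral_cmult)
  finally show ?thesis unfolding B_def i_def n_def .
qed

section \<open>Arcs through a given point of space\<close>

lemma nn_integral_lborel_shift:
  fixes G :: "'a::euclidean_space \<Rightarrow> ennreal"
  assumes [measurable]: "G \<in> borel_measurable borel"
  shows "(\<integral>\<^sup>+Y. G Y \<partial>lborel) = (\<integral>\<^sup>+Q. G (Q - X) \<partial>lborel)"
proof -
  have "(\<integral>\<^sup>+Y. G Y \<partial>lborel) = (\<integral>\<^sup>+Y. G Y \<partial>distr lborel borel ((+) (- X)))"
    by (simp only: lborel_distr_plus)
  also have "\<dots> = (\<integral>\<^sup>+Q. G (Q - X) \<partial>lborel)"
    by (subst nn_integral_distr) simp_all
  finally show ?thesis .
qed

text \<open>The frame has the length of Q instead of 1, so that Q itself is the third axis and Q - X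
  has the coordinates (- x, - y, 1 - k) required by \<open>arc_weight\<close>.\<close>

lemma orthogonal_frame:
  fixes Q :: "real^3"
  assumes "Q \<noteq> 0"
  obtains U V where "norm U = norm Q" "norm V = norm Q" "U \<bullet> V = 0" "U \<bullet> Q = 0" "V \<bullet> Q = 0"
    "triple U V Q = norm Q ^ 3"
proof -
  obtain a :: "real^3" where a: "a \<noteq> 0" "orthogonal Q a"
    using orthogonal_to_vector_exists[of Q] by auto
  define r where "r = norm Q"
  have r: "r > 0" using assms by (simp add: r_def)
  define U where "U = (r / norm a) *\<^sub>R a"
  define V where "V = (1 / r) *\<^sub>R cross3 Q U"
  have U: "norm U = r" using a r by (simp add: U_def)
  have UQ: "U \<bullet> Q = 0" using a by (simp add: U_def orthogonal_def inner_commute)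
  have c: "cross3 Q U \<bullet> U = 0" "cross3 Q U \<bullet> Q = 0"
    by (metis dot_cross_self(1,2) inner_commute)+
  have n: "norm (cross3 Q U) = r * r"
  proof -
    have "(norm (cross3 Q U))\<^sup>2 = (r * r)\<^sup>2"
      using norm_cross_dot[of Q U] UQ U by (simp add: inner_commute r_def)
    then show ?thesis using r by (simp add: power2_eq_iff_nonneg)
  qed
  have V: "norm V = r" using n r by (simp add: V_def)
  have VV: "V \<bullet> V = r\<^sup>2" using V by (simp add: dot_square_norm)
  have "triple U V Q = triple V Q U" by (rule triple_cyclic)
  also have "\<dots> = V \<bullet> (r *\<^sub>R V)" using r by (simp add: triple_def V_def)
  also have "\<dots> = r ^ 3" using VV by (simp add: power2_eq_square power3_eq_cube)
  finally have "triple U V Q = norm Q ^ 3" by (simp add: r_def)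
  moreover have "U \<bullet> V = 0" "V \<bullet> Q = 0"
    using c by (simp_all add: V_def inner_commute)
  ultimately show ?thesis using that[of U V] U V UQ by (simp add: r_def)
qed

definition vec_angle :: "real^3 \<Rightarrow> real^3 \<Rightarrow> real" where
  "vec_angle X Y = arccos (X \<bullet> Y / (norm X * norm Y))"

lemma vec_angle_measurable[measurable (raw)]:
  assumes [measurable]: "f \<in> borel_measurable M" "g \<in> borel_measurable M"
  shows "(\<lambda>x. vec_angle (f x) (g x)) \<in> borel_measurable M"
  unfolding vec_angle_def by measurable

lemma vec_angle_scaleR:
  assumes "a > 0" "b > 0"
  shows "vec_angle (a *\<^sub>R X) (b *\<^sub>R Y) = vec_angle X Y"
  using assms by (simp add: vec_angle_def)

text \<open>Completing the square with Lagrange's identity gives the antiderivative arctan ((s |X|^2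
  + X . Y) / c), where c is the norm of the cross product. It tends to pi / 2, and its value at 0 is
  pi / 2 minus the angle. Linear independence of X and Y makes c positive and the angle
  nonzero.\<close>

lemma nn_integral_arc_angle:
  assumes c: "cross3 X Y \<noteq> 0"
  shows "vec_angle X Y > 0"
    and "(\<integral>\<^sup>+s. (if 0 < s then ennreal (norm (cross3 X Y) / (norm (s *\<^sub>R X + Y))\<^sup>2) else 0) \<partial>lborel) = ennreal (vec_angle X Y)"
proof -
  define c where "c = norm (cross3 X Y)"
  define A where "A = norm X"
  define B where "B = norm Y"
  define d where "d = X \<bullet> Y"
  have c0: "c > 0" using assms by (simp add: c_def)
  have XY: "X \<noteq> 0" "Y \<noteq> 0" using assms by auto
  have A0: "A > 0" and B0: "B > 0" using XY by (auto simp: A_def B_def)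
  have id: "c\<^sup>2 + d\<^sup>2 = (A * B)\<^sup>2" unfolding c_def d_def A_def B_def by (rule norm_cross_dot)
  have n2: "(norm (s *\<^sub>R X + Y))\<^sup>2 = s\<^sup>2 * A\<^sup>2 + 2 * s * d + B\<^sup>2" for s
    unfolding A_def B_def d_def power2_norm_eq_inner
    by (simp add: inner_add_left inner_add_right inner_commute power2_eq_square algebra_simps)
  have key: "A\<^sup>2 * (s\<^sup>2 * A\<^sup>2 + 2 * s * d + B\<^sup>2) = c\<^sup>2 + (s * A\<^sup>2 + d)\<^sup>2" for s
  proof -
    have "c\<^sup>2 = A\<^sup>2 * B\<^sup>2 - d\<^sup>2" using id by (simp add: power_mult_distrib)
    then show ?thesis by (simp add: power2_eq_square algebra_simps)
  qed
  have der: "((\<lambda>s. arctan ((s * A\<^sup>2 + d) / c)) has_real_derivative c / (norm (s *\<^sub>R X + Y))\<^sup>2) (at s)" for s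
  proof -
    have "((\<lambda>s. arctan ((s * A\<^sup>2 + d) / c)) has_real_derivative inverse (1 + ((s * A\<^sup>2 + d) / c)\<^sup>2) * (A\<^sup>2 / c)) (at s)"
      using c0 by (intro DERIV_chain2[OF DERIV_arctan]) (auto intro!: derivative_eq_intros)
    moreover have "inverse (1 + ((s * A\<^sup>2 + d) / c)\<^sup>2) * (A\<^sup>2 / c) = c / (norm (s *\<^sub>R X + Y))\<^sup>2"
    proof -
      have "1 + (z / c)\<^sup>2 = (c\<^sup>2 + z\<^sup>2) / c\<^sup>2" for z
        using c0 by (simp add: power_divide add_divide_distrib)
      then have "1 + ((s * A\<^sup>2 + d) / c)\<^sup>2 = (c\<^sup>2 + (s * A\<^sup>2 + d)\<^sup>2) / c\<^sup>2" .
      also have "\<dots> = A\<^sup>2 * (norm (s *\<^sub>R X + Y))\<^sup>2 / c\<^sup>2" by (simp only: key n2)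
      finally have e: "1 + ((s * A\<^sup>2 + d) / c)\<^sup>2 = A\<^sup>2 * (norm (s *\<^sub>R X + Y))\<^sup>2 / c\<^sup>2" .
      show ?thesis unfolding e using c0 A0 by (simp add: field_simps power2_eq_square)
    qed
    ultimately show ?thesis by simp
  qed
  have lim: "((\<lambda>s. arctan ((s * A\<^sup>2 + d) / c)) \<longlongrightarrow> pi / 2) at_top"
  proof (rule filterlim_compose[OF tendsto_arctan_at_top])
    have "filterlim (\<lambda>s. d / c + (A\<^sup>2 / c) * s) at_top at_top"
      by (intro filterlim_tendsto_add_at_top[OF tendsto_const] filterlim_tendsto_pos_mult_at_top[OF tendsto_const _ filterlim_ident])
        (use A0 c0 in auto)
    then show "filterlim (\<lambda>s. (s * A\<^sup>2 + d) / c) at_top at_top"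
      by (simp add: add_divide_distrib mult.commute add.commute)
  qed
  have "(\<integral>\<^sup>+s. (if 0 < s then ennreal (c / (norm (s *\<^sub>R X + Y))\<^sup>2) else 0) \<partial>lborel)
    = (\<integral>\<^sup>+s. ennreal (c / (norm (s *\<^sub>R X + Y))\<^sup>2) * indicator {0..} s \<partial>lborel)"
    by (rule nn_integral_cong_AE, rule eventually_mono[OF AE_lborel_singleton[of 0]]) (auto simp: indicator_def)
  also have "\<dots> = ennreal (pi / 2 - arctan ((0 * A\<^sup>2 + d) / c))"
    by (rule nn_integral_FTC_atLeast[OF _ der _ lim]) (use c0 in auto)
  finally have int: "(\<integral>\<^sup>+s. (if 0 < s then ennreal (c / (norm (s *\<^sub>R X + Y))\<^sup>2) else 0) \<partial>lborel) = ennreal (pi / 2 - arctan (d / c))"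
    by simp
  have "d\<^sup>2 < (A * B)\<^sup>2" using id c0 by (smt (verit) zero_less_power)
  then have "\<bar>d\<bar> < A * B" using A0 B0 by (intro power2_less_imp_less[of "\<bar>d\<bar>" "A * B"]) simp_all
  then have dAB: "-1 < d / (A * B)" "d / (A * B) < 1" using A0 B0 by (auto simp: field_simps abs_less_iff)
  define s where "s = arccos (d / (A * B))"
  have s: "0 < s" "s < pi" unfolding s_def using arccos_lt_bounded[OF dAB] by auto
  have cs: "cos s = d / (A * B)" unfolding s_def using dAB by (intro cos_arccos) auto
  have "(sin s)\<^sup>2 = (c / (A * B))\<^sup>2"
  proof -
    have "(sin s)\<^sup>2 = 1 - (d / (A * B))\<^sup>2" unfolding cs[symmetric] by (simp add: sin_squared_eq)
    also have "\<dots> = ((A * B)\<^sup>2 - d\<^sup>2) / (A * B)\<^sup>2" using A0 B0 by (simp add: power_divide diff_divide_distrib)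
    also have "(A * B)\<^sup>2 - d\<^sup>2 = c\<^sup>2" using id by simp
    finally show ?thesis by (simp add: power_divide)
  qed
  moreover have "sin s > 0" using s by (rule sin_gt_zero)
  ultimately have sn: "sin s = c / (A * B)" using A0 B0 c0 by (simp add: power2_eq_iff_nonneg)
  have "tan (pi / 2 - s) = d / c"
    using A0 B0 by (simp add: tan_def sin_diff cos_diff cs sn)
  then have "arctan (d / c) = pi / 2 - s"
    using arctan_tan[of "pi / 2 - s"] s by simp
  then have fin: "pi / 2 - arctan (d / c) = s" by simp
  have va: "vec_angle X Y = s" by (simp add: vec_angle_def s_def A_def B_def d_def)
  show "(\<integral>\<^sup>+s. (if 0 < s then ennreal (norm (cross3 X Y) / (norm (s *\<^sub>R X + Y))\<^sup>2) else 0) \<partial>lborel) = ennreal (vec_angle X Y)"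
    unfolding va c_def[symmetric] using int unfolding fin .
  show "vec_angle X Y > 0" using va s by simp
qed

text \<open>The vectors parallel to X lie in a plane through X, namely the orthogonal complement of
  some a orthogonal to X, and planes are negligible.\<close>

lemma AE_cross3_nonzero:
  assumes "X \<noteq> (0 :: real^3)"
  shows "AE Y in lborel. cross3 X Y \<noteq> 0"
proof -
  obtain a :: "real^3" where a: "a \<noteq> 0" "orthogonal X a"
    using orthogonal_to_vector_exists[of X] by auto
  have "{Y. a \<bullet> Y = 0} \<in> null_sets lborel"
  proof -
    have "negligible {Y. a \<bullet> Y = 0}" using a by (intro negligible_hyperplane) auto
    moreover have "{Y. a \<bullet> Y = 0} \<in> sets borel" by measurable
    ultimately show ?thesis by (simp add: negligible_iff_null_sets null_sets_completion_iff)
  qed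
  then have "AE Y in lborel. Y \<notin> {Y. a \<bullet> Y = 0}" by (rule AE_not_in)
  then show ?thesis
  proof (rule eventually_mono)
    fix Y assume Y: "Y \<notin> {Y. a \<bullet> Y = 0}"
    show "cross3 X Y \<noteq> 0"
    proof
      assume "cross3 X Y = 0"
      then have "collinear {0, X, Y}" by (simp add: cross_eq_0)
      then have "Y = 0 \<or> (\<exists>c. Y = c *\<^sub>R X)" using assms by (auto simp: collinear_lemma)
      then have "a \<bullet> Y = 0" using a by (auto simp: orthogonal_def inner_commute)
      with Y show False by simp
    qed
  qed
qed

text \<open>An arc through the direction of Q is recorded by vectors along its ends that add up to
  Q, so that one vector X describes it. The cubes of the norms are the densities that
  \<open>nn_integral_ball_scale\<close> leaves when an end that ranged over the unit ball becomes a
  free vector; the factors 3 are kept apart.\<close>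

definition arc_kernel :: "((real^3) \<times> (real^3) \<Rightarrow> real) \<Rightarrow> real^3 \<Rightarrow> real^3 \<Rightarrow> real" where
  "arc_kernel W Q X = W (X, Q - X) / (norm X ^ 3 * norm (Q - X) ^ 3)"

lemma arc_kernel_measurable[measurable (raw)]:
  assumes [measurable]: "W \<in> borel_measurable (borel \<Otimes>\<^sub>M borel)" "f \<in> borel_measurable M" "g \<in> borel_measurable M"
  shows "(\<lambda>x. arc_kernel W (f x) (g x)) \<in> borel_measurable M"
  unfolding arc_kernel_def by measurable

text \<open>Substitute \<open>Y' = a X + b Y - c X'\<close>, absorb \<open>a\<close>, \<open>b\<close>, \<open>c\<close> into the vectors
  (each absorption costs a factor 3), and pass from \<open>Y'\<close> to \<open>Q = X + Y\<close> by homogeneity.\<close>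

lemma crossing_integral_ge:
  fixes W :: "(real^3) \<times> (real^3) \<Rightarrow> real"
  assumes [measurable]: "W \<in> borel_measurable (borel \<Otimes>\<^sub>M borel)"
    and W0: "\<And>p. 0 \<le> W p"
    and scale: "\<And>a b X Y. a > 0 \<Longrightarrow> b > 0 \<Longrightarrow> W (a *\<^sub>R X, b *\<^sub>R Y) = W (X, Y)"
  defines "B \<equiv> indicator (cball 0 1) :: real^3 \<Rightarrow> ennreal"
  shows "(\<integral>\<^sup>+Q. B Q * (ennreal (norm Q ^ 3) * (\<integral>\<^sup>+X. \<integral>\<^sup>+Z. ennreal (\<bar>triple X Q Z\<bar> / 27 * (arc_kernel W Q X * arc_kernel W Q Z)) \<partial>lborel \<partial>lborel)) \<partial>lborel)
    \<le> (\<integral>\<^sup>+X. \<integral>\<^sup>+Y. \<integral>\<^sup>+X'. \<integral>\<^sup>+Y'. B X * (B Y * (B X' * (B Y' * (if crosses X Y X' Y' then ennreal (W (X, Y) * W (X', Y')) else 0))))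
        \<partial>lborel \<partial>lborel \<partial>lborel \<partial>lborel)"
proof -
  have [measurable]: "B \<in> borel_measurable borel"
    unfolding B_def by (intro borel_measurable_indicator) simp
  define i where "i a = (if 0 < a then ennreal (1/a) else 0)" for a :: real
  define \<Phi> where "\<Phi> X Y Z = ennreal \<bar>triple X Y Z\<bar> * (B (X + Y - Z) * ennreal (W (X, Y) * W (Z, X + Y - Z)))" for X Y Z
  have [measurable (raw)]: "(\<lambda>x. \<Phi> (f x) (g x) (h x)) \<in> borel_measurable M"
    if [measurable]: "f \<in> borel_measurable M" "g \<in> borel_measurable M" "h \<in> borel_measurable M" for f g h and M :: "'z measure"
    unfolding \<Phi>_def by measurable
  have \<Phi>m: "(\<lambda>p. \<Phi> (fst p) (fst (snd p)) (snd (snd p))) \<in> borel_measurable (borel \<Otimes>\<^sub>M (borel \<Otimes>\<^sub>M borel))"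
    by measurable
  define n where "n X = ennreal (1 / (3 * norm X ^ 3))" for X :: "real^3"
  have [measurable]: "n \<in> borel_measurable borel" unfolding n_def by measurable
  define H where "H p = (case p of (Q, X, Z) \<Rightarrow> ennreal (\<bar>triple X Q Z\<bar> / 27 * (arc_kernel W Q X * arc_kernel W Q Z)))" for p
  have Hm: "H \<in> borel_measurable borel"
  proof -
    have "(\<lambda>p. H p) \<in> borel_measurable (borel \<Otimes>\<^sub>M (borel \<Otimes>\<^sub>M borel))"
      unfolding H_def case_prod_beta by measurable
    then show ?thesis by (simp add: borel_prod)
  qed
  have W1: "W (a *\<^sub>R X, Y) = W (X, Y)" if "a > 0" for a X Y
    using scale[OF that zero_less_one, of X Y] by simp
  \<comment> \<open>The triple product has degree 1 in each argument, so the factor a b c extracted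
    from it cancels the weights 1 / a, 1 / b and 1 / c, while W does not change under positive
    scaling.\<close>
  have point: "i a * (i b * (i c * \<Phi> (a *\<^sub>R X) (b *\<^sub>R Y) (c *\<^sub>R Z))) =
    ennreal \<bar>triple X Y Z\<bar> * (if 0 < a \<and> 0 < b \<and> 0 < c then B (a *\<^sub>R X + b *\<^sub>R Y - c *\<^sub>R Z) * ennreal (W (X, Y) * W (Z, a *\<^sub>R X + b *\<^sub>R Y - c *\<^sub>R Z)) else 0)"
    for a b c X Y Z
  proof (cases "0 < a \<and> 0 < b \<and> 0 < c")
    case True
    then have pos: "0 < a" "0 < b" "0 < c" by auto
    have "ennreal (1/a) * (ennreal (1/b) * (ennreal (1/c) * ennreal \<bar>a * b * c * triple X Y Z\<bar>)) = ennreal \<bar>triple X Y Z\<bar>"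
      using pos by (simp add: ennreal_mult[symmetric] abs_mult)
    then have "ennreal (1/a) * (ennreal (1/b) * (ennreal (1/c) * (ennreal \<bar>a * b * c * triple X Y Z\<bar> * R))) = ennreal \<bar>triple X Y Z\<bar> * R" for R
      by (metis mult.assoc)
    then show ?thesis
      using True by (simp add: i_def \<Phi>_def triple_scaleR scale[OF pos(1,2)] W1[OF pos(3)])
  qed (auto simp: i_def)
  have "(\<integral>\<^sup>+X. \<integral>\<^sup>+Y. \<integral>\<^sup>+Z. n X * (n Y * (n Z * \<Phi> X Y Z)) \<partial>lborel \<partial>lborel \<partial>lborel)
    = (\<integral>\<^sup>+X. \<integral>\<^sup>+Y. \<integral>\<^sup>+Z. \<integral>\<^sup>+a. \<integral>\<^sup>+b. \<integral>\<^sup>+c. B X * (B Y * (B Z *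
      (i a * (i b * (i c * \<Phi> (a *\<^sub>R X) (b *\<^sub>R Y) (c *\<^sub>R Z)))))) \<partial>lborel \<partial>lborel \<partial>lborel \<partial>lborel \<partial>lborel \<partial>lborel)"
    using nn_integral_ball_scale3[OF \<Phi>m] unfolding B_def i_def n_def by (rule sym)
  also have "\<dots> \<le> (\<integral>\<^sup>+X. \<integral>\<^sup>+Y. \<integral>\<^sup>+X'. \<integral>\<^sup>+Y'. B X * (B Y * (B X' * (B Y' * (if crosses X Y X' Y' then ennreal (W (X, Y) * W (X', Y')) else 0))))
        \<partial>lborel \<partial>lborel \<partial>lborel \<partial>lborel)"
  proof (intro nn_integral_mono)
    fix X Y Z :: "real^3"
    have "(\<integral>\<^sup>+a. \<integral>\<^sup>+b. \<integral>\<^sup>+c. B X * (B Y * (B Z * (i a * (i b * (i c * \<Phi> (a *\<^sub>R X) (b *\<^sub>R Y) (c *\<^sub>R Z)))))) \<partial>lborel \<partial>lborel \<partial>lborel)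
      = (\<integral>\<^sup>+a. \<integral>\<^sup>+b. \<integral>\<^sup>+c. (B X * (B Y * (B Z * ennreal \<bar>triple X Y Z\<bar>))) *
         (if 0 < a \<and> 0 < b \<and> 0 < c then B (a *\<^sub>R X + b *\<^sub>R Y - c *\<^sub>R Z) * ennreal (W (X, Y) * W (Z, a *\<^sub>R X + b *\<^sub>R Y - c *\<^sub>R Z)) else 0) \<partial>lborel \<partial>lborel \<partial>lborel)"
      by (simp only: point mult.assoc)
    also have "\<dots> = (B X * (B Y * (B Z * ennreal \<bar>triple X Y Z\<bar>))) * (\<integral>\<^sup>+a. \<integral>\<^sup>+b. \<integral>\<^sup>+c.
         (if 0 < a \<and> 0 < b \<and> 0 < c then B (a *\<^sub>R X + b *\<^sub>R Y - c *\<^sub>R Z) * ennreal (W (X, Y) * W (Z, a *\<^sub>R X + b *\<^sub>R Y - c *\<^sub>R Z)) else 0) \<partial>lborel \<partial>lborel \<partial>lborel)"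
      by (simp add: nn_integral_cmult)
    also have "\<dots> = B X * (B Y * (B Z * (ennreal \<bar>triple X Y Z\<bar> * (\<integral>\<^sup>+a. \<integral>\<^sup>+b. \<integral>\<^sup>+c.
         (if 0 < a \<and> 0 < b \<and> 0 < c then B (a *\<^sub>R X + b *\<^sub>R Y - c *\<^sub>R Z) * ennreal (W (X, Y) * W (Z, a *\<^sub>R X + b *\<^sub>R Y - c *\<^sub>R Z)) else 0) \<partial>lborel \<partial>lborel \<partial>lborel))))"
      by (simp only: mult.assoc)
    also have "\<dots> \<le> B X * (B Y * (B Z * (\<integral>\<^sup>+Y'. (if crosses X Y Z Y' then B Y' * ennreal (W (X, Y) * W (Z, Y')) else 0) \<partial>lborel)))"
      by (intro mult_left_mono nn_integral_crosses_ge) simp_all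
    also have "\<dots> = (\<integral>\<^sup>+Y'. B X * (B Y * (B Z * (if crosses X Y Z Y' then B Y' * ennreal (W (X, Y) * W (Z, Y')) else 0))) \<partial>lborel)"
      by (simp add: nn_integral_cmult)
    also have "\<dots> = (\<integral>\<^sup>+Y'. B X * (B Y * (B Z * (B Y' * (if crosses X Y Z Y' then ennreal (W (X, Y) * W (Z, Y')) else 0)))) \<partial>lborel)"
      by (intro nn_integral_cong) simp
    finally show "(\<integral>\<^sup>+a. \<integral>\<^sup>+b. \<integral>\<^sup>+c. B X * (B Y * (B Z * (i a * (i b * (i c * \<Phi> (a *\<^sub>R X) (b *\<^sub>R Y) (c *\<^sub>R Z)))))) \<partial>lborel \<partial>lborel \<partial>lborel)
      \<le> (\<integral>\<^sup>+Y'. B X * (B Y * (B Z * (B Y' * (if crosses X Y Z Y' then ennreal (W (X, Y) * W (Z, Y')) else 0)))) \<partial>lborel)" .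
  qed
  finally have 1: "(\<integral>\<^sup>+X. \<integral>\<^sup>+Y. \<integral>\<^sup>+Z. n X * (n Y * (n Z * \<Phi> X Y Z)) \<partial>lborel \<partial>lborel \<partial>lborel) \<le>
    (\<integral>\<^sup>+X. \<integral>\<^sup>+Y. \<integral>\<^sup>+X'. \<integral>\<^sup>+Y'. B X * (B Y * (B X' * (B Y' * (if crosses X Y X' Y' then ennreal (W (X, Y) * W (X', Y')) else 0))))
        \<partial>lborel \<partial>lborel \<partial>lborel \<partial>lborel)" .
  have 2: "(\<integral>\<^sup>+X. \<integral>\<^sup>+Y. \<integral>\<^sup>+Z. n X * (n Y * (n Z * \<Phi> X Y Z)) \<partial>lborel \<partial>lborel \<partial>lborel)
    = (\<integral>\<^sup>+Q. \<integral>\<^sup>+X. \<integral>\<^sup>+Z. n X * (n (Q - X) * (n Z * \<Phi> X (Q - X) Z)) \<partial>lborel \<partial>lborel \<partial>lborel)"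
  proof -
    have "(\<integral>\<^sup>+X. \<integral>\<^sup>+Y. \<integral>\<^sup>+Z. n X * (n Y * (n Z * \<Phi> X Y Z)) \<partial>lborel \<partial>lborel \<partial>lborel)
      = (\<integral>\<^sup>+X. \<integral>\<^sup>+Q. \<integral>\<^sup>+Z. n X * (n (Q - X) * (n Z * \<Phi> X (Q - X) Z)) \<partial>lborel \<partial>lborel \<partial>lborel)"
      by (rule nn_integral_cong, rule nn_integral_lborel_shift) measurable
    also have "\<dots> = (\<integral>\<^sup>+Q. \<integral>\<^sup>+X. \<integral>\<^sup>+Z. n X * (n (Q - X) * (n Z * \<Phi> X (Q - X) Z)) \<partial>lborel \<partial>lborel \<partial>lborel)"
      by (rule lborel_pair.Fubini') measurable
    finally show ?thesis .
  qed
  have pt: "H (Q, X, Z) * (ennreal (norm (Q - Z) ^ 3) * (if norm (Q - Z) \<le> 1 then 1 else 0)) \<le> n X * (n (Q - X) * (n Z * \<Phi> X (Q - X) Z))" for Q X Z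
  proof (cases "Q - Z = 0")
    case False
    then have z: "norm (Q - Z) > 0" by simp
    define T x y z q u v where "T = \<bar>triple X Q Z\<bar>" and "x = norm X" and "y = norm (Q - X)" and "z = norm Z" and "q = norm (Q - Z)"
      and "u = W (X, Q - X)" and "v = W (Z, Q - Z)"
    have nn: "0 \<le> T" "0 \<le> x" "0 \<le> y" "0 \<le> z" "0 < q" "0 \<le> u" "0 \<le> v"
      using False W0 by (auto simp: T_def x_def y_def z_def q_def u_def v_def)
    have e: "T / 27 * (u / (x ^ 3 * y ^ 3) * (v / (z ^ 3 * q ^ 3))) * q ^ 3 = 1 / (3 * x ^ 3) * (1 / (3 * y ^ 3) * (1 / (3 * z ^ 3) * (T * (u * v))))"
      using nn(5) by simp
    have B: "B (Q - Z) = (if norm (Q - Z) \<le> 1 then 1 else 0)" by (simp add: B_def indicator_def)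
    have "H (Q, X, Z) * (ennreal (norm (Q - Z) ^ 3) * (if norm (Q - Z) \<le> 1 then 1 else 0))
       = ennreal (T / 27 * (u / (x ^ 3 * y ^ 3) * (v / (z ^ 3 * q ^ 3))) * q ^ 3) * (if norm (Q - Z) \<le> 1 then 1 else 0)"
      unfolding H_def arc_kernel_def prod.case T_def[symmetric] x_def[symmetric] y_def[symmetric] z_def[symmetric] q_def[symmetric] u_def[symmetric] v_def[symmetric]
      using nn by (subst (2) ennreal_mult) (auto simp: mult.assoc)
    also have "\<dots> = n X * (n (Q - X) * (n Z * (ennreal T * ((if norm (Q - Z) \<le> 1 then 1 else 0) * ennreal (u * v)))))"
    proof -
      have "ennreal (1 / (3 * x ^ 3) * (1 / (3 * y ^ 3) * (1 / (3 * z ^ 3) * (T * (u * v)))))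
        = ennreal (1 / (3 * x ^ 3)) * (ennreal (1 / (3 * y ^ 3)) * (ennreal (1 / (3 * z ^ 3)) * (ennreal T * ennreal (u * v))))"
        using nn by (subst ennreal_mult, simp, simp)+ simp
      then show ?thesis unfolding e n_def x_def[symmetric] y_def[symmetric] z_def[symmetric]
        by (simp only: mult_ac)
    qed
    also have "\<dots> = n X * (n (Q - X) * (n Z * \<Phi> X (Q - X) Z))"
      unfolding \<Phi>_def triple_diff T_def u_def v_def by (simp add: B)
    finally show ?thesis by simp
  qed simp
  \<comment> \<open>The cutoff on the fourth end Q - Z is exchanged for a cutoff on Q. This is
    possible because H has degree 3 - 6 - 6 = -9 on a space of dimension 9.\<close>
  have 3: "(\<integral>\<^sup>+p. H p * (ennreal (norm (fst p - snd (snd p)) ^ 3) * (if norm (fst p - snd (snd p)) \<le> 1 then 1 else 0)) \<partial>lborel)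
     = (\<integral>\<^sup>+p. H p * (ennreal (norm (fst p) ^ 3) * (if norm (fst p) \<le> 1 then 1 else 0)) \<partial>lborel)"
  proof (rule nn_integral_homogeneous_change[OF Hm])
    show "H x = ennreal (c ^ DIM((real^3) \<times> (real^3) \<times> (real^3))) * H (c *\<^sub>R x)" if c: "c > 0" for c x
    proof -
      obtain Q X Z where x: "x = (Q, X, Z)" by (cases x) auto
      have k: "arc_kernel W (c *\<^sub>R Q) (c *\<^sub>R X) = arc_kernel W Q X / c ^ 6" for X
        unfolding arc_kernel_def scaleR_diff_right[symmetric] norm_scaleR scale[OF c c]
        using c by (simp add: power_mult_distrib field_simps power_eq_if)
      have "c ^ 9 * (\<bar>triple (c *\<^sub>R X) (c *\<^sub>R Q) (c *\<^sub>R Z)\<bar> / 27 * (arc_kernel W (c *\<^sub>R Q) (c *\<^sub>R X) * arc_kernel W (c *\<^sub>R Q) (c *\<^sub>R Z)))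
        = \<bar>triple X Q Z\<bar> / 27 * (arc_kernel W Q X * arc_kernel W Q Z)"
        unfolding k triple_scaleR using c by (simp add: abs_mult field_simps power_eq_if)
      moreover have "0 \<le> c ^ 9" using c by simp
      ultimately have "ennreal (\<bar>triple X Q Z\<bar> / 27 * (arc_kernel W Q X * arc_kernel W Q Z)) = ennreal (c ^ 9) * H (c *\<^sub>R x)"
        unfolding x H_def by (simp only: scaleR_prod_def fst_conv snd_conv prod.case ennreal_mult'[symmetric])
      then show ?thesis by (simp add: x H_def)
    qed
    show "(\<lambda>p::(real^3) \<times> (real^3) \<times> (real^3). norm (fst p - snd (snd p))) \<in> borel_measurable borel"
      "(\<lambda>p::(real^3) \<times> (real^3) \<times> (real^3). norm (fst p)) \<in> borel_measurable borel"
      by (intro borel_measurable_continuous_onI continuous_intros)+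
    show "norm (fst (c *\<^sub>R x) - snd (snd (c *\<^sub>R x))) = c * norm (fst x - snd (snd x))" if "c > 0" for c and x :: "(real^3) \<times> (real^3) \<times> (real^3)"
      using that by (simp add: scaleR_diff_right[symmetric])
    show "norm (fst (c *\<^sub>R x)) = c * norm (fst x)" if "c > 0" for c and x :: "(real^3) \<times> (real^3) \<times> (real^3)"
      using that by simp
    show "0 < norm (fst x - snd (snd x)) \<and> 0 < norm (fst x)" if "H x \<noteq> 0" for x
    proof -
      obtain Q X Z where x: "x = (Q, X, Z)" by (cases x) auto
      have "Q - Z \<noteq> 0" using that unfolding x H_def arc_kernel_def by auto
      moreover have "Q \<noteq> 0" using that unfolding x H_def by (auto simp: triple_eq)
      ultimately show ?thesis by (simp add: x)
    qed
  qed
  have split: "(\<integral>\<^sup>+p. F p \<partial>lborel) = (\<integral>\<^sup>+Q. \<integral>\<^sup>+X. \<integral>\<^sup>+Z. F (Q, X, Z) \<partial>lborel \<partial>lborel \<partial>lborel)"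
    if F: "F \<in> borel_measurable borel" for F :: "(real^3) \<times> (real^3) \<times> (real^3) \<Rightarrow> ennreal"
  proof -
    have "(\<lambda>q. F (Q, q)) \<in> borel_measurable borel" for Q
      using F by (intro measurable_compose[OF _ F] borel_measurable_continuous_onI continuous_intros)
    then show ?thesis using F by (simp add: nn_integral_lborel_Pair)
  qed
  have nm: "(\<lambda>p::(real^3) \<times> (real^3) \<times> (real^3). ennreal (norm (fst p - snd (snd p)) ^ 3) * (if norm (fst p - snd (snd p)) \<le> 1 then 1 else 0)) \<in> borel_measurable borel"
    "(\<lambda>p::(real^3) \<times> (real^3) \<times> (real^3). ennreal (norm (fst p) ^ 3) * (if norm (fst p) \<le> 1 then 1 else 0)) \<in> borel_measurable borel"
    unfolding borel_prod[symmetric] by measurable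
  have "(\<integral>\<^sup>+Q. B Q * (ennreal (norm Q ^ 3) * (\<integral>\<^sup>+X. \<integral>\<^sup>+Z. ennreal (\<bar>triple X Q Z\<bar> / 27 * (arc_kernel W Q X * arc_kernel W Q Z)) \<partial>lborel \<partial>lborel)) \<partial>lborel)
    = (\<integral>\<^sup>+Q. \<integral>\<^sup>+X. \<integral>\<^sup>+Z. (B Q * ennreal (norm Q ^ 3)) * ennreal (\<bar>triple X Q Z\<bar> / 27 * (arc_kernel W Q X * arc_kernel W Q Z)) \<partial>lborel \<partial>lborel \<partial>lborel)"
    by (simp add: nn_integral_cmult mult.assoc)
  also have "\<dots> = (\<integral>\<^sup>+Q. \<integral>\<^sup>+X. \<integral>\<^sup>+Z. H (Q, X, Z) * (ennreal (norm Q ^ 3) * (if norm Q \<le> 1 then 1 else 0)) \<partial>lborel \<partial>lborel \<partial>lborel)"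
    by (intro nn_integral_cong) (simp add: H_def B_def indicator_def mult_ac)
  also have "\<dots> = (\<integral>\<^sup>+p. H p * (ennreal (norm (fst p) ^ 3) * (if norm (fst p) \<le> 1 then 1 else 0)) \<partial>lborel)"
    using split[OF borel_measurable_times_ennreal[OF Hm nm(2)]] by simp
  also have "\<dots> = (\<integral>\<^sup>+p. H p * (ennreal (norm (fst p - snd (snd p)) ^ 3) * (if norm (fst p - snd (snd p)) \<le> 1 then 1 else 0)) \<partial>lborel)"
    by (rule 3[symmetric])
  also have "\<dots> = (\<integral>\<^sup>+Q. \<integral>\<^sup>+X. \<integral>\<^sup>+Z. H (Q, X, Z) * (ennreal (norm (Q - Z) ^ 3) * (if norm (Q - Z) \<le> 1 then 1 else 0)) \<partial>lborel \<partial>lborel \<partial>lborel)"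
    using split[OF borel_measurable_times_ennreal[OF Hm nm(1)]] by simp
  also have "\<dots> \<le> (\<integral>\<^sup>+Q. \<integral>\<^sup>+X. \<integral>\<^sup>+Z. n X * (n (Q - X) * (n Z * \<Phi> X (Q - X) Z)) \<partial>lborel \<partial>lborel \<partial>lborel)"
    by (intro nn_integral_mono pt)
  also have "\<dots> = (\<integral>\<^sup>+X. \<integral>\<^sup>+Y. \<integral>\<^sup>+Z. n X * (n Y * (n Z * \<Phi> X Y Z)) \<partial>lborel \<partial>lborel \<partial>lborel)"
    by (rule 2[symmetric])
  finally show ?thesis using 1 by (rule order_trans)
qed

text \<open>Linear coordinates with third axis Q reduce this to \<open>local_crossing_bound\<close>.
  The prefactor makes both integrals independent of r = norm Q: each integration contributes r^3,
  the triple product r^3, each kernel r^(-6), and the quotient of the cross product by the squared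
  norm nothing.\<close>

lemma pencil_bound:
  fixes W :: "(real^3) \<times> (real^3) \<Rightarrow> real" and Q :: "real^3"
  assumes [measurable]: "W \<in> borel_measurable (borel \<Otimes>\<^sub>M borel)"
    and W: "\<And>p. 0 \<le> W p" "\<And>p. W p \<le> 1" and t: "0 < t" "t \<le> pi" and Q: "Q \<noteq> 0"
  defines "D \<equiv> cap_moment t"
  shows "ennreal (8 * pi * D\<^sup>2) + ennreal (8 * D * t) *
      (ennreal (norm Q ^ 3) * (\<integral>\<^sup>+X. ennreal (arc_kernel W Q X * (norm (cross3 X Q) / ((norm Q)\<^sup>2 * vec_angle X (Q - X)))) \<partial>lborel))
    \<le> ennreal (norm Q ^ 3) * (\<integral>\<^sup>+X. \<integral>\<^sup>+Z. ennreal (\<bar>triple X Q Z\<bar> * (arc_kernel W Q X * arc_kernel W Q Z)) \<partial>lborel \<partial>lborel)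
      + ennreal (16 * pi * D * t * (1 - cos t))"
proof -
  obtain U V where UV: "norm U = norm Q" "norm V = norm Q" "U \<bullet> V = 0" "U \<bullet> Q = 0" "V \<bullet> Q = 0"
    "triple U V Q = norm Q ^ 3"
    using Q by (rule orthogonal_frame)
  define r where "r = norm Q"
  have r: "r > 0" using Q by (simp add: r_def)
  define P where "P x y k = x *\<^sub>R U + y *\<^sub>R V + k *\<^sub>R Q" for x y k
  have [measurable (raw)]: "(\<lambda>p. P (f p) (g p) (h p)) \<in> borel_measurable M"
    if [measurable]: "f \<in> borel_measurable M" "g \<in> borel_measurable M" "h \<in> borel_measurable M" for f g h and M :: "'z measure"
    unfolding P_def by measurable
  have inner: "P x y k \<bullet> P x' y' k' = r\<^sup>2 * (x * x' + y * y' + k * k')" for x y k x' y' k'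
    using UV unfolding P_def r_def
    by (simp add: inner_add_left inner_add_right inner_commute dot_square_norm algebra_simps)
  have nP: "norm (P x y k) = r * sqrt (x\<^sup>2 + y\<^sup>2 + k\<^sup>2)" for x y k
  proof -
    have "norm (P x y k) = sqrt (r\<^sup>2 * (x\<^sup>2 + y\<^sup>2 + k\<^sup>2))"
      unfolding norm_eq_sqrt_inner inner by (simp add: power2_eq_square)
    then show ?thesis using r by (simp add: real_sqrt_mult)
  qed
  have QP: "Q - P x y k = P (- x) (- y) (1 - k)" for x y k
    by (simp add: P_def algebra_simps)
  have Q1: "Q = P 0 0 1" by (simp add: P_def)
  have nQP: "norm (Q - P x y k) = r * sqrt (x\<^sup>2 + y\<^sup>2 + (1 - k)\<^sup>2)" for x y k
    unfolding QP nP by simp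
  have tr: "\<bar>triple (P x y k) Q (P x' y' k')\<bar> = r ^ 3 * \<bar>x * y' - y * x'\<bar>" for x y k x' y' k'
  proof -
    have "triple (P x y k) Q (P x' y' k') = (y * x' - x * y') * triple U V Q"
      unfolding P_def by (simp add: triple_eq algebra_simps)
    then show ?thesis using r by (simp add: UV(6) abs_mult abs_minus_commute r_def)
  qed
  have cr: "norm (cross3 (P x y k) Q) = r\<^sup>2 * sqrt (x\<^sup>2 + y\<^sup>2)" for x y k
  proof -
    have "(norm (cross3 (P x y k) Q))\<^sup>2 = (norm (P x y k) * norm Q)\<^sup>2 - (P x y k \<bullet> Q)\<^sup>2"
      using norm_cross_dot[of "P x y k" Q] by simp
    also have "P x y k \<bullet> Q = r\<^sup>2 * k" using inner[of x y k 0 0 1] by (simp add: Q1[symmetric])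
    also have "(norm (P x y k) * norm Q)\<^sup>2 - (r\<^sup>2 * k)\<^sup>2 = (r\<^sup>2)\<^sup>2 * (x\<^sup>2 + y\<^sup>2)"
      unfolding nP r_def[symmetric] by (simp add: power_mult_distrib algebra_simps power2_eq_square)
    also have "\<dots> = (r\<^sup>2 * sqrt (x\<^sup>2 + y\<^sup>2))\<^sup>2" by (simp add: power_mult_distrib)
    finally show ?thesis by (simp add: power2_eq_iff_nonneg)
  qed
  have va: "vec_angle (P x y k) (Q - P x y k) = arc_angle (sqrt (x\<^sup>2 + y\<^sup>2)) k" for x y k
  proof -
    have "P x y k \<bullet> (Q - P x y k) = r\<^sup>2 * (k * (1 - k) - (x\<^sup>2 + y\<^sup>2))"
      unfolding QP inner by (simp add: power2_eq_square)
    moreover have "norm (P x y k) * norm (Q - P x y k) = r\<^sup>2 * (sqrt (k\<^sup>2 + (x\<^sup>2 + y\<^sup>2)) * sqrt ((1 - k)\<^sup>2 + (x\<^sup>2 + y\<^sup>2)))"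
      unfolding nP nQP by (simp add: power2_eq_square add_ac)
    ultimately show ?thesis using r by (simp add: vec_angle_def arc_angle_def)
  qed
  define w where "w p = W (P (fst p) (fst (snd p)) (snd (snd p)), Q - P (fst p) (fst (snd p)) (snd (snd p)))" for p
  have wm: "w \<in> borel_measurable (borel \<Otimes>\<^sub>M (borel \<Otimes>\<^sub>M borel))"
    unfolding w_def by measurable
  have ker: "arc_kernel W Q (P x y k) = arc_weight w x y k / r ^ 6" for x y k
    unfolding arc_kernel_def arc_weight_def nP nQP w_def using r
    by (simp add: power_mult_distrib power_eq_if)
  have awm[measurable (raw)]: "(\<lambda>p. arc_weight w (f p) (g p) (h p)) \<in> borel_measurable M"
    if "f \<in> borel_measurable M" "g \<in> borel_measurable M" "h \<in> borel_measurable M" for f g h and M :: "'y measure"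
    using arc_weight_measurable[OF wm that] .
  have T: "triple U V Q \<noteq> 0" using UV(6) r by (simp add: r_def)
  have r3: "0 \<le> r ^ 3" using r by simp
  have lin: "(\<integral>\<^sup>+X. G X \<partial>lborel) = ennreal (r ^ 3) * (\<integral>\<^sup>+x. \<integral>\<^sup>+y. \<integral>\<^sup>+k. G (P x y k) \<partial>lborel \<partial>lborel \<partial>lborel)"
    if "G \<in> borel_measurable borel" for G
    using nn_integral_real3_frame[OF that T] r3 unfolding P_def UV(6) r_def by simp
  have E: "ennreal (r ^ 3) * (\<integral>\<^sup>+X. ennreal (arc_kernel W Q X * (norm (cross3 X Q) / (r\<^sup>2 * vec_angle X (Q - X)))) \<partial>lborel)
    = (\<integral>\<^sup>+x. \<integral>\<^sup>+y. \<integral>\<^sup>+k. ennreal (arc_weight w x y k * (sqrt (x\<^sup>2 + y\<^sup>2) / arc_angle (sqrt (x\<^sup>2 + y\<^sup>2)) k)) \<partial>lborel \<partial>lborel \<partial>lborel)"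
  proof -
    have "ennreal (r ^ 3) * (\<integral>\<^sup>+X. ennreal (arc_kernel W Q X * (norm (cross3 X Q) / (r\<^sup>2 * vec_angle X (Q - X)))) \<partial>lborel)
      = ennreal (r ^ 3) * (ennreal (r ^ 3) * (\<integral>\<^sup>+x. \<integral>\<^sup>+y. \<integral>\<^sup>+k. ennreal (arc_weight w x y k / r ^ 6 * (r\<^sup>2 * sqrt (x\<^sup>2 + y\<^sup>2) / (r\<^sup>2 * arc_angle (sqrt (x\<^sup>2 + y\<^sup>2)) k))) \<partial>lborel \<partial>lborel \<partial>lborel))"
      by (subst lin, measurable) (simp only: ker cr va)
    also have "\<dots> = (\<integral>\<^sup>+x. \<integral>\<^sup>+y. \<integral>\<^sup>+k. ennreal (r ^ 3) * (ennreal (r ^ 3) * ennreal (arc_weight w x y k / r ^ 6 * (r\<^sup>2 * sqrt (x\<^sup>2 + y\<^sup>2) / (r\<^sup>2 * arc_angle (sqrt (x\<^sup>2 + y\<^sup>2)) k)))) \<partial>lborel \<partial>lborel \<partial>lborel)"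
      by (simp add: nn_integral_cmult)
    also have "\<dots> = (\<integral>\<^sup>+x. \<integral>\<^sup>+y. \<integral>\<^sup>+k. ennreal (arc_weight w x y k * (sqrt (x\<^sup>2 + y\<^sup>2) / arc_angle (sqrt (x\<^sup>2 + y\<^sup>2)) k)) \<partial>lborel \<partial>lborel \<partial>lborel)"
    proof (intro nn_integral_cong)
      fix x y k :: real
      have "r ^ 3 * (r ^ 3 * (a / r ^ 6 * (r\<^sup>2 * s / (r\<^sup>2 * g)))) = a * (s / g)" for a s g
        using r by (simp add: power_eq_if)
      then show "ennreal (r ^ 3) * (ennreal (r ^ 3) * ennreal (arc_weight w x y k / r ^ 6 * (r\<^sup>2 * sqrt (x\<^sup>2 + y\<^sup>2) / (r\<^sup>2 * arc_angle (sqrt (x\<^sup>2 + y\<^sup>2)) k))))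
        = ennreal (arc_weight w x y k * (sqrt (x\<^sup>2 + y\<^sup>2) / arc_angle (sqrt (x\<^sup>2 + y\<^sup>2)) k))"
        by (simp only: ennreal_mult'[OF r3, symmetric])
    qed
    finally show ?thesis .
  qed
  have I: "ennreal (r ^ 3) * (\<integral>\<^sup>+X. \<integral>\<^sup>+Z. ennreal (\<bar>triple X Q Z\<bar> * (arc_kernel W Q X * arc_kernel W Q Z)) \<partial>lborel \<partial>lborel)
    = (\<integral>\<^sup>+x. \<integral>\<^sup>+y. \<integral>\<^sup>+k. \<integral>\<^sup>+x'. \<integral>\<^sup>+y'. \<integral>\<^sup>+k'. ennreal (\<bar>x * y' - y * x'\<bar> * arc_weight w x y k * arc_weight w x' y' k')
          \<partial>lborel \<partial>lborel \<partial>lborel \<partial>lborel \<partial>lborel \<partial>lborel)"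
  proof -
    have inn: "(\<integral>\<^sup>+Z. ennreal (\<bar>triple X Q Z\<bar> * (arc_kernel W Q X * arc_kernel W Q Z)) \<partial>lborel)
      = ennreal (r ^ 3) * (\<integral>\<^sup>+x'. \<integral>\<^sup>+y'. \<integral>\<^sup>+k'. ennreal (\<bar>triple X Q (P x' y' k')\<bar> * (arc_kernel W Q X * arc_kernel W Q (P x' y' k'))) \<partial>lborel \<partial>lborel \<partial>lborel)" for X
      by (rule lin) measurable
    have "(\<integral>\<^sup>+X. \<integral>\<^sup>+Z. ennreal (\<bar>triple X Q Z\<bar> * (arc_kernel W Q X * arc_kernel W Q Z)) \<partial>lborel \<partial>lborel)
      = ennreal (r ^ 3) * (\<integral>\<^sup>+x. \<integral>\<^sup>+y. \<integral>\<^sup>+k. \<integral>\<^sup>+Z. ennreal (\<bar>triple (P x y k) Q Z\<bar> * (arc_kernel W Q (P x y k) * arc_kernel W Q Z)) \<partial>lborel \<partial>lborel \<partial>lborel \<partial>lborel)"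
      by (rule lin) measurable
    also have "\<dots> = ennreal (r ^ 3) * (\<integral>\<^sup>+x. \<integral>\<^sup>+y. \<integral>\<^sup>+k. ennreal (r ^ 3) * (\<integral>\<^sup>+x'. \<integral>\<^sup>+y'. \<integral>\<^sup>+k'.
        ennreal (\<bar>triple (P x y k) Q (P x' y' k')\<bar> * (arc_kernel W Q (P x y k) * arc_kernel W Q (P x' y' k'))) \<partial>lborel \<partial>lborel \<partial>lborel) \<partial>lborel \<partial>lborel \<partial>lborel)"
      by (simp only: inn)
    also have "\<dots> = ennreal (r ^ 3) * (\<integral>\<^sup>+x. \<integral>\<^sup>+y. \<integral>\<^sup>+k. ennreal (r ^ 3) * (\<integral>\<^sup>+x'. \<integral>\<^sup>+y'. \<integral>\<^sup>+k'.
        ennreal (r ^ 3 * \<bar>x * y' - y * x'\<bar> * (arc_weight w x y k / r ^ 6 * (arc_weight w x' y' k' / r ^ 6))) \<partial>lborel \<partial>lborel \<partial>lborel) \<partial>lborel \<partial>lborel \<partial>lborel)"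
      by (simp only: tr ker)
    finally have "ennreal (r ^ 3) * (\<integral>\<^sup>+X. \<integral>\<^sup>+Z. ennreal (\<bar>triple X Q Z\<bar> * (arc_kernel W Q X * arc_kernel W Q Z)) \<partial>lborel \<partial>lborel)
      = (\<integral>\<^sup>+x. \<integral>\<^sup>+y. \<integral>\<^sup>+k. \<integral>\<^sup>+x'. \<integral>\<^sup>+y'. \<integral>\<^sup>+k'. ennreal (r ^ 3) * (ennreal (r ^ 3) * (ennreal (r ^ 3) *
        ennreal (r ^ 3 * \<bar>x * y' - y * x'\<bar> * (arc_weight w x y k / r ^ 6 * (arc_weight w x' y' k' / r ^ 6))))) \<partial>lborel \<partial>lborel \<partial>lborel \<partial>lborel \<partial>lborel \<partial>lborel)"
      by (simp add: nn_integral_cmult)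
    also have "\<dots> = (\<integral>\<^sup>+x. \<integral>\<^sup>+y. \<integral>\<^sup>+k. \<integral>\<^sup>+x'. \<integral>\<^sup>+y'. \<integral>\<^sup>+k'. ennreal (\<bar>x * y' - y * x'\<bar> * arc_weight w x y k * arc_weight w x' y' k')
          \<partial>lborel \<partial>lborel \<partial>lborel \<partial>lborel \<partial>lborel \<partial>lborel)"
    proof (intro nn_integral_cong)
      fix x y k x' y' k' :: real
      have "r ^ 3 * (r ^ 3 * (r ^ 3 * (r ^ 3 * s * (a / r ^ 6 * (b / r ^ 6))))) = s * a * b" for a b s
        using r by (simp add: power_eq_if)
      then show "ennreal (r ^ 3) * (ennreal (r ^ 3) * (ennreal (r ^ 3) *
        ennreal (r ^ 3 * \<bar>x * y' - y * x'\<bar> * (arc_weight w x y k / r ^ 6 * (arc_weight w x' y' k' / r ^ 6)))))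
        = ennreal (\<bar>x * y' - y * x'\<bar> * arc_weight w x y k * arc_weight w x' y' k')"
        by (simp only: ennreal_mult'[OF r3, symmetric])
    qed
    finally show ?thesis .
  qed
  show ?thesis
    unfolding r_def[symmetric] E I D_def by (rule local_crossing_bound[OF wm _ _ t]) (simp_all add: w_def W)
qed

text \<open>The great circle arc from \<open>X\<close> to \<open>Y\<close> is swept out by \<open>s X + Y\<close> for \<open>s > 0\<close>, whose direction moves with
  speed \<open>norm (cross3 X Y) / (norm (s X + Y))\<^sup>2\<close>; dividing by the length of the arc writes the
  constant 1 as an average over the points \<open>Q\<close> of the arc.\<close>

lemma edge_mass_le:
  fixes W :: "(real^3) \<times> (real^3) \<Rightarrow> real"
  assumes [measurable]: "W \<in> borel_measurable (borel \<Otimes>\<^sub>M borel)"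
    and W0: "\<And>p. 0 \<le> W p"
    and scale: "\<And>a b X Y. a > 0 \<Longrightarrow> b > 0 \<Longrightarrow> W (a *\<^sub>R X, b *\<^sub>R Y) = W (X, Y)"
  defines "B \<equiv> indicator (cball 0 1) :: real^3 \<Rightarrow> ennreal"
  shows "(\<integral>\<^sup>+X. \<integral>\<^sup>+Y. B X * (B Y * ennreal (W (X, Y))) \<partial>lborel \<partial>lborel)
    \<le> ennreal (1/3) * (\<integral>\<^sup>+Q. B Q * (ennreal (norm Q ^ 3) * (\<integral>\<^sup>+X. ennreal (arc_kernel W Q X * (norm (cross3 X Q) / ((norm Q)\<^sup>2 * vec_angle X (Q - X)))) \<partial>lborel)) \<partial>lborel)"
proof -
  have [measurable]: "B \<in> borel_measurable borel"
    unfolding B_def by (intro borel_measurable_indicator) simp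
  have Bif: "B x = (if norm x \<le> 1 then 1 else 0)" for x
    by (simp add: B_def indicator_def)
  have W1: "W (a *\<^sub>R X, Y) = W (X, Y)" if "a > 0" for a X Y
    using scale[OF that zero_less_one, of X Y] by simp
  have va1: "vec_angle (a *\<^sub>R X) Y = vec_angle X Y" if "a > 0" for a X Y
    using vec_angle_scaleR[OF that zero_less_one, of X Y] by simp
  define k where "k X Y = ennreal (norm (cross3 X Y) / (norm (X + Y))\<^sup>2) * ennreal (W (X, Y) / vec_angle X Y)" for X Y
  have [measurable (raw)]: "(\<lambda>x. k (f x) (g x)) \<in> borel_measurable M"
    if [measurable]: "f \<in> borel_measurable M" "g \<in> borel_measurable M" for f g and M :: "'z measure"
    unfolding k_def by measurable
  define n where "n X = ennreal (1 / (3 * norm X ^ 3))" for X :: "real^3"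
  have [measurable]: "n \<in> borel_measurable borel" unfolding n_def by measurable
  define i where "i a = (if 0 < a then ennreal (1/a) else 0)" for a :: real
  have [measurable]: "i \<in> borel_measurable borel" unfolding i_def by measurable
  have ins: "(\<integral>\<^sup>+s. i s * k (s *\<^sub>R X) Y \<partial>lborel) = ennreal (W (X, Y))" if c: "cross3 X Y \<noteq> 0" for X Y
  proof -
    have "i s * k (s *\<^sub>R X) Y = (if 0 < s then ennreal (norm (cross3 X Y) / (norm (s *\<^sub>R X + Y))\<^sup>2) else 0) * ennreal (W (X, Y) / vec_angle X Y)" for s
    proof (cases "0 < s")
      case True
      have "ennreal (1 / s) * ennreal (norm (cross3 (s *\<^sub>R X) Y) / (norm (s *\<^sub>R X + Y))\<^sup>2) = ennreal (norm (cross3 X Y) / (norm (s *\<^sub>R X + Y))\<^sup>2)"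
        using True by (simp add: ennreal_mult[symmetric] cross_mult_left)
      then show ?thesis using True by (simp add: i_def k_def W1 va1 mult.assoc[symmetric])
    qed (simp add: i_def)
    then have "(\<integral>\<^sup>+s. i s * k (s *\<^sub>R X) Y \<partial>lborel) = ennreal (vec_angle X Y) * ennreal (W (X, Y) / vec_angle X Y)"
      using nn_integral_arc_angle(2)[OF c] by (simp add: nn_integral_multc)
    then show ?thesis using nn_integral_arc_angle(1)[OF c] W0 by (simp add: ennreal_mult[symmetric])
  qed
  have sc: "(\<integral>\<^sup>+X. \<integral>\<^sup>+s. B X * (i s * G (s *\<^sub>R X)) \<partial>lborel \<partial>lborel) = (\<integral>\<^sup>+X. n X * G X \<partial>lborel)"
    if "G \<in> borel_measurable borel" for G
    using nn_integral_ball_scale'[OF that] unfolding B_def i_def n_def .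
  have "(\<integral>\<^sup>+X. \<integral>\<^sup>+Y. B X * (B Y * ennreal (W (X, Y))) \<partial>lborel \<partial>lborel)
    = (\<integral>\<^sup>+X. \<integral>\<^sup>+Y. \<integral>\<^sup>+s. B Y * (B X * (i s * k (s *\<^sub>R X) Y)) \<partial>lborel \<partial>lborel \<partial>lborel)"
  proof (rule nn_integral_cong_AE, rule eventually_mono[OF AE_lborel_singleton[of 0]])
    fix X :: "real^3" assume X: "X \<noteq> 0"
    show "(\<integral>\<^sup>+Y. B X * (B Y * ennreal (W (X, Y))) \<partial>lborel) = (\<integral>\<^sup>+Y. \<integral>\<^sup>+s. B Y * (B X * (i s * k (s *\<^sub>R X) Y)) \<partial>lborel \<partial>lborel)"
    proof (rule nn_integral_cong_AE, rule eventually_mono[OF AE_cross3_nonzero[OF X]])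
      fix Y assume c: "cross3 X Y \<noteq> 0"
      show "B X * (B Y * ennreal (W (X, Y))) = (\<integral>\<^sup>+s. B Y * (B X * (i s * k (s *\<^sub>R X) Y)) \<partial>lborel)"
        by (simp add: nn_integral_cmult ins[OF c] mult_ac)
    qed
  qed
  also have "\<dots> = (\<integral>\<^sup>+Y. \<integral>\<^sup>+X. \<integral>\<^sup>+s. B Y * (B X * (i s * k (s *\<^sub>R X) Y)) \<partial>lborel \<partial>lborel \<partial>lborel)"
    by (rule lborel_pair.Fubini') measurable
  also have "\<dots> = (\<integral>\<^sup>+Y. B Y * (\<integral>\<^sup>+X. \<integral>\<^sup>+s. B X * (i s * k (s *\<^sub>R X) Y) \<partial>lborel \<partial>lborel) \<partial>lborel)"
    by (simp add: nn_integral_cmult)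
  also have "\<dots> = (\<integral>\<^sup>+Y. B Y * (\<integral>\<^sup>+X. n X * k X Y \<partial>lborel) \<partial>lborel)"
    by (subst sc) simp_all
  also have "\<dots> = (\<integral>\<^sup>+Y. \<integral>\<^sup>+X. B Y * (n X * k X Y) \<partial>lborel \<partial>lborel)"
    by (simp add: nn_integral_cmult)
  also have "\<dots> = (\<integral>\<^sup>+X. \<integral>\<^sup>+Y. B Y * (n X * k X Y) \<partial>lborel \<partial>lborel)"
    by (rule lborel_pair.Fubini') measurable
  finally have 1: "(\<integral>\<^sup>+X. \<integral>\<^sup>+Y. B X * (B Y * ennreal (W (X, Y))) \<partial>lborel \<partial>lborel) = (\<integral>\<^sup>+X. \<integral>\<^sup>+Y. B Y * (n X * k X Y) \<partial>lborel \<partial>lborel)" .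
  define H where "H p = n (fst p) * (ennreal (1 / norm (snd p) ^ 3) * k (fst p) (snd p))" for p
  have Hm: "H \<in> borel_measurable borel"
  proof -
    have "H \<in> borel_measurable (borel \<Otimes>\<^sub>M borel)" unfolding H_def by measurable
    then show ?thesis by (simp add: borel_prod)
  qed
  \<comment> \<open>The cutoff passes from the end Y to the sum X + Y, which becomes the point Q of
    the arc. Here H has degree -6 on a space of dimension 6.\<close>
  have hom: "(\<integral>\<^sup>+p. H p * (ennreal (norm (snd p) ^ 3) * (if norm (snd p) \<le> 1 then 1 else 0)) \<partial>lborel)
     = (\<integral>\<^sup>+p. H p * (ennreal (norm (fst p + snd p) ^ 3) * (if norm (fst p + snd p) \<le> 1 then 1 else 0)) \<partial>lborel)"
  proof (rule nn_integral_homogeneous_change[OF Hm])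
    show "H x = ennreal (c ^ DIM((real^3) \<times> (real^3))) * H (c *\<^sub>R x)" if c: "c > 0" for c x
    proof -
      obtain X Y where x: "x = (X, Y)" by (cases x)
      have kk: "k (c *\<^sub>R X) (c *\<^sub>R Y) = k X Y"
        unfolding k_def scale[OF c c] vec_angle_scaleR[OF c c] scaleR_add_right[symmetric] norm_scaleR
        using c by (simp add: cross_mult_left cross_mult_right power_mult_distrib power2_eq_square)
      have "ennreal (c ^ 6) * (n (c *\<^sub>R X) * ennreal (1 / norm (c *\<^sub>R Y) ^ 3)) = n X * ennreal (1 / norm Y ^ 3)"
        unfolding n_def norm_scaleR using c by (simp add: ennreal_mult[symmetric] power_mult_distrib power_eq_if)
      then have "ennreal (c ^ 6) * (n (c *\<^sub>R X) * (ennreal (1 / norm (c *\<^sub>R Y) ^ 3) * k X Y)) = n X * (ennreal (1 / norm Y ^ 3) * k X Y)"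
        by (simp only: mult.assoc[symmetric])
      then show ?thesis unfolding x H_def by (simp add: kk scaleR_prod_def del: norm_scaleR)
    qed
    show "(\<lambda>p::(real^3) \<times> (real^3). norm (snd p)) \<in> borel_measurable borel"
      "(\<lambda>p::(real^3) \<times> (real^3). norm (fst p + snd p)) \<in> borel_measurable borel"
      by (intro borel_measurable_continuous_onI continuous_intros)+
    show "norm (snd (c *\<^sub>R x)) = c * norm (snd x)" if "c > 0" for c and x :: "(real^3) \<times> (real^3)"
      using that by simp
    show "norm (fst (c *\<^sub>R x) + snd (c *\<^sub>R x)) = c * norm (fst x + snd x)" if "c > 0" for c and x :: "(real^3) \<times> (real^3)"
      using that by (simp add: scaleR_add_right[symmetric])
    show "0 < norm (snd x) \<and> 0 < norm (fst x + snd x)" if "H x \<noteq> 0" for x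
    proof -
      have "snd x \<noteq> 0" using that by (auto simp: H_def)
      moreover have "fst x + snd x \<noteq> 0" using that by (auto simp: H_def k_def)
      ultimately show ?thesis by simp
    qed
  qed
  have nm: "(\<lambda>p::(real^3) \<times> (real^3). ennreal (norm (snd p) ^ 3) * (if norm (snd p) \<le> 1 then 1 else 0)) \<in> borel_measurable borel"
    "(\<lambda>p::(real^3) \<times> (real^3). ennreal (norm (fst p + snd p) ^ 3) * (if norm (fst p + snd p) \<le> 1 then 1 else 0)) \<in> borel_measurable borel"
    unfolding borel_prod[symmetric] by measurable
  have "(\<integral>\<^sup>+X. \<integral>\<^sup>+Y. B Y * (n X * k X Y) \<partial>lborel \<partial>lborel)
    = (\<integral>\<^sup>+X. \<integral>\<^sup>+Y. H (X, Y) * (ennreal (norm Y ^ 3) * (if norm Y \<le> 1 then 1 else 0)) \<partial>lborel \<partial>lborel)"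
  proof (rule nn_integral_cong, rule nn_integral_cong_AE, rule eventually_mono[OF AE_lborel_singleton[of 0]])
    fix X Y :: "real^3" assume Y: "Y \<noteq> 0"
    have "ennreal (1 / norm Y ^ 3) * ennreal (norm Y ^ 3) = 1"
      using Y by (simp add: ennreal_mult[symmetric])
    then have "ennreal (1 / norm Y ^ 3) * (ennreal (norm Y ^ 3) * R) = R" for R
      by (simp add: mult.assoc[symmetric])
    moreover have "H (X, Y) * (ennreal (norm Y ^ 3) * (if norm Y \<le> 1 then 1 else 0))
      = ennreal (1 / norm Y ^ 3) * (ennreal (norm Y ^ 3) * (B Y * (n X * k X Y)))"
      unfolding H_def fst_conv snd_conv B_def by (simp add: indicator_def mult_ac)
    ultimately show "B Y * (n X * k X Y) = H (X, Y) * (ennreal (norm Y ^ 3) * (if norm Y \<le> 1 then 1 else 0))" by simp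
  qed
  also have "\<dots> = (\<integral>\<^sup>+p. H p * (ennreal (norm (snd p) ^ 3) * (if norm (snd p) \<le> 1 then 1 else 0)) \<partial>lborel)"
    by (subst nn_integral_lborel_Pair[OF borel_measurable_times_ennreal[OF Hm nm(1)]]) simp
  also have "\<dots> = (\<integral>\<^sup>+p. H p * (ennreal (norm (fst p + snd p) ^ 3) * (if norm (fst p + snd p) \<le> 1 then 1 else 0)) \<partial>lborel)"
    by (rule hom)
  also have "\<dots> = (\<integral>\<^sup>+X. \<integral>\<^sup>+Y. H (X, Y) * (ennreal (norm (X + Y) ^ 3) * B (X + Y)) \<partial>lborel \<partial>lborel)"
    by (subst nn_integral_lborel_Pair[OF borel_measurable_times_ennreal[OF Hm nm(2)]]) (simp only: fst_conv snd_conv Bif)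
  also have "\<dots> = (\<integral>\<^sup>+X. \<integral>\<^sup>+Q. H (X, Q - X) * (ennreal (norm Q ^ 3) * B Q) \<partial>lborel \<partial>lborel)"
  proof (rule nn_integral_cong)
    fix X :: "real^3"
    have "(\<lambda>Y. H (X, Y) * (ennreal (norm (X + Y) ^ 3) * B (X + Y))) \<in> borel_measurable borel"
      unfolding H_def fst_conv snd_conv by measurable
    from nn_integral_lborel_shift[OF this, of X]
    show "(\<integral>\<^sup>+Y. H (X, Y) * (ennreal (norm (X + Y) ^ 3) * B (X + Y)) \<partial>lborel) = (\<integral>\<^sup>+Q. H (X, Q - X) * (ennreal (norm Q ^ 3) * B Q) \<partial>lborel)"
      by simp
  qed
  also have "\<dots> = (\<integral>\<^sup>+Q. \<integral>\<^sup>+X. H (X, Q - X) * (ennreal (norm Q ^ 3) * B Q) \<partial>lborel \<partial>lborel)"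
    unfolding H_def by (rule lborel_pair.Fubini') measurable
  also have "\<dots> = (\<integral>\<^sup>+Q. \<integral>\<^sup>+X. ennreal (1/3) * (B Q * (ennreal (norm Q ^ 3) * ennreal (arc_kernel W Q X * (norm (cross3 X Q) / ((norm Q)\<^sup>2 * vec_angle X (Q - X)))))) \<partial>lborel \<partial>lborel)"
  proof (intro nn_integral_cong)
    fix Q X :: "real^3"
    have c: "cross3 X (Q - X) = cross3 X Q"
      by (simp add: Cross3.right_diff_distrib)
    define x y z v w c where "x = norm X ^ 3" and "y = norm (Q - X) ^ 3" and "z = (norm Q)\<^sup>2" and "v = vec_angle X (Q - X)"
      and "w = W (X, Q - X)" and "c = norm (cross3 X Q)"
    have nn: "0 \<le> x" "0 \<le> y" "0 \<le> z" "0 \<le> w" "0 \<le> c"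
      using W0 by (auto simp: x_def y_def z_def w_def c_def)
    have "1 / (3 * x) * (1 / y * (c / z * (w / v))) = 1/3 * (w / (x * y) * (c / (z * v)))" by (simp add: mult_ac)
    moreover have "ennreal (1 / (3 * x)) * (ennreal (1 / y) * (ennreal (c / z) * ennreal (w / v))) = ennreal (1 / (3 * x) * (1 / y * (c / z * (w / v))))"
      using nn by (simp only: ennreal_mult'[symmetric] divide_nonneg_nonneg mult_nonneg_nonneg zero_le_one zero_le_numeral)
    moreover have "ennreal (1/3 * (w / (x * y) * (c / (z * v)))) = ennreal (1/3) * ennreal (w / (x * y) * (c / (z * v)))"
      by (rule ennreal_mult') simp
    ultimately have "H (X, Q - X) = ennreal (1/3) * ennreal (arc_kernel W Q X * (norm (cross3 X Q) / ((norm Q)\<^sup>2 * vec_angle X (Q - X))))"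
      unfolding H_def n_def k_def fst_conv snd_conv arc_kernel_def \<open>cross3 X (Q - X) = cross3 X Q\<close> add_diff_cancel_left' diff_add_cancel
        x_def[symmetric] y_def[symmetric] w_def[symmetric] c_def[symmetric]
      by (simp add: z_def v_def)
    then show "H (X, Q - X) * (ennreal (norm Q ^ 3) * B Q) = ennreal (1/3) * (B Q * (ennreal (norm Q ^ 3) * ennreal (arc_kernel W Q X * (norm (cross3 X Q) / ((norm Q)\<^sup>2 * vec_angle X (Q - X))))))"
      by (simp only: mult_ac)
  qed
  also have "\<dots> = ennreal (1/3) * (\<integral>\<^sup>+Q. B Q * (ennreal (norm Q ^ 3) * (\<integral>\<^sup>+X. ennreal (arc_kernel W Q X * (norm (cross3 X Q) / ((norm Q)\<^sup>2 * vec_angle X (Q - X)))) \<partial>lborel)) \<partial>lborel)"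
    by (simp add: nn_integral_cmult)
  finally show ?thesis unfolding 1 by simp
qed

section \<open>The lower bound for edge densities\<close>

lemma emeasure_unit_ball3: "emeasure lborel (cball (0 :: real^3) 1) = ennreal (4 * pi / 3)"
  by (subst emeasure_cball) (simp_all add: unit_ball_vol_3)

text \<open>This is \<open>pencil_bound\<close> integrated over the unit ball, of volume 4 pi / 3,
  and divided by 27 for the three absorbed scalings. The edge term uses up only one factor 3, hence
  8 * 3 / 27 = 8 / 9. When W has the mass (4 pi / 3)^2 (1 - cos t) / 2, the two terms containing t
  cancel and a pure lower bound for the crossings remains.\<close>

theorem crossing_measure_bound:
  fixes W :: "(real^3) \<times> (real^3) \<Rightarrow> real"
  assumes Wm[measurable]: "W \<in> borel_measurable (borel \<Otimes>\<^sub>M borel)"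
    and W: "\<And>p. 0 \<le> W p" "\<And>p. W p \<le> 1"
    and scale: "\<And>a b X Y. a > 0 \<Longrightarrow> b > 0 \<Longrightarrow> W (a *\<^sub>R X, b *\<^sub>R Y) = W (X, Y)"
    and t: "0 < t" "t \<le> pi"
  defines "B \<equiv> indicator (cball 0 1) :: real^3 \<Rightarrow> ennreal" and "D \<equiv> cap_moment t"
  shows "ennreal (32 * pi\<^sup>2 / 81 * D\<^sup>2) + ennreal (8 / 9 * D * t) * (\<integral>\<^sup>+X. \<integral>\<^sup>+Y. B X * (B Y * ennreal (W (X, Y))) \<partial>lborel \<partial>lborel)
    \<le> (\<integral>\<^sup>+X. \<integral>\<^sup>+Y. \<integral>\<^sup>+X'. \<integral>\<^sup>+Y'. B X * (B Y * (B X' * (B Y' * (if crosses X Y X' Y' then ennreal (W (X, Y) * W (X', Y')) else 0))))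
        \<partial>lborel \<partial>lborel \<partial>lborel \<partial>lborel) + ennreal (64 * pi\<^sup>2 / 81 * D * t * (1 - cos t))"
    (is "_ + _ * ?M \<le> ?S + _")
proof -
  have [measurable]: "B \<in> borel_measurable borel"
    unfolding B_def by (intro borel_measurable_indicator) simp
  have vol: "(\<integral>\<^sup>+Q. B Q \<partial>lborel) = ennreal (4 * pi / 3)"
    unfolding B_def by (subst nn_integral_indicator) (simp_all add: emeasure_unit_ball3)
  have D: "D > 0" unfolding D_def using t by (rule cap_moment_pos)
  have u: "0 \<le> 1 - cos t" by simp
  define I where "I Q = (\<integral>\<^sup>+X. \<integral>\<^sup>+Z. ennreal (\<bar>triple X Q Z\<bar> * (arc_kernel W Q X * arc_kernel W Q Z)) \<partial>lborel \<partial>lborel)" for Q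
  define E where "E Q = (\<integral>\<^sup>+X. ennreal (arc_kernel W Q X * (norm (cross3 X Q) / ((norm Q)\<^sup>2 * vec_angle X (Q - X)))) \<partial>lborel)" for Q
  have [measurable]: "I \<in> borel_measurable borel" "E \<in> borel_measurable borel"
    unfolding I_def E_def by measurable
  define JI where "JI = (\<integral>\<^sup>+Q. B Q * (ennreal (norm Q ^ 3) * I Q) \<partial>lborel)"
  define JE where "JE = (\<integral>\<^sup>+Q. B Q * (ennreal (norm Q ^ 3) * E Q) \<partial>lborel)"
  have S: "ennreal (1/27) * JI \<le> ?S"
  proof -
    have "ennreal (1/27) * JI = (\<integral>\<^sup>+Q. B Q * (ennreal (norm Q ^ 3) * (\<integral>\<^sup>+X. \<integral>\<^sup>+Z. ennreal (\<bar>triple X Q Z\<bar> / 27 * (arc_kernel W Q X * arc_kernel W Q Z)) \<partial>lborel \<partial>lborel)) \<partial>lborel)"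
    proof -
      have "(\<integral>\<^sup>+X. \<integral>\<^sup>+Z. ennreal (\<bar>triple X Q Z\<bar> / 27 * (arc_kernel W Q X * arc_kernel W Q Z)) \<partial>lborel \<partial>lborel) = ennreal (1/27) * I Q" for Q
      proof -
        have "ennreal (\<bar>triple X Q Z\<bar> / 27 * (arc_kernel W Q X * arc_kernel W Q Z)) = ennreal (1/27) * ennreal (\<bar>triple X Q Z\<bar> * (arc_kernel W Q X * arc_kernel W Q Z))" for X Z
          by (subst ennreal_mult'[symmetric]) simp_all
        then show ?thesis unfolding I_def by (simp add: nn_integral_cmult)
      qed
      then have "(\<integral>\<^sup>+Q. B Q * (ennreal (norm Q ^ 3) * (\<integral>\<^sup>+X. \<integral>\<^sup>+Z. ennreal (\<bar>triple X Q Z\<bar> / 27 * (arc_kernel W Q X * arc_kernel W Q Z)) \<partial>lborel \<partial>lborel)) \<partial>lborel)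
        = (\<integral>\<^sup>+Q. ennreal (1/27) * (B Q * (ennreal (norm Q ^ 3) * I Q)) \<partial>lborel)"
        by (simp only: mult_ac)
      then show ?thesis unfolding JI_def by (simp add: nn_integral_cmult)
    qed
    also have "\<dots> \<le> ?S"
      unfolding B_def by (rule crossing_integral_ge[OF Wm W(1) scale])
    finally show ?thesis .
  qed
  have M: "?M \<le> ennreal (1/3) * JE"
    unfolding JE_def E_def B_def by (rule edge_mass_le[OF Wm W(1) scale])
  define a where "a = ennreal (8 * pi * D\<^sup>2)"
  define b where "b = ennreal (8 * D * t)"
  define c where "c = ennreal (16 * pi * D * t * (1 - cos t))"
  have "a * ennreal (4 * pi / 3) + b * JE = (\<integral>\<^sup>+Q. B Q * (a + b * (ennreal (norm Q ^ 3) * E Q)) \<partial>lborel)"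
  proof -
    have "(\<integral>\<^sup>+Q. B Q * (a + b * (ennreal (norm Q ^ 3) * E Q)) \<partial>lborel)
      = (\<integral>\<^sup>+Q. a * B Q + b * (B Q * (ennreal (norm Q ^ 3) * E Q)) \<partial>lborel)"
      by (intro nn_integral_cong) (simp only: distrib_left mult_ac)
    also have "\<dots> = a * ennreal (4 * pi / 3) + b * JE"
      unfolding JE_def by (simp add: nn_integral_add nn_integral_cmult vol)
    finally show ?thesis by (rule sym)
  qed
  also have "\<dots> \<le> (\<integral>\<^sup>+Q. B Q * (ennreal (norm Q ^ 3) * I Q + c) \<partial>lborel)"
  proof (rule nn_integral_mono_AE, rule eventually_mono[OF AE_lborel_singleton[of 0]])
    fix Q :: "real^3" assume "Q \<noteq> 0"
    then show "B Q * (a + b * (ennreal (norm Q ^ 3) * E Q)) \<le> B Q * (ennreal (norm Q ^ 3) * I Q + c)"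
      unfolding a_def b_def c_def I_def E_def D_def by (intro mult_left_mono pencil_bound[OF Wm W t]) simp_all
  qed
  also have "\<dots> = JI + c * ennreal (4 * pi / 3)"
  proof -
    have "(\<integral>\<^sup>+Q. B Q * (ennreal (norm Q ^ 3) * I Q + c) \<partial>lborel) = (\<integral>\<^sup>+Q. B Q * (ennreal (norm Q ^ 3) * I Q) + c * B Q \<partial>lborel)"
      by (intro nn_integral_cong) (simp only: distrib_left mult_ac)
    also have "\<dots> = JI + c * ennreal (4 * pi / 3)"
      unfolding JI_def by (simp add: nn_integral_add nn_integral_cmult vol)
    finally show ?thesis .
  qed
  finally have "ennreal (1/27) * (a * ennreal (4 * pi / 3) + b * JE) \<le> ennreal (1/27) * (JI + c * ennreal (4 * pi / 3))"
    by (rule mult_left_mono) simp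
  then have main: "ennreal (1/27) * (a * ennreal (4 * pi / 3)) + ennreal (1/27) * (b * JE) \<le> ennreal (1/27) * JI + ennreal (1/27) * (c * ennreal (4 * pi / 3))"
    by (simp only: distrib_left)
  have mult3: "ennreal (1/27) * (ennreal x * ennreal y) = ennreal (1/27 * (x * y))" if "0 \<le> x" for x y
    unfolding ennreal_mult'[OF that, symmetric] by (rule ennreal_mult'[symmetric]) simp
  have ca: "ennreal (1/27) * (a * ennreal (4 * pi / 3)) = ennreal (32 * pi\<^sup>2 / 81 * D\<^sup>2)"
  proof -
    have "1/27 * (8 * pi * D\<^sup>2 * (4 * pi / 3)) = 32 * pi\<^sup>2 / 81 * D\<^sup>2"
      by (simp add: power2_eq_square)
    moreover have "0 \<le> 8 * pi * D\<^sup>2" by simp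
    ultimately show ?thesis unfolding a_def by (simp only: mult3)
  qed
  have cc: "ennreal (1/27) * (c * ennreal (4 * pi / 3)) = ennreal (64 * pi\<^sup>2 / 81 * D * t * (1 - cos t))"
  proof -
    have "1/27 * (16 * pi * D * t * (1 - cos t) * (4 * pi / 3)) = 64 * pi\<^sup>2 / 81 * D * t * (1 - cos t)"
      by (simp add: power2_eq_square)
    moreover have "0 \<le> 16 * pi * D * t * (1 - cos t)" using D t u by simp
    ultimately show ?thesis unfolding c_def by (simp only: mult3)
  qed
  have cb: "ennreal (8 / 9 * D * t) * ?M \<le> ennreal (1/27) * (b * JE)"
  proof -
    have "ennreal (8 / 9 * D * t) * ?M \<le> ennreal (8 / 9 * D * t) * (ennreal (1/3) * JE)"
      by (intro mult_left_mono M) simp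
    also have "\<dots> = ennreal (8 / 9 * D * t * (1/3)) * JE"
      using D t by (subst ennreal_mult'') (simp_all add: mult.assoc)
    also have "8 / 9 * D * t * (1/3) = 1/27 * (8 * D * t)" by simp
    also have "ennreal (1/27 * (8 * D * t)) * JE = ennreal (1/27) * (b * JE)"
      unfolding b_def by (subst ennreal_mult') (simp_all add: mult.assoc)
    finally show ?thesis .
  qed
  have "ennreal (32 * pi\<^sup>2 / 81 * D\<^sup>2) + ennreal (8 / 9 * D * t) * ?M \<le> ennreal (32 * pi\<^sup>2 / 81 * D\<^sup>2) + ennreal (1/27) * (b * JE)"
    by (intro add_left_mono cb)
  also have "\<dots> \<le> ennreal (1/27) * JI + ennreal (64 * pi\<^sup>2 / 81 * D * t * (1 - cos t))"
    using main unfolding ca cc .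
  also have "\<dots> \<le> ?S + ennreal (64 * pi\<^sup>2 / 81 * D * t * (1 - cos t))"
    by (intro add_right_mono S)
  finally show ?thesis .
qed

subsection \<open>Crossings of a drawing\<close>

text \<open>Four vectors in three-space are dependent, and by Cramer's rule the coefficients are
  their signed 3 by 3 minors.\<close>

lemma triple_linear_relation:
  "triple Y X' Y' *\<^sub>R X - triple X X' Y' *\<^sub>R Y = - (triple X Y Y') *\<^sub>R X' + triple X Y X' *\<^sub>R Y'"
  unfolding vec_eq_iff forall_3 triple_eq by (simp add: algebra_simps)

lemma triple_repeat: "triple X Y X = 0" "triple X Y Y = 0"
  by (simp_all add: triple_eq algebra_simps)

text \<open>With respect to X and the unit vector orthogonal to it on the side of Y, the point has
  the coordinates (a + b cos \<theta>, b sin \<theta>). As a unit vector in the upper half-plane it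
  equals (cos s, sin s) for some s in (0, pi), and comparing coefficients gives the form used in
  \<open>shorter_arc\<close>. Positivity of a means sin (\<theta> - s) > 0, which forces s <=
  \<theta>.\<close>

lemma shorter_arc_memI:
  fixes X Y :: "real^3"
  assumes X: "norm X = 1" and Y: "norm Y = 1" and c: "cross3 X Y \<noteq> 0" and ab: "0 < a" "0 < b"
    and n: "norm (a *\<^sub>R X + b *\<^sub>R Y) = 1"
  shows "a *\<^sub>R X + b *\<^sub>R Y \<in> shorter_arc X Y"
proof -
  define d where "d = X \<bullet> Y"
  have id: "(norm (cross3 X Y))\<^sup>2 + d\<^sup>2 = 1"
    using norm_cross_dot[of X Y] X Y by (simp add: d_def)
  have "(norm (cross3 X Y))\<^sup>2 > 0" using c by simp
  then have "d\<^sup>2 < 1" using id by linarith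
  then have d: "-1 < d" "d < 1" by (auto simp: abs_square_less_1 abs_less_iff)
  define \<theta> where "\<theta> = arccos d"
  have \<theta>: "0 < \<theta>" "\<theta> < pi" "cos \<theta> = d"
    using arccos_lt_bounded[OF d] d by (auto simp: \<theta>_def cos_arccos)
  have s\<theta>: "sin \<theta> > 0" using \<theta> by (intro sin_gt_zero)
  define x where "x = a + b * d"
  define y where "y = b * sin \<theta>"
  have "(norm (a *\<^sub>R X + b *\<^sub>R Y))\<^sup>2 = a\<^sup>2 + 2 * a * b * d + b\<^sup>2"
  proof -
    have "X \<bullet> X = 1" "Y \<bullet> Y = 1" using X Y by (simp_all add: dot_square_norm)
    then show ?thesis unfolding power2_norm_eq_inner
      by (simp add: inner_add_left inner_add_right inner_commute[of Y X] d_def power2_eq_square algebra_simps)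
  qed
  then have one: "a\<^sup>2 + 2 * a * b * d + b\<^sup>2 = 1" using n by simp
  have "(sin \<theta>)\<^sup>2 = 1 - d\<^sup>2" using \<theta>(3) by (simp add: sin_squared_eq)
  then have xy: "x\<^sup>2 + y\<^sup>2 = 1" using one
    by (simp add: x_def y_def power_mult_distrib) (simp add: power2_eq_square algebra_simps)
  have y: "y > 0" using ab s\<theta> by (simp add: y_def)
  have "x\<^sup>2 < 1" using xy y by (smt (verit) zero_less_power)
  then have x: "-1 < x" "x < 1" by (auto simp: abs_square_less_1 abs_less_iff)
  define s where "s = arccos x"
  have s: "0 < s" "s < pi" "cos s = x"
    using arccos_lt_bounded[OF x] x by (auto simp: s_def cos_arccos)
  have "(sin s)\<^sup>2 = y\<^sup>2" using xy s(3) by (simp add: sin_squared_eq)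
  moreover have "sin s > 0" using s by (intro sin_gt_zero)
  ultimately have sy: "sin s = y" using y by (simp add: power2_eq_iff_nonneg)
  have b: "b = sin s / sin \<theta>" using s\<theta> by (simp add: sy y_def)
  have "sin (\<theta> - s) = a * sin \<theta>"
    by (simp add: sin_diff s(3) sy \<theta>(3)) (simp add: x_def y_def algebra_simps)
  then have a: "a = sin (\<theta> - s) / sin \<theta>" using s\<theta> by simp
  have "s \<le> \<theta>"
  proof (rule ccontr)
    assume "\<not> s \<le> \<theta>"
    then have "0 < sin (s - \<theta>)" using s \<theta> by (intro sin_gt_zero) auto
    then have "sin (\<theta> - s) < 0" by (simp add: sin_diff algebra_simps)
    then have "a * sin \<theta> < 0" using \<open>sin (\<theta> - s) = a * sin \<theta>\<close> by simp
    then show False using ab s\<theta> by (simp add: mult_less_0_iff)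
  qed
  then have "s \<in> {0..\<theta>}" using s by simp
  moreover have "a *\<^sub>R X + b *\<^sub>R Y = (sin (\<theta> - s) / sin \<theta>) *\<^sub>R X + (sin s / sin \<theta>) *\<^sub>R Y"
    by (simp only: a[symmetric] b[symmetric])
  ultimately show ?thesis
    unfolding shorter_arc_def Let_def d_def[symmetric] \<theta>_def[symmetric] by (rule rev_image_eqI)
qed

lemma crosses_common_point:
  fixes X Y X' Y' :: "real^3"
  assumes "norm X = 1" "norm Y = 1" "norm X' = 1" "norm Y' = 1" and cr: "crosses X Y X' Y'"
  obtains x where "x \<in> shorter_arc X Y" "x \<in> shorter_arc X' Y'" "x \<notin> {X, Y, X', Y'}"
proof -
  obtain a b c d where abcd: "0 < a" "0 < b" "0 < c" "0 < d" "a *\<^sub>R X + b *\<^sub>R Y = c *\<^sub>R X' + d *\<^sub>R Y'"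
  proof -
    have rel: "triple Y X' Y' *\<^sub>R X + (- triple X X' Y') *\<^sub>R Y = (- triple X Y Y') *\<^sub>R X' + triple X Y X' *\<^sub>R Y'"
      using triple_linear_relation[of Y X' Y' X] by simp
    \<comment> \<open>In the second case of \<open>crosses\<close> all minors have the opposite
      sign, and the negated relation is the one with positive coefficients.\<close>
    then have rel': "(- triple Y X' Y') *\<^sub>R X + triple X X' Y' *\<^sub>R Y = triple X Y Y' *\<^sub>R X' + (- triple X Y X') *\<^sub>R Y'"
      by (simp add: algebra_simps)
    from cr show ?thesis unfolding crosses_def
      using that[OF _ _ _ _ rel] that[OF _ _ _ _ rel'] by auto
  qed
  have T: "triple X Y X' \<noteq> 0" "triple Y X' Y' \<noteq> 0" using cr by (auto simp: crosses_def)
  have c1: "cross3 X Y \<noteq> 0"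
  proof
    assume "cross3 X Y = 0"
    moreover have "triple X Y X' = X' \<bullet> cross3 X Y"
      unfolding triple_def by (metis triple_def triple_cyclic)
    ultimately show False using T by simp
  qed
  have c2: "cross3 X' Y' \<noteq> 0" using T(2) by (auto simp: triple_def)
  define z where "z = a *\<^sub>R X + b *\<^sub>R Y"
  \<comment> \<open>The common point is none of the four ends: its cross product with each of them
    is a nonzero multiple of the normal vector of an arc.\<close>
  have cX: "cross3 z X = - (b *\<^sub>R cross3 X Y)" "cross3 z Y = a *\<^sub>R cross3 X Y"
    unfolding z_def by (simp_all add: cross_add_left cross_mult_left cross_skew[of Y X])
  have cX': "cross3 z X' = - (d *\<^sub>R cross3 X' Y')" "cross3 z Y' = c *\<^sub>R cross3 X' Y'"
    unfolding z_def abcd(5) by (simp_all add: cross_add_left cross_mult_left cross_skew[of Y' X'])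
  have "z \<noteq> 0" using cX(2) c1 abcd by auto
  define r where "r = norm z"
  have r: "r > 0" using \<open>z \<noteq> 0\<close> by (simp add: r_def)
  define x where "x = (1 / r) *\<^sub>R z"
  have nx: "norm x = 1" using r by (simp add: x_def r_def)
  have x1: "x = (a / r) *\<^sub>R X + (b / r) *\<^sub>R Y" by (simp add: x_def z_def scaleR_add_right)
  have x2: "x = (c / r) *\<^sub>R X' + (d / r) *\<^sub>R Y'" by (simp add: x_def z_def abcd(5) scaleR_add_right)
  have "x \<in> shorter_arc X Y"
    unfolding x1 by (rule shorter_arc_memI) (use assms c1 abcd r nx x1 in auto)
  moreover have "x \<in> shorter_arc X' Y'"
    unfolding x2 by (rule shorter_arc_memI) (use assms c2 abcd r nx x2 in auto)
  moreover have "x \<notin> {X, Y, X', Y'}"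
  proof
    assume "x \<in> {X, Y, X', Y'}"
    then have "cross3 z X = 0 \<or> cross3 z Y = 0 \<or> cross3 z X' = 0 \<or> cross3 z Y' = 0"
    proof -
      have "z = r *\<^sub>R x" using r by (simp add: x_def)
      then show ?thesis using \<open>x \<in> {X, Y, X', Y'}\<close> by (auto simp: cross_mult_left)
    qed
    then show False unfolding cX cX' using c1 c2 abcd by simp
  qed
  ultimately show ?thesis by (rule that)
qed

section \<open>Crossing pairs of oriented edges\<close>

definition arcs :: "'v set set \<Rightarrow> ('v \<times> 'v) set" where
  "arcs E = {(u, v). {u, v} \<in> E}"

context
  fixes V :: "'v set" and E p
  assumes drawing: "spherical_geodesic_drawing V E p"
begin

lemma drawing_facts:
  shows "finite V" "e \<in> E \<Longrightarrow> e \<subseteq> V \<and> card e = 2" "v \<in> V \<Longrightarrow> norm (p v) = 1" "inj_on p V"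
proof -
  have *: "simple_graph V E" "p ` V \<subseteq> sphere 0 1" "inj_on p V"
    using drawing unfolding spherical_geodesic_drawing_def by blast+
  show "finite V" "e \<in> E \<Longrightarrow> e \<subseteq> V \<and> card e = 2" using *(1) unfolding simple_graph_def by blast+
  show "v \<in> V \<Longrightarrow> norm (p v) = 1" using *(2) by (auto simp: image_subset_iff)
  show "inj_on p V" by (rule *(3))
qed

lemma finite_edges: "finite E"
  using drawing_facts(1,2) by (intro finite_subset[of E "Pow V"]) auto

lemma arcs_subset: "arcs E \<subseteq> V \<times> V"
  using drawing_facts(2) by (fastforce simp: arcs_def)

lemma finite_arcs: "finite (arcs E)"
  using finite_subset[OF arcs_subset] drawing_facts(1) by blast

lemma arcs_neq: "(u, v) \<in> arcs E \<Longrightarrow> u \<noteq> v"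
  using drawing_facts(2)[of "{u, v}"] by (auto simp: arcs_def)

lemma card_arcs: "card (arcs E) = 2 * card E"
proof -
  have *: "card {q. q \<in> arcs E \<and> {fst q, snd q} = e} = 2" if e: "e \<in> E" for e
  proof -
    obtain u v where uv: "e = {u, v}" "u \<noteq> v" using drawing_facts(2)[OF e] by (auto simp: card_2_iff)
    have "{q. q \<in> arcs E \<and> {fst q, snd q} = e} = {(u, v), (v, u)}"
      using e uv by (auto simp: arcs_def doubleton_eq_iff insert_commute)
    then show ?thesis using uv by simp
  qed
  have "arcs E = (\<Union>e\<in>E. {q. q \<in> arcs E \<and> {fst q, snd q} = e})"
    by (auto simp: arcs_def)
  also have "card \<dots> = (\<Sum>e\<in>E. card {q. q \<in> arcs E \<and> {fst q, snd q} = e})"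
    using finite_edges finite_arcs by (intro card_UN_disjoint) (auto intro: finite_subset)
  also have "\<dots> = 2 * card E" using * by simp
  finally show ?thesis .
qed

text \<open>\<open>crossing_count\<close> is a cardinality and would be 0 for an infinite set, so an
  upper bound by it requires finiteness.\<close>

lemma finite_crossings: "finite (crossings V E p)"
proof -
  have "crossings V E p \<subseteq> (\<Union>e\<in>E. \<Union>f\<in>E - {e}. edge_arc p e \<inter> edge_arc p f)"
    by (auto simp: crossings_def)
  moreover have "finite (\<Union>e\<in>E. \<Union>f\<in>E - {e}. edge_arc p e \<inter> edge_arc p f)"
    using drawing finite_edges
    by (intro finite_UN_I finite_Diff) (auto simp: spherical_geodesic_drawing_def good_drawing_def)
  ultimately show ?thesis by (rule finite_subset)
qed

text \<open>The factor 8 counts two orientations of each edge and two orders of the pair of edges.\<close>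

lemma crossing_arcs_le:
  "card {q \<in> arcs E \<times> arcs E. crosses (p (fst (fst q))) (p (snd (fst q))) (p (fst (snd q))) (p (snd (snd q)))}
     \<le> 8 * crossing_count V E p"
proof -
  define C where "C = {q \<in> arcs E \<times> arcs E. crosses (p (fst (fst q))) (p (snd (fst q))) (p (fst (snd q))) (p (snd (snd q)))}"
  have finC: "finite C" unfolding C_def using finite_arcs by simp
  define common where "common q x \<longleftrightarrow> x \<in> edge_interior p {fst (fst q), snd (fst q)} \<inter> edge_interior p {fst (snd q), snd (snd q)}" for q x
  have "\<exists>x. common q x" if q: "q \<in> C" for q
  proof -
    obtain u v u' v' where quv: "q = ((u, v), (u', v'))" by (metis prod.exhaust_sel)
    have arcs: "(u, v) \<in> arcs E" "(u', v') \<in> arcs E" and cr: "crosses (p u) (p v) (p u') (p v')"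
      using q by (auto simp: C_def quv)
    have V: "u \<in> V" "v \<in> V" "u' \<in> V" "v' \<in> V" using arcs arcs_subset by auto
    obtain x where x: "x \<in> shorter_arc (p u) (p v)" "x \<in> shorter_arc (p u') (p v')" "x \<notin> {p u, p v, p u', p v'}"
      using cr V by (rule_tac crosses_common_point[of "p u" "p v" "p u'" "p v'"]) (auto simp: drawing_facts(3))
    have "x \<in> edge_arc p {u, v}" using x(1) arcs_neq[OF arcs(1)] by (auto simp: edge_arc_def)
    moreover have "x \<in> edge_arc p {u', v'}" using x(2) arcs_neq[OF arcs(2)] by (auto simp: edge_arc_def)
    ultimately show ?thesis using x(3) by (auto simp: common_def quv edge_interior_def)
  qed
  then obtain pt where pt: "\<And>q. q \<in> C \<Longrightarrow> common q (pt q)" by metis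
  have good: "\<And>e. e \<in> E \<Longrightarrow> edge_interior p e \<inter> p ` V = {}"
    "\<And>e f g. e \<in> E \<Longrightarrow> f \<in> E \<Longrightarrow> g \<in> E \<Longrightarrow> e \<noteq> f \<Longrightarrow> f \<noteq> g \<Longrightarrow> e \<noteq> g \<Longrightarrow> edge_interior p e \<inter> edge_interior p f \<inter> edge_interior p g = {}"
    using drawing by (auto simp: spherical_geodesic_drawing_def good_drawing_def)
  \<comment> \<open>A repeated end would make one of the triple products 0, so crossing arcs belong
    to different edges.\<close>
  have diff: "{fst (fst q), snd (fst q)} \<noteq> {fst (snd q), snd (snd q)}"
    and inE: "{fst (fst q), snd (fst q)} \<in> E" "{fst (snd q), snd (snd q)} \<in> E" if q: "q \<in> C" for q
  proof -
    show "{fst (fst q), snd (fst q)} \<in> E" "{fst (snd q), snd (snd q)} \<in> E"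
      using q by (auto simp: C_def arcs_def)
    have "crosses (p (fst (fst q))) (p (snd (fst q))) (p (fst (snd q))) (p (snd (snd q)))"
      using q by (simp add: C_def)
    then have "triple (p (fst (fst q))) (p (snd (fst q))) (p (fst (snd q))) \<noteq> 0"
      by (auto simp: crosses_def)
    then have "fst (snd q) \<notin> {fst (fst q), snd (fst q)}" by (auto simp: triple_repeat)
    then show "{fst (fst q), snd (fst q)} \<noteq> {fst (snd q), snd (snd q)}" by auto
  qed
  have img: "pt ` C \<subseteq> crossings V E p"
  proof
    fix x assume "x \<in> pt ` C"
    then obtain q where xq: "x = pt q" and q: "q \<in> C" by (rule imageE)
    define e f where "e = {fst (fst q), snd (fst q)}" and "f = {fst (snd q), snd (snd q)}"
    have E: "e \<in> E" "f \<in> E" "e \<noteq> f"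
      unfolding e_def f_def using inE[OF q] diff[OF q] .
    have x: "x \<in> edge_interior p e" "x \<in> edge_interior p f"
      using pt[OF q] unfolding common_def xq e_def f_def by blast+
    have "x \<notin> p ` V" using good(1)[OF E(1)] x(1) by blast
    moreover have "x \<in> edge_arc p e \<inter> edge_arc p f" using x by (simp add: edge_interior_def)
    ultimately show "x \<in> crossings V E p" unfolding crossings_def using E by blast
  qed
  \<comment> \<open>No three edges share an interior point, so x determines the two edges; what
    remains free are their order and their orientations.\<close>
  have fiber: "card {q \<in> C. pt q = x} \<le> 8" for x
  proof (cases "\<exists>q. q \<in> C \<and> pt q = x")
    case False
    then have "{q \<in> C. pt q = x} = {}" by auto
    then show ?thesis by (simp only: card.empty)
  next
    case True
    then obtain q where q: "q \<in> C" "pt q = x" by blast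
    obtain u v u' v' where quv: "q = ((u, v), (u', v'))" by (metis prod.exhaust_sel)
    define e f where "e = {u, v}" and "f = {u', v'}"
    have ef: "e \<in> E" "f \<in> E" "e \<noteq> f" "x \<in> edge_interior p e" "x \<in> edge_interior p f"
      using inE[OF q(1)] diff[OF q(1)] pt[OF q(1)] unfolding q(2) by (simp_all add: quv e_def f_def common_def)
    have only: "g \<in> {e, f}" if "g \<in> E" "x \<in> edge_interior p g" for g
    proof (rule ccontr)
      assume "g \<notin> {e, f}"
      then have "edge_interior p e \<inter> edge_interior p f \<inter> edge_interior p g = {}"
        using that ef by (intro good(2)) auto
      then show False using that ef by blast
    qed
    define R where "R = {((u, v), (u', v')), ((u, v), (v', u')), ((v, u), (u', v')), ((v, u), (v', u')),
      ((u', v'), (u, v)), ((u', v'), (v, u)), ((v', u'), (u, v)), ((v', u'), (v, u))}"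
    have "{q \<in> C. pt q = x} \<subseteq> R"
    proof
      fix q' assume "q' \<in> {q \<in> C. pt q = x}"
      then have q': "q' \<in> C" "pt q' = x" by auto
      obtain a b a' b' where qab: "q' = ((a, b), (a', b'))" by (metis prod.exhaust_sel)
      have "{a, b} \<in> {e, f}" "{a', b'} \<in> {e, f}" "{a, b} \<noteq> {a', b'}"
      proof -
        have "{a, b} \<in> E" "{a', b'} \<in> E" and "{a, b} \<noteq> {a', b'}"
          using inE[OF q'(1)] diff[OF q'(1)] by (simp_all add: qab)
        moreover have "x \<in> edge_interior p {a, b}" "x \<in> edge_interior p {a', b'}"
          using pt[OF q'(1)] unfolding q'(2) by (simp_all add: qab common_def)
        ultimately show "{a, b} \<in> {e, f}" "{a', b'} \<in> {e, f}" "{a, b} \<noteq> {a', b'}"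
          using only by blast+
      qed
      then have "({a, b} = {u, v} \<and> {a', b'} = {u', v'}) \<or> ({a, b} = {u', v'} \<and> {a', b'} = {u, v})"
        unfolding e_def f_def by (elim insertE emptyE) simp_all
      then show "q' \<in> R" unfolding qab R_def doubleton_eq_iff by (elim disjE conjE) simp_all
    qed
    then have "card {q \<in> C. pt q = x} \<le> card R" by (intro card_mono) (auto simp: R_def)
    also have "\<dots> \<le> 8"
    proof -
      define xs where "xs = [((u, v), (u', v')), ((u, v), (v', u')), ((v, u), (u', v')), ((v, u), (v', u')),
        ((u', v'), (u, v)), ((u', v'), (v, u)), ((v', u'), (u, v)), ((v', u'), (v, u))]"
      have "R = set xs" by (simp add: R_def xs_def)
      then show ?thesis using card_length[of xs] by (simp add: xs_def)
    qed
    finally show ?thesis .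
  qed
  have "C = (\<Union>x\<in>pt ` C. {q \<in> C. pt q = x})" by auto
  then have "card C = card (\<Union>x\<in>pt ` C. {q \<in> C. pt q = x})" by (rule arg_cong)
  also have "\<dots> \<le> (\<Sum>x\<in>pt ` C. card {q \<in> C. pt q = x})"
    by (rule card_UN_le) (simp add: finC)
  also have "\<dots> \<le> (\<Sum>x\<in>pt ` C. 8)" by (intro sum_mono fiber)
  also have "\<dots> = 8 * card (pt ` C)" by simp
  also have "\<dots> \<le> 8 * crossing_count V E p"
    unfolding crossing_count_def using img finite_crossings by (intro mult_left_mono card_mono) auto
  finally show ?thesis unfolding C_def .
qed

end

subsection \<open>Smoothing a drawing\<close>

lemma sgn_vec_measurable[measurable (raw)]:
  fixes f :: "'b \<Rightarrow> real^3"
  assumes [measurable]: "f \<in> borel_measurable M"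
  shows "(\<lambda>x. sgn (f x)) \<in> borel_measurable M"
  unfolding sgn_div_norm by measurable

lemma sgn_in_sphere: "X \<noteq> 0 \<Longrightarrow> sgn X \<in> sphere (0::real^3) 1"
  by (simp add: norm_sgn)

lemma nn_integral_sphere_area:
  fixes f :: "real^3 \<Rightarrow> ennreal"
  assumes [measurable]: "f \<in> borel_measurable borel"
  shows "(\<integral>\<^sup>+x. f x \<partial>sphere_area) = 3 * (\<integral>\<^sup>+X. indicator (cball 0 1) X * f (sgn X) \<partial>lborel)"
proof -
  have fm: "f \<in> borel_measurable (restrict_space borel (sphere 0 1))"
    by (rule measurable_restrict_space1) measurable
  have "(\<integral>\<^sup>+x. f x \<partial>sphere_area) = 3 * (\<integral>\<^sup>+x. f x \<partial>distr (restrict_space lborel (cball 0 1 - {0})) (restrict_space borel (sphere 0 1)) sgn)"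
    unfolding sphere_area_def by (rule nn_integral_scale_measure) (simp add: fm)
  also have "(\<integral>\<^sup>+x. f x \<partial>distr (restrict_space lborel (cball 0 1 - {0})) (restrict_space borel (sphere 0 1)) sgn)
    = (\<integral>\<^sup>+X. f (sgn X) \<partial>restrict_space lborel (cball 0 1 - {0}))"
    by (rule nn_integral_distr[OF sgn_measurable_sphere]) (simp add: fm)
  also have "\<dots> = (\<integral>\<^sup>+X. f (sgn X) * indicator (cball 0 1 - {0}) X \<partial>lborel)"
    by (rule nn_integral_restrict_space) simp
  also have "\<dots> = (\<integral>\<^sup>+X. indicator (cball 0 1) X * f (sgn X) \<partial>lborel)"
    by (rule nn_integral_cong_AE, rule eventually_mono[OF AE_lborel_singleton[of 0]]) (auto simp: indicator_def)
  finally show ?thesis .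
qed

text \<open>Here a is the mean of F over the sphere, expressed through the ball integral of
  \<open>F (sgn X)\<close>; the volume 4 pi / 3 of the ball and the factor 3 in
  \<open>sphere_area\<close> combine to the area 4 pi.\<close>

lemma uniform_on_sphere_tendsto:
  fixes F :: "real^3 \<Rightarrow> real"
  assumes u: "uniform_on_sphere V p" and c: "continuous_on (sphere 0 1) F" and m: "F \<in> borel_measurable borel"
    and F0: "\<And>x. 0 \<le> F x" and a: "0 \<le> a"
    and int: "(\<integral>\<^sup>+X. indicator (cball 0 1) X * ennreal (F (sgn X)) \<partial>lborel) = ennreal (4 * pi / 3 * a)"
  shows "(\<lambda>n. 1 / real n * (\<Sum>v\<in>V n. F (p n v))) \<longlonglongrightarrow> a"
proof -
  have "(\<integral>\<^sup>+x. ennreal (F x) \<partial>sphere_area) = 3 * ennreal (4 * pi / 3 * a)"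
    using nn_integral_sphere_area[of "\<lambda>x. ennreal (F x)"] m int by simp
  also have "\<dots> = ennreal (4 * pi * a)"
  proof -
    have "3 * ennreal x = ennreal (3 * x)" for x by (simp add: ennreal_mult')
    then have "3 * ennreal (4 * pi / 3 * a) = ennreal (3 * (4 * pi / 3 * a))" by blast
    also have "3 * (4 * pi / 3 * a) = 4 * pi * a" by simp
    finally show ?thesis .
  qed
  finally have nn: "(\<integral>\<^sup>+x. ennreal (F x) \<partial>sphere_area) = ennreal (4 * pi * a)" .
  have Fm: "F \<in> borel_measurable sphere_area"
  proof -
    have "F \<in> borel_measurable (restrict_space borel (sphere 0 1))"
      using m by (rule measurable_restrict_space1)
    moreover have "sets sphere_area = sets (restrict_space borel (sphere 0 1))"
      by (simp add: sphere_area_def)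
    ultimately show ?thesis
      using measurable_cong_sets[of sphere_area "restrict_space borel (sphere 0 1)" borel borel] by blast
  qed
  have "(LINT x|sphere_area. F x) = enn2real (\<integral>\<^sup>+x. ennreal (F x) \<partial>sphere_area)"
    using F0 by (intro integral_eq_nn_integral Fm) auto
  also have "\<dots> = 4 * pi * a" unfolding nn using a by simp
  finally have "(LINT x|sphere_area. F x) / (4 * pi) = a" by simp
  moreover have "(\<lambda>n. 1 / real n * (\<Sum>v\<in>V n. F (p n v))) \<longlonglongrightarrow> (LINT x|sphere_area. F x) / (4 * pi)"
    using u c unfolding uniform_on_sphere_def by blast
  ultimately show ?thesis by (simp only:)
qed

text \<open>Uniformity controls one continuous test function at a time, whereas the smoothed density
  must be bounded at all points at once. A kernel built from finitely many test functions reconciles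
  the two: the bound at x is a convex combination, with weights \<open>\<phi> i x\<close>, of
  finitely many means that converge, so it holds for all x from the same n on. Dividing by the areas
  gives every vertex the same total mass.\<close>

lemma smoothing_kernel_exists:
  fixes V :: "nat \<Rightarrow> 'v set" and p :: "nat \<Rightarrow> 'v \<Rightarrow> real^3"
  assumes u: "uniform_on_sphere V p" and \<epsilon>: "\<epsilon> > 0"
  obtains K :: "real^3 \<Rightarrow> real^3 \<Rightarrow> real" where "\<And>z x. 0 \<le> K z x" "\<And>z. K z \<in> borel_measurable borel"
    "\<And>z. z \<in> sphere 0 1 \<Longrightarrow> (\<integral>\<^sup>+X. indicator (cball 0 1) X * ennreal (K z (sgn X)) \<partial>lborel) = ennreal (4 * pi / 3)"
    "\<And>z x. K z x \<noteq> 0 \<Longrightarrow> x \<in> sphere 0 1 \<and> dist z x < \<epsilon>"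
    "\<And>\<eta>. \<eta> > 0 \<Longrightarrow> \<forall>\<^sub>F n in sequentially. \<forall>x. (\<Sum>v\<in>V n. K (p n v) x) \<le> (1 + \<eta>) * real n"
proof -
  have [measurable]: "(indicator (cball 0 1) :: real^3 \<Rightarrow> ennreal) \<in> borel_measurable borel"
    by (intro borel_measurable_indicator) simp
  \<comment> \<open>The kernel is the sum of \<open>\<phi> i z * \<phi> i x / a i\<close> for a partition of unity \<open>\<phi>\<close> subordinate to balls
    of radius \<open>\<epsilon>/2\<close>, with \<open>a i\<close> the normalised area of \<open>\<phi> i\<close>.\<close>
  define S where "S = sphere (0::real^3) 1"
  have cS: "compact S" by (simp add: S_def)
  have cover: "S \<subseteq> (\<Union>i\<in>S. ball i (\<epsilon>/2))" using \<epsilon> by auto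
  obtain I where I: "I \<subseteq> S" "finite I" "S \<subseteq> (\<Union>i\<in>I. ball i (\<epsilon>/2))"
    by (rule compactE_image[OF cS, of S "\<lambda>i. ball i (\<epsilon>/2)"]) (use cover in auto)
  \<comment> \<open>Tent functions around the centres of a finite subcover. Their radius
    \<epsilon>/2 ensures that two points in a common support are closer than \<epsilon>.\<close>
  define \<psi> where "\<psi> i x = max 0 (\<epsilon>/2 - dist i x)" for i x :: "real^3"
  define \<Psi> where "\<Psi> x = (\<Sum>i\<in>I. \<psi> i x)" for x
  define \<phi> where "\<phi> i x = \<psi> i x / \<Psi> x" for i x
  have \<psi>0: "0 \<le> \<psi> i x" for i x by (simp add: \<psi>_def)
  have \<Psi>0: "0 \<le> \<Psi> x" for x unfolding \<Psi>_def by (intro sum_nonneg \<psi>0)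
  have \<Psi>pos: "0 < \<Psi> x" if xS: "x \<in> S" for x
  proof -
    obtain i where i: "i \<in> I" "x \<in> ball i (\<epsilon>/2)" using I(3) xS by blast
    have "0 < \<psi> i x" using i(2) by (simp add: \<psi>_def)
    also have "\<psi> i x \<le> \<Psi> x" unfolding \<Psi>_def using i I(2) \<psi>0 by (intro member_le_sum) auto
    finally show ?thesis .
  qed
  have \<phi>0: "0 \<le> \<phi> i x" for i x using \<psi>0 \<Psi>0 by (simp add: \<phi>_def)
  have \<phi>1: "(\<Sum>i\<in>I. \<phi> i x) = 1" if "x \<in> S" for x
    using \<Psi>pos[OF that] by (simp add: \<phi>_def sum_divide_distrib[symmetric] \<Psi>_def[symmetric])
  have \<phi>le: "\<phi> i x \<le> 1" if "i \<in> I" for i x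
  proof (cases "\<Psi> x = 0")
    case False
    have "\<psi> i x \<le> \<Psi> x" unfolding \<Psi>_def using that I(2) \<psi>0 by (intro member_le_sum) auto
    then show ?thesis using \<Psi>0[of x] False by (simp add: \<phi>_def)
  qed (simp add: \<phi>_def)
  have \<psi>c: "continuous_on A (\<psi> i)" for i A
    unfolding \<psi>_def by (intro continuous_intros)
  have \<phi>c: "continuous_on S (\<phi> i)" for i
  proof -
    have "(\<Sum>i\<in>I. \<psi> i x) \<noteq> 0" if "x \<in> S" for x
      using \<Psi>pos[OF that] by (simp add: \<Psi>_def)
    then show ?thesis unfolding \<phi>_def[abs_def] \<Psi>_def
      by (intro continuous_intros \<psi>c) blast
  qed
  have \<phi>m[measurable]: "\<phi> i \<in> borel_measurable borel" for i
  proof -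
    have "\<psi> i \<in> borel_measurable borel" for i by (intro borel_measurable_continuous_onI \<psi>c)
    then show ?thesis unfolding \<phi>_def[abs_def] \<Psi>_def by measurable
  qed
  have near: "dist z x < \<epsilon>" if "\<phi> i z \<noteq> 0" "\<phi> i x \<noteq> 0" for i z x
  proof -
    have "dist i z < \<epsilon>/2" "dist i x < \<epsilon>/2" using that by (auto simp: \<phi>_def \<psi>_def max_def split: if_splits)
    then show ?thesis using dist_triangle_less_add[of z i "\<epsilon>/2" x "\<epsilon>/2"] by (simp add: dist_commute)
  qed
  define A where "A i = (\<integral>\<^sup>+X. indicator (cball 0 1) X * ennreal (\<phi> i (sgn X)) \<partial>lborel)" for i
  have Afin: "A i \<le> ennreal (4 * pi / 3)" if "i \<in> I" for i
  proof -
    have "A i \<le> (\<integral>\<^sup>+X. indicator (cball (0::real^3) 1) X \<partial>lborel)"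
      unfolding A_def using \<phi>le[OF that] by (intro nn_integral_mono) (auto simp: indicator_def ennreal_le_1)
    also have "\<dots> = ennreal (4 * pi / 3)" by (subst nn_integral_indicator) (simp_all add: emeasure_unit_ball3)
    finally show ?thesis .
  qed
  \<comment> \<open>The kernel divides by this area. It is positive because the centre i lies on the
    sphere and the tent is positive on an open set around it, which cannot be negligible.\<close>
  have Apos: "A i \<noteq> 0" if i: "i \<in> I" for i
  proof
    assume "A i = 0"
    then have ae: "AE X in lborel. indicator (cball 0 1) X * ennreal (\<phi> i (sgn X)) = 0"
      unfolding A_def by (subst (asm) nn_integral_0_iff_AE) simp_all
    define U where "U = (ball 0 1 - {0}) \<inter> (\<lambda>X. \<psi> i (sgn X)) -` {0<..}"
    have "continuous_on (ball 0 1 - {0}) (\<lambda>X::real^3. sgn X)"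
      unfolding sgn_div_norm by (intro continuous_intros) auto
    then have "continuous_on (ball 0 1 - {0}) (\<lambda>X. \<psi> i (sgn X))"
      by (rule continuous_on_compose2[OF \<psi>c[of UNIV]]) auto
    then have openU: "open U" unfolding U_def
      by (intro continuous_open_preimage) auto
    have ni: "norm i = 1" using i I(1) by (auto simp: S_def)
    then have "sgn ((1/2) *\<^sub>R i) = i" by (simp add: sgn_scaleR sgn_div_norm)
    then have "(1/2) *\<^sub>R i \<in> U" using ni \<epsilon> by (auto simp: U_def \<psi>_def)
    then have "U \<noteq> {}" by auto
    have "X \<notin> U" if "indicator (cball 0 1) X * ennreal (\<phi> i (sgn X)) = 0" for X
    proof
      assume X: "X \<in> U"
      then have "X \<noteq> 0" "norm X < 1" "0 < \<psi> i (sgn X)" by (auto simp: U_def)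
      then have "0 < \<phi> i (sgn X)" using \<Psi>pos[of "sgn X"] sgn_in_sphere[of X] by (simp add: \<phi>_def S_def)
      then show False using that \<open>norm X < 1\<close> by (simp add: indicator_def)
    qed
    with ae have "AE X in lborel. X \<notin> U" by (auto elim: eventually_mono)
    then have "negligible U"
      using openU by (simp add: AE_iff_null_sets[symmetric] negligible_iff_null_sets null_sets_completion_iff)
    then show False using open_not_negligible[OF openU \<open>U \<noteq> {}\<close>] by simp
  qed
  define a where "a i = enn2real (A i) * 3 / (4 * pi)" for i
  have Aa: "A i = ennreal (4 * pi / 3 * a i)" and apos: "0 < a i" if "i \<in> I" for i
  proof -
    have "A i < top" using Afin[OF that] by (rule le_less_trans) simp
    then have e: "A i = ennreal (enn2real (A i))" by simp
    show "A i = ennreal (4 * pi / 3 * a i)" unfolding a_def by (subst e) simp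
    have "enn2real (A i) \<noteq> 0" using Apos[OF that] e by (metis ennreal_0)
    then show "0 < a i" by (simp add: a_def enn2real_nonneg order.not_eq_order_implies_strict)
  qed
  \<comment> \<open>The indicator removes points off the sphere, where the \<phi> need not add up to
    1. In particular it removes \<open>sgn 0 = 0\<close>, so the bound on the sum over the vertices
    holds for all x without exception.\<close>
  define K where "K z x = indicator S x * (\<Sum>i\<in>I. \<phi> i z * \<phi> i x / a i)" for z x
  show ?thesis
  proof (rule that[of K])
    show "0 \<le> K z x" for z x
      unfolding K_def using \<phi>0 apos by (intro mult_nonneg_nonneg sum_nonneg divide_nonneg_pos) auto
    show "K z \<in> borel_measurable borel" for z
    proof -
      have "S \<in> sets borel" by (simp add: S_def)
      then show ?thesis unfolding K_def[abs_def] by measurable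
    qed
    show "(\<integral>\<^sup>+X. indicator (cball 0 1) X * ennreal (K z (sgn X)) \<partial>lborel) = ennreal (4 * pi / 3)" if z: "z \<in> sphere 0 1" for z
    proof -
      have "(\<integral>\<^sup>+X. indicator (cball 0 1) X * ennreal (K z (sgn X)) \<partial>lborel)
        = (\<integral>\<^sup>+X. (\<Sum>i\<in>I. ennreal (\<phi> i z / a i) * (indicator (cball 0 1) X * ennreal (\<phi> i (sgn X)))) \<partial>lborel)"
      proof (rule nn_integral_cong_AE, rule eventually_mono[OF AE_lborel_singleton[of 0]])
        fix X :: "real^3" assume "X \<noteq> 0"
        then have "sgn X \<in> S" using sgn_in_sphere[of X] by (simp add: S_def)
        then have "ennreal (K z (sgn X)) = ennreal (\<Sum>i\<in>I. \<phi> i z / a i * \<phi> i (sgn X))"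
          by (simp add: K_def)
        also have "\<dots> = (\<Sum>i\<in>I. ennreal (\<phi> i z / a i * \<phi> i (sgn X)))"
          using \<phi>0 apos by (intro sum_ennreal[symmetric] mult_nonneg_nonneg divide_nonneg_pos)
        also have "\<dots> = (\<Sum>i\<in>I. ennreal (\<phi> i z / a i) * ennreal (\<phi> i (sgn X)))"
          by (simp only: ennreal_mult''[OF \<phi>0])
        finally show "indicator (cball 0 1) X * ennreal (K z (sgn X)) = (\<Sum>i\<in>I. ennreal (\<phi> i z / a i) * (indicator (cball 0 1) X * ennreal (\<phi> i (sgn X))))"
          by (simp add: sum_distrib_left mult_ac)
      qed
      also have "\<dots> = (\<Sum>i\<in>I. ennreal (\<phi> i z / a i) * A i)"
        unfolding A_def by (simp add: nn_integral_sum nn_integral_cmult)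
      also have "\<dots> = (\<Sum>i\<in>I. ennreal (4 * pi / 3 * \<phi> i z))"
      proof (rule sum.cong)
        fix i assume i: "i \<in> I"
        have "ennreal (\<phi> i z / a i) * ennreal (4 * pi / 3 * a i) = ennreal (\<phi> i z / a i * (4 * pi / 3 * a i))"
          using \<phi>0[of i z] apos[OF i] by (intro ennreal_mult[symmetric]) auto
        then show "ennreal (\<phi> i z / a i) * A i = ennreal (4 * pi / 3 * \<phi> i z)"
          using apos[OF i] unfolding Aa[OF i] by (simp add: mult_ac)
      qed simp
      also have "\<dots> = ennreal (\<Sum>i\<in>I. 4 * pi / 3 * \<phi> i z)"
        using \<phi>0 by (intro sum_ennreal) auto
      also have "(\<Sum>i\<in>I. 4 * pi / 3 * \<phi> i z) = 4 * pi / 3"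
      proof -
        have "(\<Sum>i\<in>I. \<phi> i z) = 1" using z by (intro \<phi>1) (simp only: S_def)
        then show ?thesis by (simp only: sum_distrib_left[symmetric] mult_1_right)
      qed
      finally show ?thesis .
    qed
    show "x \<in> sphere 0 1 \<and> dist z x < \<epsilon>" if "K z x \<noteq> 0" for z x
    proof -
      have x: "x \<in> S" and "(\<Sum>i\<in>I. \<phi> i z * \<phi> i x / a i) \<noteq> 0"
        using that by (auto simp: K_def indicator_def split: if_splits)
      then obtain i where "\<phi> i z * \<phi> i x / a i \<noteq> 0" by (meson sum.not_neutral_contains_not_neutral)
      then have "dist z x < \<epsilon>" by (intro near[of i]) auto
      then show ?thesis using x by (simp add: S_def)
    qed
    fix \<eta> :: real assume \<eta>: "\<eta> > 0"
    have "\<forall>\<^sub>F n in sequentially. \<forall>i\<in>I. 1 / real n * (\<Sum>v\<in>V n. \<phi> i (p n v)) < (1 + \<eta>) * a i"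
    proof (intro eventually_ball_finite I(2) ballI)
      fix i assume i: "i \<in> I"
      have "(\<lambda>n. 1 / real n * (\<Sum>v\<in>V n. \<phi> i (p n v))) \<longlonglongrightarrow> a i"
      proof (rule uniform_on_sphere_tendsto[OF u])
        show "continuous_on (sphere 0 1) (\<phi> i)" using \<phi>c by (simp add: S_def)
        show "(\<integral>\<^sup>+X. indicator (cball 0 1) X * ennreal (\<phi> i (sgn X)) \<partial>lborel) = ennreal (4 * pi / 3 * a i)"
          using Aa[OF i] by (simp only: A_def)
      qed (use \<phi>0 apos[OF i] in auto)
      moreover have "a i < (1 + \<eta>) * a i" using apos[OF i] \<eta> by simp
      ultimately show "\<forall>\<^sub>F n in sequentially. 1 / real n * (\<Sum>v\<in>V n. \<phi> i (p n v)) < (1 + \<eta>) * a i"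
        by (rule order_tendstoD(2))
    qed
    moreover have "\<forall>\<^sub>F n in sequentially. n \<ge> (1::nat)" by (rule eventually_ge_at_top)
    ultimately show "\<forall>\<^sub>F n in sequentially. \<forall>x. (\<Sum>v\<in>V n. K (p n v) x) \<le> (1 + \<eta>) * real n"
    proof eventually_elim
      case (elim n)
      show ?case
      proof
        fix x
        show "(\<Sum>v\<in>V n. K (p n v) x) \<le> (1 + \<eta>) * real n"
        proof (cases "x \<in> S")
          case True
          have "(\<Sum>v\<in>V n. K (p n v) x) = (\<Sum>v\<in>V n. \<Sum>i\<in>I. \<phi> i x / a i * \<phi> i (p n v))"
            using True by (simp add: K_def mult_ac)
          also have "\<dots> = (\<Sum>i\<in>I. \<phi> i x / a i * (\<Sum>v\<in>V n. \<phi> i (p n v)))"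
            by (subst sum.swap) (simp add: sum_distrib_left)
          also have "\<dots> \<le> (\<Sum>i\<in>I. \<phi> i x * ((1 + \<eta>) * real n))"
          proof (rule sum_mono)
            fix i assume i: "i \<in> I"
            have "(\<Sum>v\<in>V n. \<phi> i (p n v)) \<le> (1 + \<eta>) * a i * real n"
              using elim i by (fastforce simp: field_simps)
            then have "\<phi> i x / a i * (\<Sum>v\<in>V n. \<phi> i (p n v)) \<le> \<phi> i x / a i * ((1 + \<eta>) * a i * real n)"
              using \<phi>0[of i x] apos[OF i] by (intro mult_left_mono) auto
            also have "\<dots> = \<phi> i x * ((1 + \<eta>) * real n)" using apos[OF i] by simp
            finally show "\<phi> i x / a i * (\<Sum>v\<in>V n. \<phi> i (p n v)) \<le> \<phi> i x * ((1 + \<eta>) * real n)" .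
          qed
          also have "\<dots> = (1 + \<eta>) * real n" using \<phi>1[OF True] by (simp add: sum_distrib_right[symmetric])
          finally show ?thesis .
        next
          case False
          then show ?thesis using \<eta> by (simp add: K_def)
        qed
      qed
    qed
  qed
qed

section \<open>A continuous substitute for the crossing indicator\<close>

definition crossing_margin :: "(real^3) \<times> (real^3) \<times> (real^3) \<times> (real^3) \<Rightarrow> real" where
  "crossing_margin = (\<lambda>(X, Y, X', Y'). max
     (min (min (triple Y X' Y') (- triple X X' Y')) (min (- triple X Y Y') (triple X Y X')))
     (min (min (- triple Y X' Y') (triple X X' Y')) (min (triple X Y Y') (- triple X Y X'))))"

lemma crossing_margin_pos_iff: "crossing_margin (X, Y, X', Y') > 0 \<longleftrightarrow> crosses X Y X' Y'"
  by (auto simp: crossing_margin_def crosses_def less_max_iff_disj)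

lemma continuous_crossing_margin: "continuous_on A crossing_margin"
  unfolding crossing_margin_def case_prod_beta triple_eq by (intro continuous_intros)

text \<open>A continuous minorant of the indicator of \<open>crosses\<close>. Smoothing displaces
  the ends of the arcs slightly, and the indicator itself jumps at degenerate quadruples, so its
  values before and after the displacement cannot be compared.\<close>

definition soft_crossing :: "real \<Rightarrow> (real^3) \<times> (real^3) \<times> (real^3) \<times> (real^3) \<Rightarrow> real" where
  "soft_crossing \<delta> q = max 0 (min 1 (crossing_margin q / \<delta>))"

lemma soft_crossing_bounds: "0 \<le> soft_crossing \<delta> q" "soft_crossing \<delta> q \<le> 1"
  by (auto simp: soft_crossing_def)

lemma soft_crossing_zero:
  assumes "\<delta> > 0" "\<not> crosses X Y X' Y'"
  shows "soft_crossing \<delta> (X, Y, X', Y') = 0"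
proof -
  have "crossing_margin (X, Y, X', Y') / \<delta> \<le> 0"
    using assms crossing_margin_pos_iff[of X Y X' Y'] by (simp add: divide_nonpos_pos not_less)
  then show ?thesis by (simp add: soft_crossing_def)
qed

lemma continuous_soft_crossing: "\<delta> > 0 \<Longrightarrow> continuous_on A (soft_crossing \<delta>)"
  unfolding soft_crossing_def[abs_def] by (intro continuous_intros continuous_crossing_margin) auto

lemma soft_crossing_measurable[measurable (raw)]:
  assumes "\<delta> > 0" and m: "f \<in> borel_measurable M" "g \<in> borel_measurable M" "h \<in> borel_measurable M" "k \<in> borel_measurable M"
  shows "(\<lambda>x. soft_crossing \<delta> (f x, g x, h x, k x)) \<in> borel_measurable M"
proof -
  have "(\<lambda>x. (f x, g x, h x, k x)) \<in> M \<rightarrow>\<^sub>M borel"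
    unfolding borel_prod[symmetric] using m by measurable
  moreover have "soft_crossing \<delta> \<in> borel_measurable borel"
    using assms(1) by (intro borel_measurable_continuous_onI continuous_soft_crossing)
  ultimately show ?thesis by (rule measurable_compose)
qed

lemma crosses_sgn: "crosses X Y X' Y' \<Longrightarrow> crosses (sgn X) (sgn Y) (sgn X') (sgn Y')"
proof -
  assume c: "crosses X Y X' Y'"
  then have "X \<noteq> 0" "Y \<noteq> 0" "X' \<noteq> 0" "Y' \<noteq> 0"
    by (auto simp: crosses_def triple_eq)
  then have pos: "inverse (norm X) > 0" "inverse (norm Y) > 0" "inverse (norm X') > 0" "inverse (norm Y') > 0"
    by auto
  show ?thesis
    using c pos unfolding crosses_def sgn_div_norm triple_scaleR
    by (auto simp: zero_less_mult_iff mult_less_0_iff)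
qed

lemma crosses_sgn_iff: "crosses (sgn X) (sgn Y) (sgn X') (sgn Y') \<longleftrightarrow> crosses X Y X' Y'"
proof
  assume c: "crosses (sgn X) (sgn Y) (sgn X') (sgn Y')"
  then have nz: "X \<noteq> 0" "Y \<noteq> 0" "X' \<noteq> 0" "Y' \<noteq> 0"
    by (auto simp: crosses_def triple_eq)
  have "inverse (norm X) > 0" "inverse (norm Y) > 0" "inverse (norm X') > 0" "inverse (norm Y') > 0"
    using nz by auto
  then show "crosses X Y X' Y'"
    using c unfolding crosses_def sgn_div_norm triple_scaleR
    by (auto simp: zero_less_mult_iff mult_less_0_iff)
qed (rule crosses_sgn)

text \<open>A crossing quadruple has positive margin, so its soft crossing reaches 1 for large k; on
  all other quadruples both terms are 0. The product of four balls has finite volume, which provides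
  the dominating function.\<close>

lemma soft_crossing_defect_tendsto:
  defines "B \<equiv> indicator (cball 0 1) :: real^3 \<Rightarrow> ennreal"
  shows "(\<lambda>k. \<integral>\<^sup>+X. \<integral>\<^sup>+Y. \<integral>\<^sup>+X'. \<integral>\<^sup>+Y'. B X * (B Y * (B X' * (B Y' *
      ennreal ((if crosses X Y X' Y' then 1 else 0) - soft_crossing (1 / real (Suc k)) (sgn X, sgn Y, sgn X', sgn Y')))))
      \<partial>lborel \<partial>lborel \<partial>lborel \<partial>lborel) \<longlonglongrightarrow> 0"
proof -
  have [measurable]: "B \<in> borel_measurable borel"
    unfolding B_def by (intro borel_measurable_indicator) simp
  define G where "G k q = (case q of (X, Y, X', Y') \<Rightarrow> B X * (B Y * (B X' * (B Y' *
      ennreal ((if crosses X Y X' Y' then 1 else 0) - soft_crossing (1 / real (Suc k)) (sgn X, sgn Y, sgn X', sgn Y'))))))" for k q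
  define g where "g q = (case q of (X, Y, X', Y') \<Rightarrow> B X * (B Y * (B X' * B Y')))" for q
  have Gm: "G k \<in> borel_measurable borel" for k
  proof -
    have "(\<lambda>q. G k q) \<in> borel_measurable (borel \<Otimes>\<^sub>M (borel \<Otimes>\<^sub>M (borel \<Otimes>\<^sub>M borel)))"
      unfolding G_def case_prod_beta by measurable
    then show ?thesis by (simp add: borel_prod)
  qed
  have gm: "g \<in> borel_measurable borel"
  proof -
    have "(\<lambda>q. g q) \<in> borel_measurable (borel \<Otimes>\<^sub>M (borel \<Otimes>\<^sub>M (borel \<Otimes>\<^sub>M borel)))"
      unfolding g_def case_prod_beta by measurable
    then show ?thesis by (simp add: borel_prod)
  qed
  have split: "(\<integral>\<^sup>+q. F q \<partial>lborel) = (\<integral>\<^sup>+X. \<integral>\<^sup>+Y. \<integral>\<^sup>+X'. \<integral>\<^sup>+Y'. F (X, Y, X', Y') \<partial>lborel \<partial>lborel \<partial>lborel \<partial>lborel)"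
    if F: "F \<in> borel_measurable borel" for F :: "(real^3) \<times> (real^3) \<times> (real^3) \<times> (real^3) \<Rightarrow> ennreal"
  proof -
    have "(\<lambda>q. F (Q, q)) \<in> borel_measurable borel" for Q
      by (intro measurable_compose[OF _ F] borel_measurable_continuous_onI continuous_intros)
    moreover have "(\<lambda>q. F (Q, R, q)) \<in> borel_measurable borel" for Q R
      by (intro measurable_compose[OF _ F] borel_measurable_continuous_onI continuous_intros)
    ultimately show ?thesis using F by (simp add: nn_integral_lborel_Pair)
  qed
  have vol: "(\<integral>\<^sup>+Q. B Q \<partial>lborel) = ennreal (4 * pi / 3)"
    unfolding B_def by (subst nn_integral_indicator) (simp_all add: emeasure_unit_ball3)
  have "(\<lambda>k. \<integral>\<^sup>+q. G k q \<partial>lborel) \<longlonglongrightarrow> (\<integral>\<^sup>+q. 0 \<partial>(lborel :: ((real^3) \<times> (real^3) \<times> (real^3) \<times> (real^3)) measure))"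
  proof (rule nn_integral_dominated_convergence[where w = g])
    show "AE q in lborel. G k q \<le> g q" for k
    proof (rule AE_I2)
      fix q :: "(real^3) \<times> (real^3) \<times> (real^3) \<times> (real^3)"
      obtain X Y X' Y' where q: "q = (X, Y, X', Y')" by (metis prod.exhaust_sel)
      have "(if crosses X Y X' Y' then 1 else 0) - soft_crossing (1 / real (Suc k)) (sgn X, sgn Y, sgn X', sgn Y') \<le> 1"
        using soft_crossing_bounds(1)[of "1 / real (Suc k)" "(sgn X, sgn Y, sgn X', sgn Y')"] by auto
      then have "B Y' * ennreal ((if crosses X Y X' Y' then 1 else 0) - soft_crossing (1 / real (Suc k)) (sgn X, sgn Y, sgn X', sgn Y')) \<le> B Y' * 1"
        by (intro mult_left_mono) (simp_all add: ennreal_le_1)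
      then show "G k q \<le> g q" unfolding q G_def g_def prod.case by (intro mult_left_mono) simp_all
    qed
    have "(\<integral>\<^sup>+q. g q \<partial>lborel) = ennreal (4 * pi / 3) * (ennreal (4 * pi / 3) * (ennreal (4 * pi / 3) * ennreal (4 * pi / 3)))"
      by (subst split[OF gm]) (simp add: g_def nn_integral_cmult nn_integral_multc vol)
    also have "\<dots> < \<infinity>" by (simp add: ennreal_mult_less_top)
    finally show "(\<integral>\<^sup>+q. g q \<partial>lborel) < \<infinity>" .
    show "AE q in lborel. (\<lambda>k. G k q) \<longlonglongrightarrow> 0"
    proof (rule AE_I2)
      fix q :: "(real^3) \<times> (real^3) \<times> (real^3) \<times> (real^3)"
      obtain X Y X' Y' where q: "q = (X, Y, X', Y')" by (metis prod.exhaust_sel)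
      show "(\<lambda>k. G k q) \<longlonglongrightarrow> 0"
      proof (rule tendsto_eventually)
        show "\<forall>\<^sub>F k in sequentially. G k q = 0"
        proof (cases "crosses X Y X' Y'")
          case True
          define m where "m = crossing_margin (sgn X, sgn Y, sgn X', sgn Y')"
          have m: "m > 0" unfolding m_def crossing_margin_pos_iff using True by (rule crosses_sgn)
          obtain N where N: "real N > 1 / m" using reals_Archimedean2 by blast
          have "\<forall>\<^sub>F k in sequentially. k \<ge> N" by (rule eventually_ge_at_top)
          then show ?thesis
          proof eventually_elim
            case (elim k)
            have "1 / m \<le> real (Suc k)" using N elim by simp
            then have "1 \<le> m / (1 / real (Suc k))" using m by (simp add: field_simps)
            then have "soft_crossing (1 / real (Suc k)) (sgn X, sgn Y, sgn X', sgn Y') = 1"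
              unfolding soft_crossing_def m_def[symmetric] by simp
            then show ?case using True by (simp add: q G_def)
          qed
        next
          case False
          then have "\<not> crosses (sgn X) (sgn Y) (sgn X') (sgn Y')" by (simp add: crosses_sgn_iff)
          then have "soft_crossing (1 / real (Suc k)) (sgn X, sgn Y, sgn X', sgn Y') = 0" for k
            by (intro soft_crossing_zero) simp_all
          then show ?thesis using False by (simp add: q G_def)
        qed
      qed
    qed
  qed (use Gm gm in simp_all)
  then show ?thesis by (simp add: split[OF Gm]) (simp add: G_def)
qed

lemma soft_crossing_uniform:
  assumes \<delta>: "\<delta> > 0" and \<eta>: "\<eta> > 0"
  obtains \<epsilon> where "\<epsilon> > 0"
    "\<And>a b c d a' b' c' d'. {a, b, c, d, a', b', c', d'} \<subseteq> sphere 0 1 \<Longrightarrow>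
      dist a a' < \<epsilon> \<Longrightarrow> dist b b' < \<epsilon> \<Longrightarrow> dist c c' < \<epsilon> \<Longrightarrow> dist d d' < \<epsilon> \<Longrightarrow>
      soft_crossing \<delta> (a', b', c', d') \<le> soft_crossing \<delta> (a, b, c, d) + \<eta>"
proof -
  define S where "S = sphere (0::real^3) 1"
  have "compact S" by (simp add: S_def)
  then have "compact (S \<times> S \<times> S \<times> S)" by (intro compact_Times)
  then have "uniformly_continuous_on (S \<times> S \<times> S \<times> S) (soft_crossing \<delta>)"
    by (intro compact_uniformly_continuous continuous_soft_crossing \<delta>)
  then obtain e where e: "e > 0" "\<And>x x'. x \<in> S \<times> S \<times> S \<times> S \<Longrightarrow> x' \<in> S \<times> S \<times> S \<times> S \<Longrightarrow> dist x' x < e \<Longrightarrow>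
      dist (soft_crossing \<delta> x') (soft_crossing \<delta> x) < \<eta>"
    using \<eta> unfolding uniformly_continuous_on_def by metis
  have dp: "dist (x, y) (x', y') \<le> dist x x' + dist y y'" for x x' :: "'a::metric_space" and y y' :: "'b::metric_space"
    unfolding dist_Pair_Pair by (rule sqrt_sum_squares_le_sum) simp_all
  show ?thesis
  proof (rule that[of "e / 4"])
    fix a b c d a' b' c' d' :: "real^3"
    assume S: "{a, b, c, d, a', b', c', d'} \<subseteq> sphere 0 1"
      and d: "dist a a' < e / 4" "dist b b' < e / 4" "dist c c' < e / 4" "dist d d' < e / 4"
    have "dist (a', b', c', d') (a, b, c, d) \<le> dist a' a + (dist b' b + (dist c' c + dist d' d))"
      by (intro order_trans[OF dp] add_left_mono order_refl)
    also have "\<dots> < e" using d by (simp add: dist_commute)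
    finally have "dist (soft_crossing \<delta> (a', b', c', d')) (soft_crossing \<delta> (a, b, c, d)) < \<eta>"
      using S by (intro e(2)) (auto simp: S_def)
    then show "soft_crossing \<delta> (a', b', c', d') \<le> soft_crossing \<delta> (a, b, c, d) + \<eta>"
      by (simp add: dist_real_def)
  qed (use e in simp)
qed

lemma sum_soft_crossing_le:
  assumes drawing: "spherical_geodesic_drawing V E p" and \<delta>: "\<delta> > 0"
  shows "(\<Sum>q\<in>arcs E \<times> arcs E. soft_crossing \<delta> (p (fst (fst q)), p (snd (fst q)), p (fst (snd q)), p (snd (snd q))))
    \<le> 8 * real (crossing_count V E p)"
proof -
  define C where "C = {q \<in> arcs E \<times> arcs E. crosses (p (fst (fst q))) (p (snd (fst q))) (p (fst (snd q))) (p (snd (snd q)))}"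
  have fin: "finite (arcs E \<times> arcs E)" using finite_arcs[OF drawing] by simp
  have "(\<Sum>q\<in>arcs E \<times> arcs E. soft_crossing \<delta> (p (fst (fst q)), p (snd (fst q)), p (fst (snd q)), p (snd (snd q))))
    \<le> (\<Sum>q\<in>arcs E \<times> arcs E. if crosses (p (fst (fst q))) (p (snd (fst q))) (p (fst (snd q))) (p (snd (snd q))) then 1 else 0)"
    using soft_crossing_bounds(2) soft_crossing_zero[OF \<delta>] by (intro sum_mono) auto
  also have "\<dots> = real (card C)"
    using fin by (simp add: C_def sum.If_cases Int_def)
  also have "\<dots> \<le> real (8 * crossing_count V E p)"
    using crossing_arcs_le[OF drawing] unfolding C_def by (simp only: of_nat_le_iff)
  finally show ?thesis by simp
qed

text \<open>W spreads each oriented edge over the pairs of points within \<epsilon> of its ends,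
  with the kernels as weights. Its mass is known exactly, since every kernel integrates to the
  volume of the ball. In the crossing integral the indicator is replaced by the soft crossing at the
  cost \<kappa>; by uniform continuity the soft crossing of the displaced ends exceeds that of the
  vertices by at most \<eta>, and the sum over the vertices is bounded by 8 times the crossing
  count.\<close>

lemma discrete_crossing_bound:
  fixes V :: "'v set" and E p and K :: "real^3 \<Rightarrow> real^3 \<Rightarrow> real" and n :: nat
  assumes drawing: "spherical_geodesic_drawing V E p" and card: "card V = n" and n: "n \<ge> 1"
    and K0: "\<And>z x. 0 \<le> K z x" and Km[measurable]: "\<And>z. K z \<in> borel_measurable borel"
    and Kint: "\<And>z. z \<in> sphere 0 1 \<Longrightarrow> (\<integral>\<^sup>+X. indicator (cball 0 1) X * ennreal (K z (sgn X)) \<partial>lborel) = ennreal (4 * pi / 3)"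
    and Ksupp: "\<And>z x. K z x \<noteq> 0 \<Longrightarrow> x \<in> sphere 0 1 \<and> dist z x < \<epsilon>"
    and Kbd: "\<And>x. (\<Sum>v\<in>V. K (p v) x) \<le> (1 + \<eta>) * real n" and \<eta>: "\<eta> > 0"
    and \<delta>: "\<delta> > 0"
    and unif: "\<And>a b c d a' b' c' d'. {a, b, c, d, a', b', c', d'} \<subseteq> sphere 0 1 \<Longrightarrow>
      dist a a' < \<epsilon> \<Longrightarrow> dist b b' < \<epsilon> \<Longrightarrow> dist c c' < \<epsilon> \<Longrightarrow> dist d d' < \<epsilon> \<Longrightarrow>
      soft_crossing \<delta> (a', b', c', d') \<le> soft_crossing \<delta> (a, b, c, d) + \<eta>"
    and t: "0 < t" "t \<le> pi"
    and defect: "(\<integral>\<^sup>+X. \<integral>\<^sup>+Y. \<integral>\<^sup>+X'. \<integral>\<^sup>+Y'. indicator (cball 0 1) X * (indicator (cball 0 1) Y * (indicator (cball 0 1) X' * (indicator (cball 0 1) Y' *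
      ennreal ((if crosses X Y X' Y' then 1 else 0) - soft_crossing \<delta> (sgn X, sgn Y, sgn X', sgn Y')))))
      \<partial>lborel \<partial>lborel \<partial>lborel \<partial>lborel) \<le> ennreal \<kappa>" and \<kappa>: "0 \<le> \<kappa>"
  defines "D \<equiv> cap_moment t" and "b \<equiv> (1 + \<eta>)\<^sup>2"
  shows "32 * pi\<^sup>2 / 81 * D\<^sup>2 + 128 * pi\<^sup>2 / 81 * D * t * (2 * real (card E) / (real n)\<^sup>2 / b)
    \<le> 256 * pi ^ 4 / 81 * (8 * real (crossing_count V E p) / real n ^ 4 + \<eta>) + \<kappa> + 64 * pi\<^sup>2 / 81 * D * t * (1 - cos t)"
proof -
  define B :: "real^3 \<Rightarrow> ennreal" where "B = indicator (cball 0 1)"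
  have [measurable]: "B \<in> borel_measurable borel"
    unfolding B_def by (intro borel_measurable_indicator) simp
  have b: "b \<ge> 1" unfolding b_def using \<eta> by (simp add: one_le_power)
  note finV = drawing_facts(1)[OF drawing]
  have sph: "p v \<in> sphere 0 1" if "v \<in> V" for v using drawing_facts(3)[OF drawing that] by simp
  define A where "A = arcs E"
  have A: "finite A" "A \<subseteq> V \<times> V" "card A = 2 * card E"
    unfolding A_def using finite_arcs[OF drawing] arcs_subset[OF drawing] card_arcs[OF drawing] by auto
  have D: "D > 0" unfolding D_def using t by (rule cap_moment_pos)
  \<comment> \<open>The normalisation that makes W <= 1: each of the two vertex sums is at most (1 +
    \<eta>) n.\<close>
  define c where "c = 1 / ((real n)\<^sup>2 * b)"
  have c0: "0 < c" unfolding c_def using n b by simp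
  define W where "W q = c * (\<Sum>a\<in>A. K (p (fst a)) (sgn (fst q)) * K (p (snd a)) (sgn (snd q)))" for q :: "(real^3) \<times> (real^3)"
  have Wm: "W \<in> borel_measurable (borel \<Otimes>\<^sub>M borel)"
    unfolding W_def by measurable
  note [measurable] = Wm
  have W0: "0 \<le> W q" for q unfolding W_def using c0 K0 by (intro mult_nonneg_nonneg sum_nonneg) auto
  have W1: "W q \<le> 1" for q
  proof -
    have "(\<Sum>a\<in>A. K (p (fst a)) (sgn (fst q)) * K (p (snd a)) (sgn (snd q)))
      \<le> (\<Sum>a\<in>V \<times> V. K (p (fst a)) (sgn (fst q)) * K (p (snd a)) (sgn (snd q)))"
      using A finV K0 by (intro sum_mono2) auto
    also have "\<dots> = (\<Sum>v\<in>V. K (p v) (sgn (fst q))) * (\<Sum>v\<in>V. K (p v) (sgn (snd q)))"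
      unfolding sum_product by (simp add: sum.cartesian_product case_prod_beta)
    also have "\<dots> \<le> ((1 + \<eta>) * real n) * ((1 + \<eta>) * real n)"
      using \<eta> K0 by (intro mult_mono Kbd sum_nonneg) auto
    also have "\<dots> = (real n)\<^sup>2 * b" by (simp add: b_def power2_eq_square)
    finally have "W q \<le> c * ((real n)\<^sup>2 * b)" unfolding W_def using c0 by (intro mult_left_mono) auto
    also have "\<dots> = 1" unfolding c_def using n b by simp
    finally show ?thesis .
  qed
  have Wscale: "W (x *\<^sub>R X, y *\<^sub>R Y) = W (X, Y)" if "x > 0" "y > 0" for x y X Y
    using that by (simp add: W_def sgn_scaleR)
  define L where "L = 4 * pi / 3"
  have L0: "0 < L" by (simp add: L_def)
  define g where "g z X = B X * ennreal (K z (sgn X))" for z X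
  have gm[measurable]: "g z \<in> borel_measurable borel" for z unfolding g_def by measurable
  have gi: "(\<integral>\<^sup>+X. g (p v) X \<partial>lborel) = ennreal L" if "v \<in> V" for v
    unfolding g_def B_def L_def by (rule Kint[OF sph[OF that]])
  define M where "M = (\<integral>\<^sup>+X. \<integral>\<^sup>+Y. B X * (B Y * ennreal (W (X, Y))) \<partial>lborel \<partial>lborel)"
  define S where "S = (\<integral>\<^sup>+X. \<integral>\<^sup>+Y. \<integral>\<^sup>+X'. \<integral>\<^sup>+Y'. B X * (B Y * (B X' * (B Y' * (if crosses X Y X' Y' then ennreal (W (X, Y) * W (X', Y')) else 0))))
        \<partial>lborel \<partial>lborel \<partial>lborel \<partial>lborel)"
  have Wg: "B X * (B Y * ennreal (W (X, Y))) = (\<Sum>a\<in>A. ennreal c * (g (p (fst a)) X * g (p (snd a)) Y))" for X Y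
  proof -
    have "ennreal (W (X, Y)) = ennreal (\<Sum>a\<in>A. c * (K (p (fst a)) (sgn X) * K (p (snd a)) (sgn Y)))"
      by (simp add: W_def sum_distrib_left)
    also have "\<dots> = (\<Sum>a\<in>A. ennreal (c * (K (p (fst a)) (sgn X) * K (p (snd a)) (sgn Y))))"
      using c0 K0 by (intro sum_ennreal[symmetric]) simp
    also have "\<dots> = (\<Sum>a\<in>A. ennreal c * (ennreal (K (p (fst a)) (sgn X)) * ennreal (K (p (snd a)) (sgn Y))))"
      using c0 K0 by (simp add: ennreal_mult)
    finally show ?thesis unfolding g_def by (simp add: sum_distrib_left mult_ac)
  qed
  have M: "M = ennreal (L\<^sup>2 * (2 * real (card E) / (real n)\<^sup>2 / b))"
  proof -
    have "M = (\<Sum>a\<in>A. ennreal c * ((\<integral>\<^sup>+X. g (p (fst a)) X \<partial>lborel) * (\<integral>\<^sup>+Y. g (p (snd a)) Y \<partial>lborel)))"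
      unfolding M_def Wg by (simp add: nn_integral_sum nn_integral_cmult nn_integral_multc)
    also have "\<dots> = (\<Sum>a\<in>A. ennreal c * (ennreal L * ennreal L))"
      using A(2) by (intro sum.cong) (auto simp: gi)
    also have "\<dots> = (\<Sum>a\<in>A. ennreal (c * L\<^sup>2))"
      using c0 L0 by (simp add: ennreal_mult power2_eq_square)
    also have "\<dots> = ennreal (\<Sum>a\<in>A. c * L\<^sup>2)"
      using c0 by (intro sum_ennreal) simp
    also have "(\<Sum>a\<in>A. c * L\<^sup>2) = L\<^sup>2 * (2 * real (card E) / (real n)\<^sup>2 / b)"
      using A(3) by (simp add: c_def)
    finally show ?thesis .
  qed
  define s where "s q = soft_crossing \<delta> (p (fst (fst q)), p (snd (fst q)), p (fst (snd q)), p (snd (snd q)))" for q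
  have s0: "0 \<le> s q" for q unfolding s_def by (rule soft_crossing_bounds)
  define G where "G q X Y X' Y' = g (p (fst (fst q))) X * (g (p (snd (fst q))) Y * (g (p (fst (snd q))) X' * g (p (snd (snd q))) Y'))" for q X Y X' Y'
  \<comment> \<open>The products of four kernels have weight only where all four points are within
    \<epsilon> of the corresponding vertices; exactly there the soft crossing may be compared with
    its value \<open>s q\<close> at the vertices.\<close>
  have soft: "B X * (B Y * (B X' * (B Y' * ennreal (W (X, Y) * W (X', Y') * soft_crossing \<delta> (sgn X, sgn Y, sgn X', sgn Y')))))
    \<le> (\<Sum>q\<in>A \<times> A. ennreal (c\<^sup>2 * (s q + \<eta>)) * G q X Y X' Y')" for X Y X' Y'
  proof -
    define k where "k q = K (p (fst (fst q))) (sgn X) * (K (p (snd (fst q))) (sgn Y) * (K (p (fst (snd q))) (sgn X') * K (p (snd (snd q))) (sgn Y')))" for q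
    have k0: "0 \<le> k q" for q unfolding k_def by (intro mult_nonneg_nonneg K0)
    define x where "x = soft_crossing \<delta> (sgn X, sgn Y, sgn X', sgn Y')"
    have "W (X, Y) * W (X', Y') * x = (\<Sum>q\<in>A \<times> A. c\<^sup>2 * (k q * x))"
    proof -
      have "W (X, Y) * W (X', Y') = c\<^sup>2 * ((\<Sum>a\<in>A. K (p (fst a)) (sgn X) * K (p (snd a)) (sgn Y)) * (\<Sum>a\<in>A. K (p (fst a)) (sgn X') * K (p (snd a)) (sgn Y')))"
        by (simp add: W_def power2_eq_square)
      also have "\<dots> = c\<^sup>2 * (\<Sum>q\<in>A \<times> A. k q)"
        unfolding sum_product k_def by (simp add: sum.cartesian_product case_prod_beta mult.assoc)
      finally show ?thesis by (simp add: sum_distrib_left sum_distrib_right mult.assoc)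
    qed
    also have "\<dots> \<le> (\<Sum>q\<in>A \<times> A. c\<^sup>2 * (k q * (s q + \<eta>)))"
    proof (rule sum_mono, rule mult_left_mono)
      fix q assume q: "q \<in> A \<times> A"
      show "k q * x \<le> k q * (s q + \<eta>)"
      proof (cases "k q = 0")
        case False
        have V: "fst (fst q) \<in> V" "snd (fst q) \<in> V" "fst (snd q) \<in> V" "snd (snd q) \<in> V"
          using q A(2) by auto
        have "K (p (fst (fst q))) (sgn X) \<noteq> 0" "K (p (snd (fst q))) (sgn Y) \<noteq> 0"
          "K (p (fst (snd q))) (sgn X') \<noteq> 0" "K (p (snd (snd q))) (sgn Y') \<noteq> 0"
          using False by (auto simp: k_def)
        then have "x \<le> s q + \<eta>"
          unfolding x_def s_def using V sph by (intro unif) (auto dest!: Ksupp)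
        then show ?thesis using k0 by (rule mult_left_mono)
      qed simp
    qed simp
    finally have "ennreal (W (X, Y) * W (X', Y') * x) \<le> ennreal (\<Sum>q\<in>A \<times> A. c\<^sup>2 * (k q * (s q + \<eta>)))"
      by (rule ennreal_leI)
    also have "\<dots> = (\<Sum>q\<in>A \<times> A. ennreal (c\<^sup>2 * (k q * (s q + \<eta>))))"
      using k0 s0 \<eta> by (intro sum_ennreal[symmetric] mult_nonneg_nonneg add_nonneg_nonneg) auto
    also have "\<dots> = (\<Sum>q\<in>A \<times> A. ennreal (c\<^sup>2 * (s q + \<eta>)) * ennreal (k q))"
    proof (rule sum.cong)
      fix q
      have "ennreal (c\<^sup>2 * (s q + \<eta>)) * ennreal (k q) = ennreal (c\<^sup>2 * (s q + \<eta>) * k q)"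
        using k0 by (rule ennreal_mult''[symmetric])
      then show "ennreal (c\<^sup>2 * (k q * (s q + \<eta>))) = ennreal (c\<^sup>2 * (s q + \<eta>)) * ennreal (k q)"
        by (simp add: mult_ac)
    qed simp
    finally have "B X * (B Y * (B X' * (B Y' * ennreal (W (X, Y) * W (X', Y') * x))))
      \<le> B X * (B Y * (B X' * (B Y' * (\<Sum>q\<in>A \<times> A. ennreal (c\<^sup>2 * (s q + \<eta>)) * ennreal (k q)))))"
      by (intro mult_left_mono) simp_all
    also have "\<dots> = (\<Sum>q\<in>A \<times> A. ennreal (c\<^sup>2 * (s q + \<eta>)) * G q X Y X' Y')"
    proof -
      have "ennreal (k q) = ennreal (K (p (fst (fst q))) (sgn X)) * (ennreal (K (p (snd (fst q))) (sgn Y)) * (ennreal (K (p (fst (snd q))) (sgn X')) * ennreal (K (p (snd (snd q))) (sgn Y'))))" for q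
        unfolding k_def using K0 by (simp add: ennreal_mult)
      then show ?thesis unfolding G_def g_def by (simp add: sum_distrib_left mult_ac)
    qed
    finally show ?thesis unfolding x_def .
  qed
  have S: "S \<le> ennreal (L ^ 4 * (8 * real (crossing_count V E p) / real n ^ 4 + \<eta>)) + ennreal \<kappa>"
  proof -
    \<comment> \<open>For w, x in [0, 1] one has w <= w x + (1 - x), so the defect is bounded by an
      amount that does not depend on W and hence not on n.\<close>
    have pw: "B X * (B Y * (B X' * (B Y' * (if crosses X Y X' Y' then ennreal (W (X, Y) * W (X', Y')) else 0))))
      \<le> B X * (B Y * (B X' * (B Y' * ennreal (W (X, Y) * W (X', Y') * soft_crossing \<delta> (sgn X, sgn Y, sgn X', sgn Y')))))
       + B X * (B Y * (B X' * (B Y' * ennreal ((if crosses X Y X' Y' then 1 else 0) - soft_crossing \<delta> (sgn X, sgn Y, sgn X', sgn Y')))))" for X Y X' Y'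
    proof -
      define w x where "w = W (X, Y) * W (X', Y')" and "x = soft_crossing \<delta> (sgn X, sgn Y, sgn X', sgn Y')"
      have w: "0 \<le> w" "w \<le> 1" unfolding w_def using W0 W1 by (auto intro: mult_le_one)
      have x: "0 \<le> x" "x \<le> 1" unfolding x_def by (rule soft_crossing_bounds)+
      have "(if crosses X Y X' Y' then ennreal w else 0) \<le> ennreal (w * x) + ennreal ((if crosses X Y X' Y' then 1 else 0) - x)"
      proof (cases "crosses X Y X' Y'")
        case True
        have "w * (1 - x) \<le> 1 * (1 - x)" using w x by (intro mult_right_mono) auto
        then have "w \<le> w * x + (1 - x)" by (simp add: algebra_simps)
        then have "ennreal w \<le> ennreal (w * x + (1 - x))" by (rule ennreal_leI)
        also have "\<dots> = ennreal (w * x) + ennreal (1 - x)" using w x by (intro ennreal_plus) auto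
        finally show ?thesis using True by simp
      qed simp
      then show ?thesis unfolding w_def[symmetric] x_def[symmetric] distrib_left[symmetric]
        by (intro mult_left_mono) simp_all
    qed
    have [measurable]: "Measurable.pred M (\<lambda>x. 0 < \<delta>)" for M :: "'q measure" by simp
    note [measurable] = soft_crossing_measurable[OF \<delta>]
    have "S \<le> (\<integral>\<^sup>+X. \<integral>\<^sup>+Y. \<integral>\<^sup>+X'. \<integral>\<^sup>+Y'. B X * (B Y * (B X' * (B Y' * ennreal (W (X, Y) * W (X', Y') * soft_crossing \<delta> (sgn X, sgn Y, sgn X', sgn Y')))))
       + B X * (B Y * (B X' * (B Y' * ennreal ((if crosses X Y X' Y' then 1 else 0) - soft_crossing \<delta> (sgn X, sgn Y, sgn X', sgn Y'))))) \<partial>lborel \<partial>lborel \<partial>lborel \<partial>lborel)"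
      unfolding S_def by (intro nn_integral_mono pw)
    also have "\<dots> \<le> (\<integral>\<^sup>+X. \<integral>\<^sup>+Y. \<integral>\<^sup>+X'. \<integral>\<^sup>+Y'. (\<Sum>q\<in>A \<times> A. ennreal (c\<^sup>2 * (s q + \<eta>)) * G q X Y X' Y')
       + B X * (B Y * (B X' * (B Y' * ennreal ((if crosses X Y X' Y' then 1 else 0) - soft_crossing \<delta> (sgn X, sgn Y, sgn X', sgn Y'))))) \<partial>lborel \<partial>lborel \<partial>lborel \<partial>lborel)"
      by (intro nn_integral_mono add_right_mono soft)
    also have "\<dots> = (\<integral>\<^sup>+X. \<integral>\<^sup>+Y. \<integral>\<^sup>+X'. \<integral>\<^sup>+Y'. (\<Sum>q\<in>A \<times> A. ennreal (c\<^sup>2 * (s q + \<eta>)) * G q X Y X' Y') \<partial>lborel \<partial>lborel \<partial>lborel \<partial>lborel)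
       + (\<integral>\<^sup>+X. \<integral>\<^sup>+Y. \<integral>\<^sup>+X'. \<integral>\<^sup>+Y'. B X * (B Y * (B X' * (B Y' * ennreal ((if crosses X Y X' Y' then 1 else 0) - soft_crossing \<delta> (sgn X, sgn Y, sgn X', sgn Y'))))) \<partial>lborel \<partial>lborel \<partial>lborel \<partial>lborel)"
      unfolding G_def by (simp add: nn_integral_add)
    also have "\<dots> \<le> ennreal (L ^ 4 * (8 * real (crossing_count V E p) / real n ^ 4 + \<eta>)) + ennreal \<kappa>"
    proof (rule add_mono)
      show "(\<integral>\<^sup>+X. \<integral>\<^sup>+Y. \<integral>\<^sup>+X'. \<integral>\<^sup>+Y'. B X * (B Y * (B X' * (B Y' * ennreal ((if crosses X Y X' Y' then 1 else 0) - soft_crossing \<delta> (sgn X, sgn Y, sgn X', sgn Y'))))) \<partial>lborel \<partial>lborel \<partial>lborel \<partial>lborel) \<le> ennreal \<kappa>"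
        unfolding B_def by (rule defect)
      have Gi: "(\<integral>\<^sup>+X. \<integral>\<^sup>+Y. \<integral>\<^sup>+X'. \<integral>\<^sup>+Y'. G q X Y X' Y' \<partial>lborel \<partial>lborel \<partial>lborel \<partial>lborel) = ennreal (L ^ 4)" if q: "q \<in> A \<times> A" for q
      proof -
        have V: "fst (fst q) \<in> V" "snd (fst q) \<in> V" "fst (snd q) \<in> V" "snd (snd q) \<in> V"
          using q A(2) by auto
        have "(\<integral>\<^sup>+X. \<integral>\<^sup>+Y. \<integral>\<^sup>+X'. \<integral>\<^sup>+Y'. G q X Y X' Y' \<partial>lborel \<partial>lborel \<partial>lborel \<partial>lborel) = ennreal L * (ennreal L * (ennreal L * ennreal L))"
          unfolding G_def using V by (simp add: nn_integral_cmult nn_integral_multc gi)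
        also have "\<dots> = ennreal (L ^ 4)" using L0 by (simp add: ennreal_mult[symmetric] power_eq_if)
        finally show ?thesis .
      qed
      have "(\<integral>\<^sup>+X. \<integral>\<^sup>+Y. \<integral>\<^sup>+X'. \<integral>\<^sup>+Y'. (\<Sum>q\<in>A \<times> A. ennreal (c\<^sup>2 * (s q + \<eta>)) * G q X Y X' Y') \<partial>lborel \<partial>lborel \<partial>lborel \<partial>lborel)
        = (\<Sum>q\<in>A \<times> A. ennreal (c\<^sup>2 * (s q + \<eta>)) * (\<integral>\<^sup>+X. \<integral>\<^sup>+Y. \<integral>\<^sup>+X'. \<integral>\<^sup>+Y'. G q X Y X' Y' \<partial>lborel \<partial>lborel \<partial>lborel \<partial>lborel))"
        unfolding G_def by (simp add: nn_integral_sum nn_integral_cmult)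
      also have "\<dots> = (\<Sum>q\<in>A \<times> A. ennreal (c\<^sup>2 * (s q + \<eta>) * L ^ 4))"
      proof (rule sum.cong)
        fix q assume "q \<in> A \<times> A"
        then show "ennreal (c\<^sup>2 * (s q + \<eta>)) * (\<integral>\<^sup>+X. \<integral>\<^sup>+Y. \<integral>\<^sup>+X'. \<integral>\<^sup>+Y'. G q X Y X' Y' \<partial>lborel \<partial>lborel \<partial>lborel \<partial>lborel) = ennreal (c\<^sup>2 * (s q + \<eta>) * L ^ 4)"
          using L0 by (simp only: Gi) (rule ennreal_mult''[symmetric], simp)
      qed simp
      also have "\<dots> = ennreal (\<Sum>q\<in>A \<times> A. c\<^sup>2 * (s q + \<eta>) * L ^ 4)"
        using s0 \<eta> L0 by (intro sum_ennreal mult_nonneg_nonneg add_nonneg_nonneg) auto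
      also have "\<dots> \<le> ennreal (L ^ 4 * (8 * real (crossing_count V E p) / real n ^ 4 + \<eta>))"
      proof (rule ennreal_leI)
        define cr where "cr = real (crossing_count V E p)"
        have "(\<Sum>q\<in>A \<times> A. c\<^sup>2 * (s q + \<eta>) * L ^ 4) = c\<^sup>2 * L ^ 4 * ((\<Sum>q\<in>A \<times> A. s q) + real (card (A \<times> A)) * \<eta>)"
          by (simp add: sum_distrib_left sum_distrib_right sum.distrib algebra_simps)
        also have "\<dots> \<le> c\<^sup>2 * L ^ 4 * (8 * cr + real n ^ 4 * \<eta>)"
        proof (intro mult_left_mono add_mono mult_right_mono)
          show "(\<Sum>q\<in>A \<times> A. s q) \<le> 8 * cr"
            unfolding s_def A_def cr_def by (rule sum_soft_crossing_le[OF drawing \<delta>])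
          have "card A \<le> card (V \<times> V)" using A finV by (intro card_mono) auto
          then have "card A \<le> n * n" by (simp add: card card_cartesian_product)
          then have "card A * card A \<le> (n * n) * (n * n)" by (intro mult_mono) auto
          then have "real (card A * card A) \<le> real ((n * n) * (n * n))" by (simp only: of_nat_le_iff)
          then show "real (card (A \<times> A)) \<le> real n ^ 4" by (simp add: card_cartesian_product power_eq_if)
        qed (use \<eta> L0 in auto)
        \<comment> \<open>The factor b >= 1 in the denominator of c may be dropped in this upper
          bound; in the edge mass it works in the other direction and is kept.\<close>
        also have "\<dots> \<le> (1 / real n ^ 4) * L ^ 4 * (8 * cr + real n ^ 4 * \<eta>)"
        proof (intro mult_right_mono)
          have "c \<le> 1 / (real n)\<^sup>2"
            unfolding c_def using n b by (intro divide_left_mono) (auto intro: mult_pos_pos)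
          then have "c\<^sup>2 \<le> (1 / (real n)\<^sup>2)\<^sup>2" using c0 by (intro power_mono) auto
          then show "c\<^sup>2 \<le> 1 / real n ^ 4" by (simp add: power_divide flip: power_mult)
        qed (use \<eta> L0 in \<open>auto simp: cr_def\<close>)
        also have "\<dots> = L ^ 4 * (8 * cr / real n ^ 4 + \<eta>)"
          using n by (simp add: field_simps)
        finally show "(\<Sum>q\<in>A \<times> A. c\<^sup>2 * (s q + \<eta>) * L ^ 4) \<le> L ^ 4 * (8 * real (crossing_count V E p) / real n ^ 4 + \<eta>)"
          unfolding cr_def .
      qed
      finally show "(\<integral>\<^sup>+X. \<integral>\<^sup>+Y. \<integral>\<^sup>+X'. \<integral>\<^sup>+Y'. (\<Sum>q\<in>A \<times> A. ennreal (c\<^sup>2 * (s q + \<eta>)) * G q X Y X' Y') \<partial>lborel \<partial>lborel \<partial>lborel \<partial>lborel)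
        \<le> ennreal (L ^ 4 * (8 * real (crossing_count V E p) / real n ^ 4 + \<eta>))" .
    qed
    finally show ?thesis .
  qed
  define m where "m = L\<^sup>2 * (2 * real (card E) / (real n)\<^sup>2 / b)"
  have m0: "0 \<le> m" unfolding m_def using b by simp
  define R where "R = L ^ 4 * (8 * real (crossing_count V E p) / real n ^ 4 + \<eta>)"
  have R0: "0 \<le> R" unfolding R_def using L0 \<eta> by simp
  define u where "u = 64 * pi\<^sup>2 / 81 * D * t * (1 - cos t)"
  have u0: "0 \<le> u" unfolding u_def using D t by simp
  have "ennreal (32 * pi\<^sup>2 / 81 * D\<^sup>2) + ennreal (8 / 9 * D * t) * M \<le> S + ennreal u"
    unfolding M_def S_def B_def D_def u_def by (rule crossing_measure_bound[OF Wm W0 W1 Wscale t])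
  also have "\<dots> \<le> ennreal R + ennreal \<kappa> + ennreal u"
    by (intro add_right_mono) (use S in \<open>simp only: R_def\<close>)
  also have "\<dots> = ennreal (R + \<kappa> + u)" using R0 \<kappa> u0 by simp
  also have "ennreal (32 * pi\<^sup>2 / 81 * D\<^sup>2) + ennreal (8 / 9 * D * t) * M = ennreal (32 * pi\<^sup>2 / 81 * D\<^sup>2 + 8 / 9 * D * t * m)"
  proof -
    have "ennreal (8 / 9 * D * t) * M = ennreal (8 / 9 * D * t * m)"
      unfolding M m_def[symmetric] using m0 by (rule ennreal_mult''[symmetric])
    moreover have "0 \<le> 8 / 9 * D * t * m" using D t m0 by simp
    ultimately show ?thesis by (simp only: ennreal_plus zero_le_power2 mult_nonneg_nonneg divide_nonneg_nonneg zero_le_numeral)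
  qed
  finally have fin: "32 * pi\<^sup>2 / 81 * D\<^sup>2 + 8 / 9 * D * t * m \<le> R + \<kappa> + u"
    using R0 \<kappa> u0 by (subst (asm) ennreal_le_iff) auto
  have m': "8 / 9 * D * t * m = 128 * pi\<^sup>2 / 81 * D * t * (2 * real (card E) / (real n)\<^sup>2 / b)"
    unfolding m_def L_def by (simp add: power_divide power_mult_distrib)
  have L4: "L ^ 4 = 256 * pi ^ 4 / 81" unfolding L_def by (simp add: power_divide power_mult_distrib)
  show ?thesis using fin unfolding m' R_def L4 u_def .
qed

text \<open>The parameters are chosen in the order in which they depend on one another: \<eta> and
  \<kappa> from \<gamma>, then \<delta> from the defect, \<epsilon> from uniform continuity, the
  kernel from \<epsilon>, and n last. With e in place of \<omega> / b the two terms containing t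
  cancel, because 1 - cos t = 2 e, and dividing the rest by 8 L produces the constant 1 / (64
  pi^2).\<close>

lemma eventually_crossing_bound:
  fixes V :: "nat \<Rightarrow> 'v set" and E :: "nat \<Rightarrow> 'v set set" and p :: "nat \<Rightarrow> 'v \<Rightarrow> real^3" and e t \<gamma> :: real
  assumes drawing: "\<And>n. n \<ge> 1 \<Longrightarrow> spherical_geodesic_drawing (V n) (E n) (p n)"
    and card: "\<And>n. n \<ge> 1 \<Longrightarrow> card (V n) = n"
    and u: "uniform_on_sphere V p"
    and e: "e \<in> {0..1}"
    and lim: "(\<lambda>n. 2 * real (card (E n)) / real n ^ 2) \<longlonglongrightarrow> e"
    and t: "0 < t" "t \<le> pi" "cos t = 1 - 2 * e" and \<gamma>: "\<gamma> > 0"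
  shows "\<forall>\<^sub>F n in sequentially. (cap_moment t)\<^sup>2 / (64 * pi\<^sup>2) - \<gamma> \<le> real (crossing_count (V n) (E n) (p n)) / real n ^ 4"
proof -
  define D where "D = cap_moment t"
  have D: "D > 0" unfolding D_def using t(1,2) by (rule cap_moment_pos)
  define L where "L = 256 * pi ^ 4 / 81"
  have L: "L > 0" by (simp add: L_def)
  define c where "c = 128 * pi\<^sup>2 / 81 * D * t"
  have c: "c > 0" using D t by (simp add: c_def)
  \<comment> \<open>Error budget in units of L \<gamma>: 2 for L \<eta>, 2 for \<kappa> and 4 for
    replacing \<omega> / b by e. The total 8 is the factor 8 L of the normalised crossing count, so
    that exactly \<gamma> is lost.\<close>
  define \<eta> where "\<eta> = min (2 * \<gamma>) (L * \<gamma> / c)"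
  have \<eta>: "\<eta> > 0" "\<eta> \<le> 2 * \<gamma>" "\<eta> \<le> L * \<gamma> / c" using \<gamma> L c by (auto simp: \<eta>_def)
  define \<kappa> where "\<kappa> = 2 * L * \<gamma>"
  have \<kappa>: "\<kappa> > 0" using L \<gamma> by (simp add: \<kappa>_def)
  have "\<forall>\<^sub>F k in sequentially. (\<integral>\<^sup>+X. \<integral>\<^sup>+Y. \<integral>\<^sup>+X'. \<integral>\<^sup>+Y'. indicator (cball 0 1) X * (indicator (cball 0 1) Y * (indicator (cball 0 1) X' * (indicator (cball 0 1) Y' *
      ennreal ((if crosses X Y X' Y' then 1 else 0) - soft_crossing (1 / real (Suc k)) (sgn X, sgn Y, sgn X', sgn Y')))))
      \<partial>lborel \<partial>lborel \<partial>lborel \<partial>lborel) < ennreal \<kappa>"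
    by (rule order_tendstoD(2)[OF soft_crossing_defect_tendsto]) (use \<kappa> in simp)
  then obtain k where k: "(\<integral>\<^sup>+X. \<integral>\<^sup>+Y. \<integral>\<^sup>+X'. \<integral>\<^sup>+Y'. indicator (cball 0 1) X * (indicator (cball 0 1) Y * (indicator (cball 0 1) X' * (indicator (cball 0 1) Y' *
      ennreal ((if crosses X Y X' Y' then 1 else 0) - soft_crossing (1 / real (Suc k)) (sgn X, sgn Y, sgn X', sgn Y')))))
      \<partial>lborel \<partial>lborel \<partial>lborel \<partial>lborel) < ennreal \<kappa>"
    by (rule exE[OF eventually_happens'[OF sequentially_bot]])
  define \<delta> where "\<delta> = 1 / real (Suc k)"
  have \<delta>: "\<delta> > 0" by (simp add: \<delta>_def)
  obtain \<epsilon> where \<epsilon>: "\<epsilon> > 0" and unif: "\<And>a b c d a' b' c' d'. {a, b, c, d, a', b', c', d'} \<subseteq> sphere 0 1 \<Longrightarrow>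
      dist a a' < \<epsilon> \<Longrightarrow> dist b b' < \<epsilon> \<Longrightarrow> dist c c' < \<epsilon> \<Longrightarrow> dist d d' < \<epsilon> \<Longrightarrow>
      soft_crossing \<delta> (a', b', c', d') \<le> soft_crossing \<delta> (a, b, c, d) + \<eta>"
  proof (rule soft_crossing_uniform[OF \<delta> \<eta>(1)])
    fix \<epsilon> :: real
    assume "\<epsilon> > 0" and "\<And>a b c d a' b' c' d'. {a, b, c, d, a', b', c', d'} \<subseteq> sphere 0 1 \<Longrightarrow>
      dist a a' < \<epsilon> \<Longrightarrow> dist b b' < \<epsilon> \<Longrightarrow> dist c c' < \<epsilon> \<Longrightarrow> dist d d' < \<epsilon> \<Longrightarrow>
      soft_crossing \<delta> (a', b', c', d') \<le> soft_crossing \<delta> (a, b, c, d) + \<eta>"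
    then show thesis by (rule that)
  qed
  obtain K where K: "\<And>z x. 0 \<le> K z x" "\<And>z. K z \<in> borel_measurable borel"
    "\<And>z. z \<in> sphere 0 1 \<Longrightarrow> (\<integral>\<^sup>+X. indicator (cball 0 1) X * ennreal (K z (sgn X)) \<partial>lborel) = ennreal (4 * pi / 3)"
    "\<And>z x. K z x \<noteq> 0 \<Longrightarrow> x \<in> sphere 0 1 \<and> dist z x < \<epsilon>"
    "\<And>\<eta>. \<eta> > 0 \<Longrightarrow> \<forall>\<^sub>F n in sequentially. \<forall>x. (\<Sum>v\<in>V n. K (p n v) x) \<le> (1 + \<eta>) * real n"
  proof (rule smoothing_kernel_exists[OF u \<epsilon>])
    fix K :: "real^3 \<Rightarrow> real^3 \<Rightarrow> real"
    assume "\<And>z x. 0 \<le> K z x" "\<And>z. K z \<in> borel_measurable borel"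
      "\<And>z. z \<in> sphere 0 1 \<Longrightarrow> (\<integral>\<^sup>+X. indicator (cball 0 1) X * ennreal (K z (sgn X)) \<partial>lborel) = ennreal (4 * pi / 3)"
      "\<And>z x. K z x \<noteq> 0 \<Longrightarrow> x \<in> sphere 0 1 \<and> dist z x < \<epsilon>"
      "\<And>\<eta>. \<eta> > 0 \<Longrightarrow> \<forall>\<^sub>F n in sequentially. \<forall>x. (\<Sum>v\<in>V n. K (p n v) x) \<le> (1 + \<eta>) * real n"
    then show thesis by (rule that)
  qed
  have "\<forall>\<^sub>F n in sequentially. dist (2 * real (card (E n)) / real n ^ 2) e < 2 * L * \<gamma> / c"
    using lim by (rule tendstoD) (use L \<gamma> c in simp)
  moreover have "\<forall>\<^sub>F n in sequentially. n \<ge> (1::nat)" by (rule eventually_ge_at_top)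
  ultimately show ?thesis using K(5)[OF \<eta>(1)]
  proof eventually_elim
    case (elim n)
    define \<omega> where "\<omega> = 2 * real (card (E n)) / real n ^ 2"
    define b where "b = (1 + \<eta>)\<^sup>2"
    have b: "b \<ge> 1" unfolding b_def using \<eta> by (simp add: one_le_power)
    define x where "x = real (crossing_count (V n) (E n) (p n)) / real n ^ 4"
    have "32 * pi\<^sup>2 / 81 * D\<^sup>2 + 128 * pi\<^sup>2 / 81 * D * t * (\<omega> / b)
      \<le> 256 * pi ^ 4 / 81 * (8 * real (crossing_count (V n) (E n) (p n)) / real n ^ 4 + \<eta>) + \<kappa> + 64 * pi\<^sup>2 / 81 * D * t * (1 - cos t)"
      unfolding D_def \<omega>_def b_def
      by (rule discrete_crossing_bound[OF drawing card _ K(1,2,3,4) _ \<eta>(1) \<delta> unif t(1,2)])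
        (use elim k \<kappa> in \<open>auto simp: \<delta>_def\<close>)
    then have main: "32 * pi\<^sup>2 / 81 * D\<^sup>2 + c * (\<omega> / b) \<le> L * (8 * x + \<eta>) + \<kappa> + c * e"
      unfolding t(3) c_def L_def x_def by simp
    have "e - \<omega> / b \<le> 2 * L * \<gamma> / c + 2 * (L * \<gamma> / c)"
    proof -
      have "1 / b \<le> 1" using b by simp
      have "(1 - 2 * \<eta>) * b \<le> 1"
      proof -
        have "(1 - 2 * \<eta>) * b = 1 - \<eta>\<^sup>2 * (3 + 2 * \<eta>)"
          unfolding b_def by (simp add: power2_eq_square algebra_simps)
        moreover have "0 \<le> \<eta>\<^sup>2 * (3 + 2 * \<eta>)" using \<eta> by simp
        ultimately show ?thesis by linarith
      qed
      then have "1 - 1 / b \<le> 2 * \<eta>" using b by (simp add: field_simps)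
      then have 1: "e * (1 - 1 / b) \<le> 1 * (2 * \<eta>)" using e b by (intro mult_mono) auto
      have close: "\<bar>\<omega> - e\<bar> < 2 * L * \<gamma> / c" using elim by (simp add: \<omega>_def dist_real_def)
      have "(e - \<omega>) * (1 / b) \<le> \<bar>\<omega> - e\<bar> * (1 / b)"
        using b by (intro mult_right_mono) auto
      also have "\<dots> \<le> \<bar>\<omega> - e\<bar> * 1"
        using b by (intro mult_left_mono) auto
      also have "\<dots> \<le> 2 * L * \<gamma> / c" using close by simp
      finally have "(e - \<omega>) * (1 / b) \<le> 2 * L * \<gamma> / c" .
      moreover have "e - \<omega> / b = e * (1 - 1 / b) + (e - \<omega>) * (1 / b)" by (simp add: algebra_simps diff_divide_distrib)
      ultimately show ?thesis using 1 \<eta>(3) by simp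
    qed
    then have "c * (e - \<omega> / b) \<le> c * (2 * L * \<gamma> / c + 2 * (L * \<gamma> / c))"
      using c by (intro mult_left_mono) auto
    also have "\<dots> = 4 * L * \<gamma>" using c by (simp add: field_simps)
    finally have "c * e - c * (\<omega> / b) \<le> 4 * L * \<gamma>" by (simp add: algebra_simps)
    moreover have "L * \<eta> \<le> L * (2 * \<gamma>)" using L \<eta> by (intro mult_left_mono) auto
    ultimately have "32 * pi\<^sup>2 / 81 * D\<^sup>2 - 8 * L * \<gamma> \<le> 8 * L * x"
      using main unfolding \<kappa>_def by (simp add: algebra_simps)
    then have "(32 * pi\<^sup>2 / 81 * D\<^sup>2 - 8 * L * \<gamma>) / (8 * L) \<le> x"
      using L by (simp add: field_simps)
    moreover have "(32 * pi\<^sup>2 / 81 * D\<^sup>2 - 8 * L * \<gamma>) / (8 * L) = D\<^sup>2 / (64 * pi\<^sup>2) - \<gamma>"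
      using L by (simp add: diff_divide_distrib) (simp add: L_def power_eq_if)
    ultimately show ?case unfolding D_def x_def by simp
  qed
qed

theorem theorem1p7:
  fixes V :: "nat \<Rightarrow> 'v set"
    and E :: "nat \<Rightarrow> 'v set set"
    and p :: "nat \<Rightarrow> 'v \<Rightarrow> real^3"
    and e t :: real
  assumes "\<And>n. n \<ge> 1 \<Longrightarrow> spherical_geodesic_drawing (V n) (E n) (p n)"
    and "\<And>n. n \<ge> 1 \<Longrightarrow> card (V n) = n"
    and "uniform_on_sphere V p"
    and "e \<in> {0..1}"
    and "(\<lambda>n. 2 * real (card (E n)) / real n ^ 2) \<longlonglongrightarrow> e"
    and "t \<in> {0..pi}" and "cos t = 1 - 2 * e"
  shows "\<exists>r \<in> o(\<lambda>n. real n ^ 4). \<forall>n\<ge>1.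
           real (crossing_count (V n) (E n) (p n))
             \<ge> real n ^ 4 / (64 * pi\<^sup>2) * (sin t - t * cos t)\<^sup>2 - r n"
proof -
  define C where "C = (cap_moment t)\<^sup>2 / (64 * pi\<^sup>2)"
  define x where "x n = real (crossing_count (V n) (E n) (p n))" for n
  \<comment> \<open>The shortfall itself, cut off at 0. The inequality then holds for every n >= 1
    by construction, and the content is that the shortfall is o(n^4).\<close>
  define r where "r n = real n ^ 4 * max 0 (C - x n / real n ^ 4)" for n
  have ev: "\<forall>\<^sub>F n in sequentially. C - \<gamma> \<le> x n / real n ^ 4" if \<gamma>: "\<gamma> > 0" for \<gamma>
  \<comment> \<open>The tangent at t requires a positive cap moment. For t = 0 the constant C is 0
    and the bound is trivial.\<close>
  proof (cases "t = 0")
    case True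
    have "C - \<gamma> \<le> x n / real n ^ 4" for n
    proof -
      have "C = 0" by (simp add: C_def cap_moment_def True)
      moreover have "0 \<le> x n / real n ^ 4" by (simp add: x_def)
      ultimately show ?thesis using \<gamma> by simp
    qed
    then show ?thesis by simp
  next
    case False
    then have t: "0 < t" "t \<le> pi" using assms(6) by auto
    show ?thesis unfolding C_def x_def
      by (rule eventually_crossing_bound[OF assms(1-5) t assms(7) \<gamma>])
  qed
  have "r \<in> o(\<lambda>n. real n ^ 4)"
  proof (rule landau_o.smallI)
    fix c :: real assume c: "c > 0"
    from ev[OF c] show "\<forall>\<^sub>F n in sequentially. norm (r n) \<le> c * norm (real n ^ 4)"
    proof eventually_elim
      case (elim n)
      then have "max 0 (C - x n / real n ^ 4) \<le> c" using c by simp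
      then have "real n ^ 4 * max 0 (C - x n / real n ^ 4) \<le> real n ^ 4 * c"
        by (intro mult_left_mono) auto
      then show ?case by (simp add: r_def abs_mult mult.commute)
    qed
  qed
  moreover have "x n \<ge> real n ^ 4 / (64 * pi\<^sup>2) * (sin t - t * cos t)\<^sup>2 - r n" if "n \<ge> 1" for n
  proof -
    have "real n ^ 4 * (C - x n / real n ^ 4) \<le> r n"
      unfolding r_def by (intro mult_left_mono) auto
    moreover have "real n ^ 4 * (C - x n / real n ^ 4) = real n ^ 4 * C - x n"
      using that by (simp add: right_diff_distrib)
    moreover have "real n ^ 4 * C = real n ^ 4 / (64 * pi\<^sup>2) * (sin t - t * cos t)\<^sup>2"
      by (simp add: C_def cap_moment_def)
    ultimately show ?thesis by simp
  qed
  ultimately show ?thesis unfolding x_def by blast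
qed

end
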